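(* Let $1\le j\le n$, let $A_0,A_1\in \mathrm{St}(j,n)$ be complex Stiefel matrices, and let $\mathcal L_0=\mathrm{image}(A_0)$ and $\mathcal L_1=\mathrm{image}(A_1)$ be the corresponding points of the complex Grassmannian $G(j,n)$. There are $U,V\in U(j)$, $Q\in \mathrm{St}(j,n)$ and $\Theta=\mathrm{diag}(\theta_1,\ldots,\theta_j)$ with $\theta_1,\dots,\theta_j\in[0,\tfrac{\pi}{2}]$ giving the singular value decompositions (with the same $V$ and the same $\Theta$ in both) $$A_0^*A_1 = U\cos(\Theta)V^*\quad\text{and}\quad (I-A_0A_0^* )A_1 = Q\sin(\Theta)V^*,$$ and for any such data the following holds. For $t\in[0,1]$ set $$A(t) = A_0U\cos(t\Theta)U^* + Q\sin(t\Theta)U^*.$$ Then $A(t)\in \mathrm{St}(j,n)$ for all $t\in[0,1]$, and $$\mathcal L:[0,1]\to G(j,n),\qquad \mathcal L(t)=\mathrm{image}(A(t)),$$ is a length-minimizing geodesic from $\mathcal L_0$ to $\mathcal L_1$ with respect to the metric on $G(j,n)$ induced by the standard metric on $\mathrm{St}(j,n)$.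
   Context: $G(j,n)=\{\mathcal L\subset\mathbb C^n\mid \mathcal L\text{ is a complex linear subspace of dimension } j\}$ is the complex linear Grassmannian. $\mathrm{St}(j,n)=\{A\in\mathbb C^{n\times j}\mid A^*A=I\}$ is the complex Stiefel manifold, where $A^*$ is the conjugate transpose, and $U(j)$ is the unitary group. One has $G(j,n)\cong \mathrm{St}(j,n)/U(j)$ as a homogeneous space, via $A\mapsto\mathrm{image}(A)$. The metric on $G(j,n)$ is the quotient Riemannian metric induced from $\mathrm{St}(j,n)$, where $\mathrm{St}(j,n)\subset\mathbb C^{n\times j}$ carries the metric restricted from the standard metric $\langle A,B\rangle=\mathrm{Re}\,\mathrm{tr}(A^*B)$ on $\mathbb C^{n\times j}$. For a real diagonal matrix $\Theta=\mathrm{diag}(\theta_1,\dots,\theta_j)$, $\cos(\Theta)=\mathrm{diag}(\cos\theta_1,\dots,\cos\theta_j)$ and $\sin(\Theta)=\mathrm{diag}(\sin\theta_1,\dots,\sin\theta_j)$. *)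

theory Defs
  imports "HOL-Analysis.Analysis"
begin

section \<open>Matrices, Stiefel manifold, Grassmannian\<close>

definition ctranspose :: "complex^'m^'n \<Rightarrow> complex^'n^'m"
  where "ctranspose A = (\<chi> i k. cnj (A $ k $ i))"

definition diag :: "('j \<Rightarrow> real) \<Rightarrow> complex^'j^'j"
  where "diag d = (\<chi> i k. if i = k then complex_of_real (d i) else 0)"

text \<open>The complex $n \times j$ matrices are the type \<open>complex^'j^'n\<close>, with
  \<open>n = CARD('n)\<close> and \<open>j = CARD('j)\<close>.  The library inner product on this type is the
  standard metric $\mathrm{Re}\,\mathrm{tr}(A^*B)$.\<close>

lemma inner_matrix_eq:
  fixes A B :: "complex^'j^'n"
  shows "inner A B = Re (trace (ctranspose A ** B))"
proof -
  have "inner A B = (\<Sum>i\<in>UNIV. \<Sum>k\<in>UNIV. Re (cnj (A $ i $ k) * B $ i $ k))"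
    by (simp add: inner_vec_def inner_complex_def)
  also have "\<dots> = (\<Sum>k\<in>UNIV. \<Sum>i\<in>UNIV. Re (cnj (A $ i $ k) * B $ i $ k))"
    by (rule sum.swap)
  also have "\<dots> = Re (trace (ctranspose A ** B))"
    by (simp add: trace_def ctranspose_def matrix_matrix_mult_def)
  finally show ?thesis .
qed

definition stiefel :: "(complex^'j^'n) set"
  where "stiefel = {A. ctranspose A ** A = mat 1}"

definition unitary_group :: "(complex^'j^'j) set"
  where "unitary_group = {U. ctranspose U ** U = mat 1 \<and> U ** ctranspose U = mat 1}"

definition col_space :: "complex^'j^'n \<Rightarrow> (complex^'n) set"
  where "col_space A = range (\<lambda>x. A *v x)"

text \<open>The argument \<open>J\<close> of type \<open>'j itself\<close>, here and below, only carries the dimension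
  \<open>j = CARD('j)\<close>.  The constants \<open>vec.subspace\<close> and \<open>vec.dim\<close> refer to the complex
  vector space structure.\<close>

definition grassmannian :: "'j::finite itself \<Rightarrow> (complex^'n) set set"
  where "grassmannian J = {L. vec.subspace L \<and> vec.dim L = CARD('j)}"

section \<open>The quotient Riemannian metric\<close>

text \<open>The tangent space of the Stiefel manifold is the linearisation of $A^*A = I$.  The
  vertical space is the tangent space at \<open>A\<close> of the orbit $A\,U(j)$, that is, $A\,\mathfrak u(j)$
  with $\mathfrak u(j)$ the skew-Hermitian matrices.\<close>

definition stiefel_tangent :: "complex^'j^'n \<Rightarrow> (complex^'j^'n) set"
  where "stiefel_tangent A = {X. ctranspose A ** X + ctranspose X ** A = 0}"

definition vertical_space :: "complex^'j^'n \<Rightarrow> (complex^'j^'n) set"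
  where "vertical_space A = {A ** W | W :: complex^'j^'j. ctranspose W = - W}"

definition horizontal_space :: "complex^'j^'n \<Rightarrow> (complex^'j^'n) set"
  where "horizontal_space A = {X \<in> stiefel_tangent A. \<forall>Y\<in>vertical_space A. inner X Y = 0}"

definition horizontal_part :: "complex^'j^'n \<Rightarrow> complex^'j^'n \<Rightarrow> complex^'j^'n"
  where "horizontal_part A X = (THE H. H \<in> horizontal_space A \<and> X - H \<in> vertical_space A)"

lemma horizontal_part_unique:
  assumes "H \<in> horizontal_space A" "X - H \<in> vertical_space A"
  shows "horizontal_part A X = H"
  unfolding horizontal_part_def
proof (rule the_equality)
  fix K assume K: "K \<in> horizontal_space A \<and> X - K \<in> vertical_space A"
  obtain W where W: "X - H = A ** W" "ctranspose W = - W"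
    using assms by (auto simp: vertical_space_def)
  obtain Z where Z: "X - K = A ** Z" "ctranspose Z = - Z"
    using K by (auto simp: vertical_space_def)
  have "A ** (W - Z) = A ** W - A ** Z"
    by (simp add: vec_eq_iff matrix_matrix_mult_def algebra_simps sum_subtractf)
  moreover have "ctranspose (W - Z) = ctranspose W - ctranspose Z"
    by (simp add: vec_eq_iff ctranspose_def)
  ultimately have "K - H \<in> vertical_space A"
    using W Z unfolding vertical_space_def
    by (smt (verit) add_diff_cancel_left' diff_add_cancel diff_diff_eq2 mem_Collect_eq
        minus_diff_eq diff_minus_eq_add minus_diff_commute add.commute)
  then have "inner (K - H) (K - H) = 0"
    using K assms(1) by (auto simp: horizontal_space_def inner_diff_left)
  then show "K = H" by simp
qed (use assms in simp)

lemma horizontal_part_eq: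
  assumes A: "A \<in> stiefel" and X: "X \<in> stiefel_tangent A"
  shows "horizontal_part A X = X - A ** (ctranspose A ** X)"
proof (rule horizontal_part_unique)
  have ct: "ctranspose (P ** Q) = ctranspose Q ** ctranspose P"
    for P :: "complex^'p^'q" and Q :: "complex^'r^'p"
    by (simp add: vec_eq_iff ctranspose_def matrix_matrix_mult_def mult.commute)
  have cc: "ctranspose (ctranspose P) = P" for P :: "complex^'p^'q"
    by (simp add: vec_eq_iff ctranspose_def)
  have sub: "P ** (Q - R) = P ** Q - P ** R"
    for P :: "complex^'p^'q" and Q R :: "complex^'r^'p"
    by (simp add: vec_eq_iff matrix_matrix_mult_def algebra_simps sum_subtractf)
  have AA: "ctranspose A ** A = mat 1" using A by (simp add: stiefel_def)
  let ?H = "X - A ** (ctranspose A ** X)"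
  have AH: "ctranspose A ** ?H = 0"
    by (simp add: sub matrix_mul_assoc AA)
  have z: "ctranspose (0 :: complex^'p^'q) = 0" by (simp add: vec_eq_iff ctranspose_def)
  have HA: "ctranspose ?H ** A = 0"
    using ct[of "ctranspose A" ?H] by (simp add: AH cc z)
  have "inner ?H (A ** W) = 0" for W
    using HA by (simp add: inner_matrix_eq matrix_mul_assoc trace_def)
  then show "?H \<in> horizontal_space A"
    using AH HA by (auto simp: horizontal_space_def stiefel_tangent_def vertical_space_def)
  have "ctranspose (ctranspose A ** X) = - (ctranspose A ** X)"
    using X by (simp add: stiefel_tangent_def ct cc eq_neg_iff_add_eq_0 add.commute)
  then show "X - ?H \<in> vertical_space A"
    by (auto simp: vertical_space_def)
qed

text \<open>A tangent vector of the Grassmannian at \<open>col_space A\<close> is represented by \<open>X\<close> in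
  \<open>stiefel_tangent A\<close>; the quotient metric is the inner product of the horizontal parts.\<close>

definition quotient_metric :: "complex^'j^'n \<Rightarrow> complex^'j^'n \<Rightarrow> complex^'j^'n \<Rightarrow> real"
  where "quotient_metric A X Y = inner (horizontal_part A X) (horizontal_part A Y)"

definition is_lift :: "('a \<Rightarrow> complex^'j^'n) \<Rightarrow> ('a \<Rightarrow> (complex^'n) set) \<Rightarrow> 'a set \<Rightarrow> bool"
  where "is_lift A f T \<longleftrightarrow> (\<forall>y\<in>T. A y \<in> stiefel \<and> col_space (A y) = f y)"

text \<open>Differentiability of a map into the quotient manifold means existence of local
  differentiable lifts to the Stiefel manifold.  The number
  \<open>pullback_metric J f S x u v\<close> is $g_{f(x)}(df_x u, df_x v)$, where \<open>g\<close> is the quotient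
  metric, computed with any such lift; it does not depend on the lift.  It is
  used below for curves (\<open>S\<close> an interval) and for coordinate charts (\<open>S\<close> the
  real linear space on which the chart is defined, \<open>u\<close> and \<open>v\<close> in \<open>S\<close>).\<close>

definition pullback_metric ::
    "'j::finite itself \<Rightarrow> ('a::real_normed_vector \<Rightarrow> (complex^'n) set) \<Rightarrow> 'a set
      \<Rightarrow> 'a \<Rightarrow> 'a \<Rightarrow> 'a \<Rightarrow> real"
  where "pullback_metric J f S x u v = (THE r. \<exists>(A :: 'a \<Rightarrow> complex^'j^'n) A' e.
      0 < e \<and> is_lift A f (S \<inter> ball x e) \<and> (A has_derivative A') (at x within S)
      \<and> r = quotient_metric (A x) (A' u) (A' v))"

section \<open>Curves and length\<close>

definition C1_curve :: "'j::finite itself \<Rightarrow> (real \<Rightarrow> (complex^'n) set) \<Rightarrow> real set \<Rightarrow> bool"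
  where "C1_curve J \<gamma> I \<longleftrightarrow> (\<forall>t\<in>I. \<exists>(A :: real \<Rightarrow> complex^'j^'n) A' e.
      0 < e \<and> is_lift A \<gamma> (I \<inter> ball t e)
      \<and> (\<forall>s\<in>I \<inter> ball t e. (A has_vector_derivative A' s) (at s within I))
      \<and> continuous_on (I \<inter> ball t e) A')"

text \<open>\<open>S\<close> is the set of break points; the curve is $C^1$ up to the end points on every
  closed subinterval without a break point in its interior.\<close>

definition piecewise_C1_curve ::
    "'j::finite itself \<Rightarrow> (real \<Rightarrow> (complex^'n) set) \<Rightarrow> real \<Rightarrow> real \<Rightarrow> bool"
  where "piecewise_C1_curve J \<gamma> a b \<longleftrightarrow> (\<exists>S. finite S \<and>
      (\<forall>c d. a \<le> c \<and> c < d \<and> d \<le> b \<and> {c<..<d} \<inter> S = {} \<longrightarrow> C1_curve J \<gamma> {c..d}))"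

text \<open>At the finitely many break points of a piecewise $C^1$ curve the speed may be
  unspecified; this does not affect the length.\<close>

definition speed :: "'j::finite itself \<Rightarrow> (real \<Rightarrow> (complex^'n) set) \<Rightarrow> real set \<Rightarrow> real \<Rightarrow> real"
  where "speed J \<gamma> I t = sqrt (pullback_metric J \<gamma> I t 1 1)"

definition curve_length ::
    "'j::finite itself \<Rightarrow> (real \<Rightarrow> (complex^'n) set) \<Rightarrow> real \<Rightarrow> real \<Rightarrow> real"
  where "curve_length J \<gamma> a b = integral {a..b} (speed J \<gamma> {a..b})"

definition length_minimizing ::
    "'j::finite itself \<Rightarrow> (real \<Rightarrow> (complex^'n) set) \<Rightarrow> real \<Rightarrow> real \<Rightarrow> bool"
  where "length_minimizing J \<gamma> a b \<longleftrightarrow> piecewise_C1_curve J \<gamma> a b \<and>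
      (\<forall>\<delta>. piecewise_C1_curve J \<delta> a b \<and> \<delta> a = \<gamma> a \<and> \<delta> b = \<gamma> b
        \<longrightarrow> curve_length J \<gamma> a b \<le> curve_length J \<delta> a b)"

section \<open>Geodesics\<close>

text \<open>The inverse chart centred at \<open>col_space B\<close>, for \<open>B\<close> in the Stiefel manifold,
  is defined on all of \<open>horizontal_space B\<close>, which consists of the \<open>X\<close> with
  $B^*X = 0$.  Its image is the set of graphs of linear maps from \<open>col_space B\<close> to
  the orthogonal complement; a smooth lift is $(B+X)(I+X^*X)^{-1/2}$.\<close>

definition graph_chart :: "complex^'j^'n \<Rightarrow> complex^'j^'n \<Rightarrow> (complex^'n) set"
  where "graph_chart B X = col_space (B + X)"

definition chart_metric ::
    "complex^'j^'n \<Rightarrow> complex^'j^'n \<Rightarrow> complex^'j^'n \<Rightarrow> complex^'j^'n \<Rightarrow> real"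
  where "chart_metric B X u v =
      pullback_metric TYPE('j) (graph_chart B) (horizontal_space B) X u v"

text \<open>Christoffel symbols of the first kind of the Levi-Civita connection, for a metric
  given in a linear chart:
  $\Gamma(u,v;w) = \frac12 (\partial_u g(v,w) + \partial_v g(u,w) - \partial_w g(u,v))$
  for constant fields \<open>u\<close>, \<open>v\<close>, \<open>w\<close>.\<close>

definition christoffel1 ::
    "('a::real_normed_vector \<Rightarrow> 'a \<Rightarrow> 'a \<Rightarrow> real) \<Rightarrow> 'a \<Rightarrow> 'a \<Rightarrow> 'a \<Rightarrow> 'a \<Rightarrow> real"
  where "christoffel1 g x u v w =
      (deriv (\<lambda>r. g (x + r *\<^sub>R u) v w) 0 + deriv (\<lambda>r. g (x + r *\<^sub>R v) u w) 0
        - deriv (\<lambda>r. g (x + r *\<^sub>R w) u v) 0) / 2"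

text \<open>A curve is a geodesic if the covariant derivative of its velocity vanishes, that is,
  if $g(\ddot x, w) + \Gamma(\dot x, \dot x; w) = 0$ for all \<open>w\<close>, in every chart.\<close>

definition geodesic :: "'j::finite itself \<Rightarrow> (real \<Rightarrow> (complex^'n) set) \<Rightarrow> real set \<Rightarrow> bool"
  where "geodesic J \<gamma> I \<longleftrightarrow> (\<forall>t\<in>I. \<gamma> t \<in> grassmannian J \<and>
      (\<forall>B :: complex^'j^'n. B \<in> stiefel \<and> \<gamma> t \<in> graph_chart B ` horizontal_space B \<longrightarrow>
        (\<exists>x x' x'' e. 0 < e
          \<and> (\<forall>s\<in>I \<inter> ball t e. x s \<in> horizontal_space B \<and> graph_chart B (x s) = \<gamma> s
                \<and> (x has_vector_derivative x' s) (at s within I))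
          \<and> (x' has_vector_derivative x'') (at t within I)
          \<and> (\<forall>w\<in>horizontal_space B. chart_metric B (x t) x'' w
                + christoffel1 (chart_metric B) (x t) (x' t) (x' t) w = 0))))"

definition length_minimizing_geodesic_from_to ::
    "'j::finite itself \<Rightarrow> (complex^'n) set \<Rightarrow> (complex^'n) set
      \<Rightarrow> (real \<Rightarrow> (complex^'n) set) \<Rightarrow> bool"
  where "length_minimizing_geodesic_from_to J L0 L1 \<gamma> \<longleftrightarrow>
      (\<forall>t\<in>{0..1}. \<gamma> t \<in> grassmannian J) \<and> \<gamma> 0 = L0 \<and> \<gamma> 1 = L1
      \<and> geodesic J \<gamma> {0..1} \<and> length_minimizing J \<gamma> 0 1"

section \<open>The pair of singular value decompositions\<close>

definition svd_data ::
    "complex^'j^'n \<Rightarrow> complex^'j^'n \<Rightarrow> complex^'j^'j \<Rightarrow> complex^'j^'j \<Rightarrow> complex^'j^'n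
      \<Rightarrow> ('j \<Rightarrow> real) \<Rightarrow> bool"
  where "svd_data A0 A1 U V Q \<theta> \<longleftrightarrow>
      U \<in> unitary_group \<and> V \<in> unitary_group \<and> Q \<in> stiefel
      \<and> (\<forall>i. \<theta> i \<in> {0..pi / 2})
      \<and> ctranspose A0 ** A1 = U ** diag (\<lambda>i. cos (\<theta> i)) ** ctranspose V
      \<and> (mat 1 - A0 ** ctranspose A0) ** A1 = Q ** diag (\<lambda>i. sin (\<theta> i)) ** ctranspose V"

definition geodesic_lift ::
    "complex^'j^'n \<Rightarrow> complex^'j^'j \<Rightarrow> complex^'j^'n \<Rightarrow> ('j \<Rightarrow> real) \<Rightarrow> real \<Rightarrow> complex^'j^'n"
  where "geodesic_lift A0 U Q \<theta> t =
      A0 ** U ** diag (\<lambda>i. cos (t * \<theta> i)) ** ctranspose U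
      + Q ** diag (\<lambda>i. sin (t * \<theta> i)) ** ctranspose U"

end

theory Submission
  imports Defs
begin

text \<open>The main point is that no curve from \<open>col_space A0\<close> to \<open>col_space A1\<close> is shorter
  than $(\sum_i \theta_i^2)^{1/2}$. Let \<open>P\<close> be the orthogonal projection onto a moving subspace,
  $Q = I - A_0 A_0^*$ and $Z = Q P Q$, whose eigenvalues are the squared sines of the principal angles
  between the subspace and \<open>col_space A0\<close>. For a polynomial \<open>p\<close> the derivative of
  $\mathrm{tr}\,p(Z)$ is $\mathrm{tr}(p'(Z) Q P' Q)$, and the Cauchy-Schwarz inequality bounds it by
  twice the speed times $(\mathrm{tr}\,p'(Z)^2 Z (I - Z))^{1/2}$. The function
  $f(y) = \arcsin(\sqrt y)^2$ satisfies $f'(y)^2 y (1 - y) = f(y)$, so if \<open>p\<close> approximates \<open>f\<close> then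
  $(\mathrm{tr}\,p(Z))^{1/2}$ grows at most with unit speed, up to a small error, from 0
  to nearly $(\sum_i \theta_i^2)^{1/2}$. Since \<open>f'\<close> is unbounded at 1, \<open>f\<close> is first replaced by
  $\arcsin(c \sqrt y)^2$ with \<open>c < 1\<close>. Working with traces of polynomials avoids any differentiation
  of individual principal angles, which are not smooth where they coincide.

  The geodesic equation is checked in the graph charts, where the metric is
  $\mathrm{Re}\,\mathrm{tr}(u^* (I + X X^*)^{-1} v (I + X^* X)^{-1})$.\<close>

section \<open>Complex matrices and the spectral theorem\<close>

text \<open>With \<open>y = (sin \<theta>)\<^sup>2\<close> the identity for \<open>f\<close> encodes
  the eikonal equation of the distance to the starting subspace. The singularity at
  \<open>y = 1\<close> is geometric: an angle pi/2 marks the cut locus, where the distance is not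
  differentiable. Inserting \<open>c\<close> costs only a factor at most 1 in the gradient estimate,
  so the inequality keeps its direction. A second obstacle is the square root of the trace at the
  start, where the trace is 0; a small positive shift under the root removes it. The shift tends to
  0 first, because the polynomial depends on both \<open>c\<close> and the error, and
  \<open>c\<close> tends to 1 afterwards. A third obstacle is that frames are determined only up to
  U(j), and the metric is defined through arbitrary local frames. Curves are therefore studied
  through the projection, which depends on the subspace alone; the squared norm of its derivative is
  twice the squared quotient speed.\<close>

notation ctranspose ("_\<^sup>\<dagger>" [1000] 1000)

lemma matrix_add_rdistrib:
  fixes A B :: "complex^'m^'n" and C :: "complex^'p^'m"
  shows "(A + B) ** C = A ** C + B ** C"
  by (simp add: vec_eq_iff matrix_matrix_mult_def algebra_simps sum.distrib)

lemma matrix_diff_ldistrib: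
  fixes A :: "complex^'m^'n" and B C :: "complex^'p^'m"
  shows "A ** (B - C) = A ** B - A ** C"
  by (simp add: vec_eq_iff matrix_matrix_mult_def algebra_simps sum_subtractf)

lemma matrix_diff_rdistrib:
  fixes A B :: "complex^'m^'n" and C :: "complex^'p^'m"
  shows "(A - B) ** C = A ** C - B ** C"
  by (simp add: vec_eq_iff matrix_matrix_mult_def algebra_simps sum_subtractf)

lemma matrix_minus_left: "(- A) ** C = - (A ** C)"
  for A :: "complex^'m^'n" and C :: "complex^'p^'m"
  by (simp add: vec_eq_iff matrix_matrix_mult_def sum_negf)

lemma matrix_minus_right: "A ** (- C) = - (A ** C)"
  for A :: "complex^'m^'n" and C :: "complex^'p^'m"
  by (simp add: vec_eq_iff matrix_matrix_mult_def sum_negf)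

lemma matrix_scaleR_left: "(r *\<^sub>R A) ** C = r *\<^sub>R (A ** C)"
  for A :: "complex^'m^'n" and C :: "complex^'p^'m"
  by (simp add: vec_eq_iff matrix_matrix_mult_def scaleR_sum_right)

lemma matrix_scaleR_right: "A ** (r *\<^sub>R C) = r *\<^sub>R (A ** C)"
  for A :: "complex^'m^'n" and C :: "complex^'p^'m"
  by (simp add: vec_eq_iff matrix_matrix_mult_def scaleR_sum_right)

lemma matrix_zero_left: "0 ** C = 0"
  and matrix_zero_right: "A ** 0 = 0"
  for A :: "complex^'m^'n" and C :: "complex^'p^'m"
  by (simp_all add: vec_eq_iff matrix_matrix_mult_def)

lemma ct_mult: "(A ** B)\<^sup>\<dagger> = B\<^sup>\<dagger> ** A\<^sup>\<dagger>"
  by (simp add: vec_eq_iff ctranspose_def matrix_matrix_mult_def mult.commute)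

lemma ct_ct [simp]: "(A\<^sup>\<dagger>)\<^sup>\<dagger> = A"
  and ct_add: "(A + B)\<^sup>\<dagger> = A\<^sup>\<dagger> + B\<^sup>\<dagger>"
  and ct_diff: "(A - B)\<^sup>\<dagger> = A\<^sup>\<dagger> - B\<^sup>\<dagger>"
  and ct_minus: "(- A)\<^sup>\<dagger> = - A\<^sup>\<dagger>"
  and ct_scaleR: "(r *\<^sub>R A)\<^sup>\<dagger> = r *\<^sub>R A\<^sup>\<dagger>"
  and ct_zero [simp]: "0\<^sup>\<dagger> = 0"
  and ct_mat_1 [simp]: "(mat 1)\<^sup>\<dagger> = mat 1"
  and ct_diag [simp]: "(diag d)\<^sup>\<dagger> = diag d"
  by (auto simp: vec_eq_iff ctranspose_def mat_def diag_def)

lemmas mat_simps = matrix_mul_assoc[symmetric] matrix_add_ldistrib matrix_add_rdistrib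
  matrix_diff_ldistrib matrix_diff_rdistrib matrix_minus_left matrix_minus_right
  matrix_scaleR_left matrix_scaleR_right matrix_zero_left matrix_zero_right
  ct_mult ct_add ct_diff ct_minus ct_scaleR

lemma bounded_bilinear_matrix_mult:
  "bounded_bilinear ((**) :: complex^'m^'n \<Rightarrow> complex^'p^'m \<Rightarrow> complex^'p^'n)"
  unfolding bilinear_conv_bounded_bilinear[symmetric] bilinear_def
  by (auto intro!: linearI simp: mat_simps)

interpretation matrix_mult: bounded_bilinear
  "(**) :: complex^'m^'n \<Rightarrow> complex^'p^'m \<Rightarrow> complex^'p^'n"
  by (rule bounded_bilinear_matrix_mult)

lemma bounded_linear_ctranspose: "bounded_linear (ctranspose :: complex^'m^'n \<Rightarrow> _)"
  unfolding linear_conv_bounded_linear[symmetric] by (auto intro!: linearI simp: mat_simps)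

lemma inner_ct_ct: "inner (A\<^sup>\<dagger>) (B\<^sup>\<dagger>) = inner A B"
  by (subst inner_commute) (simp add: inner_matrix_eq trace_mul_sym[of A])

lemma inner_matrix_left: "inner (A ** X) Y = inner X (A\<^sup>\<dagger> ** Y)"
  by (simp add: inner_matrix_eq mat_simps)

lemma inner_matrix_right: "inner (X ** A) Y = inner X (Y ** A\<^sup>\<dagger>)"
  using inner_matrix_left[of "A\<^sup>\<dagger>" "X\<^sup>\<dagger>" "Y\<^sup>\<dagger>"] inner_ct_ct[of "X ** A" Y] inner_ct_ct[of X "Y ** A\<^sup>\<dagger>"]
  by (simp add: ct_mult)

lemma norm_ct [simp]: "norm (A\<^sup>\<dagger>) = norm A"
  by (simp add: norm_eq_sqrt_inner inner_ct_ct)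

lemma mult_diag_nth: "(A ** diag d) $ i $ k = A $ i $ k * complex_of_real (d k)"
  by (simp add: matrix_matrix_mult_def diag_def if_distrib[of "(*) _"] cong: if_cong)

lemma diag_mult: "diag d ** diag e = diag (\<lambda>i. d i * e i)"
  unfolding vec_eq_iff mult_diag_nth by (simp add: diag_def)

lemma diag_add: "diag d + diag e = diag (\<lambda>i. d i + e i)"
  and diag_diff: "diag d - diag e = diag (\<lambda>i. d i - e i)"
  and diag_scaleR: "r *\<^sub>R diag d = diag (\<lambda>i. r * d i)"
  and diag_1: "diag (\<lambda>i. 1) = mat 1"
  and diag_0: "diag (\<lambda>i. 0) = 0"
  by (auto simp: vec_eq_iff diag_def mat_def complex_eq_iff)

lemma inner_diag: "inner (diag d) (diag e) = (\<Sum>i\<in>UNIV. d i * e i)"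
proof -
  have "inner (diag d $ i) (diag e $ i) = (\<Sum>k\<in>UNIV. if i = k then d i * e i else 0)" for i
    unfolding inner_vec_def by (rule sum.cong) (auto simp: diag_def inner_complex_def)
  then show ?thesis by (subst inner_vec_def) simp
qed

lemma norm_diag_sq: "(norm (diag d))\<^sup>2 = (\<Sum>i\<in>UNIV. (d i)\<^sup>2)"
  unfolding power2_norm_eq_inner inner_diag by (simp add: power2_eq_square)

lemma trace_diag: "trace (diag d) = complex_of_real (\<Sum>i\<in>UNIV. d i)"
  by (simp add: trace_def diag_def)

lemma square_inverse_comm: "A ** B = mat 1 \<longleftrightarrow> B ** A = mat 1"
  for A B :: "complex^'j^'j"
  by (rule matrix_left_right_inverse)

lemma stiefel_unitary: "U \<in> stiefel \<longleftrightarrow> U \<in> unitary_group" for U :: "complex^'j^'j"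
  by (simp add: stiefel_def unitary_group_def square_inverse_comm[of U])

lemma unitaryD:
  assumes "U \<in> unitary_group"
  shows "U\<^sup>\<dagger> ** U = mat 1" "U ** U\<^sup>\<dagger> = mat 1" "U\<^sup>\<dagger> ** (U ** X) = X" "U ** (U\<^sup>\<dagger> ** X) = X"
  using assms by (auto simp: unitary_group_def matrix_mul_assoc)

lemma stiefelD:
  assumes "A \<in> stiefel"
  shows "A\<^sup>\<dagger> ** A = mat 1" "A\<^sup>\<dagger> ** (A ** X) = X"
  using assms by (auto simp: stiefel_def matrix_mul_assoc)

lemma norm_stiefel_mult:
  assumes "A \<in> stiefel"
  shows "norm (A ** X) = norm X"
  using assms by (simp add: norm_eq_sqrt_inner inner_matrix_left stiefelD)

lemma norm_mult_unitary_ct: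
  assumes "V \<in> unitary_group"
  shows "norm (X ** V\<^sup>\<dagger>) = norm X"
  using assms by (simp add: norm_eq_sqrt_inner inner_matrix_right mat_simps unitaryD)

section \<open>Complex inner product, orthonormal systems and diagonalisation\<close>

definition cinner :: "complex^'n \<Rightarrow> complex^'n \<Rightarrow> complex"
  where "cinner x y = (\<Sum>i\<in>UNIV. cnj (x $ i) * y $ i)"

lemma inner_eq_Re_cinner: "inner x y = Re (cinner x y)"
  by (simp add: inner_vec_def cinner_def inner_complex_def)

lemma cinner_commute: "cinner y x = cnj (cinner x y)"
  by (simp add: cinner_def mult.commute)

lemma cinner_simps:
  "cinner (x + y) z = cinner x z + cinner y z"
  "cinner x (y + z) = cinner x y + cinner x z"
  "cinner x (y - z) = cinner x y - cinner x z"
  "cinner (c *s x) y = cnj c * cinner x y"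
  "cinner x (c *s y) = c * cinner x y"
  "cinner x (r *\<^sub>R y) = complex_of_real r * cinner x y"
  "cinner (r *\<^sub>R x) y = complex_of_real r * cinner x y"
  "cinner x 0 = 0"
  by (simp_all add: cinner_def algebra_simps sum.distrib sum_subtractf sum_distrib_left
      scaleR_conv_of_real[where 'a = complex])

lemma cinner_mult: "cinner x (A *v y) = cinner (A\<^sup>\<dagger> *v x) y"
proof -
  have "cinner x (A *v y) = (\<Sum>i\<in>UNIV. \<Sum>k\<in>UNIV. cnj (x $ i) * A $ i $ k * y $ k)"
    by (simp add: cinner_def matrix_vector_mult_def sum_distrib_left mult.assoc)
  also have "\<dots> = (\<Sum>k\<in>UNIV. \<Sum>i\<in>UNIV. cnj (x $ i) * A $ i $ k * y $ k)"
    by (rule sum.swap)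
  also have "\<dots> = cinner (A\<^sup>\<dagger> *v x) y"
    by (simp add: cinner_def matrix_vector_mult_def ctranspose_def sum_distrib_left mult_ac)
  finally show ?thesis .
qed

lemma cinner_self: "cinner x x = complex_of_real ((norm x)\<^sup>2)"
proof -
  have "Im (cinner x x) = 0"
    using cinner_commute[of x x] by (metis cnj.simps(2) equal_neg_zero)
  moreover have "Re (cinner x x) = (norm x)\<^sup>2"
    by (metis inner_eq_Re_cinner power2_norm_eq_inner)
  ultimately show ?thesis
    by (simp add: complex_eq_iff)
qed

lemma ct_mult_nth: "(A\<^sup>\<dagger> ** B) $ i $ k = cinner (column i A) (column k B)"
  by (simp add: matrix_matrix_mult_def ctranspose_def cinner_def column_def)

text \<open>The library inner product is real, and complex orthogonality to \<open>q\<close> amounts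
  to real orthogonality to both \<open>q\<close> and \<open>\<i> *s q\<close>. These are at most
  \<open>2 * card T\<close> real constraints, fewer than the real dimension of the space.\<close>

lemma cinner_orthogonal_exists:
  fixes T :: "(complex^'n) set"
  assumes "finite T" "card T < CARD('n)"
  obtains x where "x \<noteq> 0" "\<And>q. q \<in> T \<Longrightarrow> cinner q x = 0"
proof -
  let ?S = "T \<union> (\<lambda>q. \<i> *s q) ` T"
  have "dim ?S \<le> card ?S"
    using assms by (intro dim_le_card') auto
  also have "\<dots> \<le> card T + card ((\<lambda>q. \<i> *s q) ` T)"
    by (rule card_Un_le)
  also have "\<dots> \<le> 2 * card T"
    using card_image_le[OF assms(1), of "\<lambda>q. \<i> *s q"] by simp
  also have "\<dots> < DIM(complex^'n)"
    using assms(2) by simp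
  finally obtain x where x: "x \<noteq> 0" "\<And>y. y \<in> span ?S \<Longrightarrow> orthogonal x y"
    using orthogonal_to_subspace_exists by blast
  show ?thesis
  proof
    fix q assume "q \<in> T"
    then have "inner q x = 0" "inner (\<i> *s q) x = 0"
      using x(2)[of q] x(2)[of "\<i> *s q"]
      by (auto simp: orthogonal_def inner_commute span_base)
    then show "cinner q x = 0"
      by (simp add: inner_eq_Re_cinner cinner_simps complex_eq_iff)
  qed (rule x(1))
qed

text \<open>This turns a diagonalised Gram matrix into a singular value decomposition. Columns with
  \<open>d i > 0\<close> are scaled to unit length; where \<open>d i = 0\<close> the column of
  \<open>N\<close> vanishes, so that column of \<open>Q\<close> may be any unit vector orthogonal to
  the others, and \<open>le\<close> leaves room for it.\<close>

lemma orthogonal_columns_normalise: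
  fixes N :: "complex^'j^'n"
  assumes le: "CARD('j) \<le> CARD('n)" and N: "N\<^sup>\<dagger> ** N = diag (\<lambda>i. (d i)\<^sup>2)"
    and d: "\<And>i. d i \<ge> 0"
  obtains Q where "Q \<in> stiefel" "N = Q ** diag d"
proof -
  have colN: "cinner (column i N) (column k N) = (if i = k then complex_of_real ((d i)\<^sup>2) else 0)" for i k
    using N ct_mult_nth[of N N i k] by (simp add: diag_def)
  let ?ok = "\<lambda>I (q :: 'j \<Rightarrow> complex^'n).
    (\<forall>i\<in>I. \<forall>k\<in>I. cinner (q i) (q k) = (if i = k then 1 else 0))
      \<and> (\<forall>i\<in>I. column i N = d i *\<^sub>R q i)"
  \<comment> \<open>The induction starts from the positive indices, whose columns are forced, and
    adjoins one further index at a time.\<close>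
  have ex: "\<exists>q. ?ok ({i. d i > 0} \<union> F) q" if "finite F" for F
    using that
  proof (induction F)
    case empty
    show ?case
      by (rule exI[of _ "\<lambda>i. (1 / d i) *\<^sub>R column i N"])
        (auto simp: cinner_simps colN power2_eq_square)
  next
    case (insert k F)
    define I where "I = {i. d i > 0} \<union> F"
    obtain q where q: "?ok I q" using insert.IH unfolding I_def by blast
    show ?case
    proof (cases "k \<in> I")
      case True
      then have "{i. d i > 0} \<union> insert k F = I" by (auto simp: I_def)
      with q show ?thesis by auto
    next
      case False
      have "card (q ` I) \<le> card I"
        by (intro card_image_le) simp
      also have "\<dots> < card (insert k I)" using False by simp
      also have "\<dots> \<le> CARD('j)" by (simp add: card_mono)
      finally have c: "card (q ` I) < CARD('n)" using le by simp
      obtain x where x: "x \<noteq> 0" "\<And>i. i \<in> I \<Longrightarrow> cinner (q i) x = 0"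
        by (rule cinner_orthogonal_exists[OF _ c]) auto
      let ?x = "(1 / norm x) *\<^sub>R x"
      have 1: "cinner ?x ?x = 1"
        using x(1) by (simp add: cinner_self)
      have 2: "cinner (q i) ?x = 0" "cinner ?x (q i) = 0" if "i \<in> I" for i
        using x(2)[OF that] cinner_commute[of "q i" x] by (simp_all add: cinner_simps)
      have dk: "d k = 0" using d[of k] False by (auto simp: I_def)
      have "cinner (column k N) (column k N) = 0" using colN[of k k] dk by simp
      then have N0: "column k N = 0" by (simp add: cinner_self)
      have "?ok (insert k I) (q(k := ?x))"
        using q 1 2 dk N0 False by (auto simp del: of_real_divide)
      moreover have "{i. d i > 0} \<union> insert k F = insert k I" by (auto simp: I_def)
      ultimately show ?thesis by metis
    qed
  qed
  obtain q :: "'j \<Rightarrow> complex^'n" where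
    q: "\<And>i k. cinner (q i) (q k) = (if i = k then 1 else 0)" "\<And>i. column i N = d i *\<^sub>R q i"
    using ex[of UNIV] by auto
  define Q :: "complex^'j^'n" where "Q = (\<chi> i k. q k $ i)"
  have col: "column k Q = q k" for k by (simp add: Q_def column_def vec_eq_iff)
  have "Q \<in> stiefel"
    using q by (auto simp: stiefel_def vec_eq_iff ct_mult_nth col mat_def)
  moreover have "N $ i $ k = (Q ** diag d) $ i $ k" for i k
    using q(2)[of k] by (simp add: mult_diag_nth Q_def vec_eq_iff column_def scaleR_conv_of_real[where 'a = complex])
  then have "N = Q ** diag d" by (simp add: vec_eq_iff)
  ultimately show ?thesis by (rule that)
qed

lemma mv_scaleR: "A *v (r *\<^sub>R x) = r *\<^sub>R (A *v x)" for A :: "complex^'m^'n"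
  by (rule linear_cmul) simp

text \<open>Variational argument: \<open>x\<close> maximises the Rayleigh quotient on the unit
  sphere of \<open>W\<close>, the complement of \<open>T\<close>. Since \<open>T\<close> consists of
  eigenvectors, \<open>W\<close> is invariant under \<open>Z\<close>, so the residual
  \<open>r\<close> is itself an admissible direction, and moving along it would increase the
  quotient unless \<open>r = 0\<close>.\<close>

lemma hermitian_eigenvector_exists:
  fixes Z :: "complex^'n^'n"
  assumes Z: "Z\<^sup>\<dagger> = Z" and fin: "finite T" "card T < CARD('n)"
    and T: "\<And>q. q \<in> T \<Longrightarrow> \<exists>l::real. Z *v q = l *\<^sub>R q"
  obtains x and l :: real where "norm x = 1" "\<And>q. q \<in> T \<Longrightarrow> cinner q x = 0" "Z *v x = l *\<^sub>R x"
proof -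
  define W where "W = {x. \<forall>q\<in>T. cinner q x = 0}"
  define K where "K = sphere 0 1 \<inter> W"
  obtain x0 where "x0 \<noteq> 0" "x0 \<in> W"
    unfolding W_def by (rule cinner_orthogonal_exists[OF fin]) simp
  then have "(1 / norm x0) *\<^sub>R x0 \<in> K"
    by (auto simp: K_def W_def cinner_simps)
  moreover have "W = (\<Inter>q\<in>T. {x. cinner q x = 0})" by (auto simp: W_def)
  then have "closed W"
    by (auto simp: cinner_def intro!: closed_INT closed_Collect_eq continuous_intros)
  then have "compact K" unfolding K_def by (intro compact_Int_closed) auto
  moreover have "continuous_on K (\<lambda>y. inner y (Z *v y))"
    by (intro continuous_intros linear_continuous_on)
      (simp add: linear_conv_bounded_linear[symmetric])
  ultimately obtain x where x: "x \<in> K" "\<And>y. y \<in> K \<Longrightarrow> inner y (Z *v y) \<le> inner x (Z *v x)"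
    using continuous_attains_sup[of K "\<lambda>y. inner y (Z *v y)"] by blast
  define l where "l = inner x (Z *v x)"
  have nx: "norm x = 1" and xW: "x \<in> W" using x by (auto simp: K_def)
  have bound: "inner w (Z *v w) \<le> l * (norm w)\<^sup>2" if "w \<in> W" for w
  proof (cases "w = 0")
    case False
    have "(1 / norm w) *\<^sub>R w \<in> K"
      using that False by (auto simp: K_def W_def cinner_simps)
    then have "inner ((1 / norm w) *\<^sub>R w) (Z *v ((1 / norm w) *\<^sub>R w)) \<le> l"
      using x l_def by blast
    then have "inner w (Z *v w) / (norm w)\<^sup>2 \<le> l"
      by (simp add: mv_scaleR power2_eq_square)
    then show ?thesis using False
      by (simp add: pos_divide_le_eq)
  qed simp
  have sym: "inner a (Z *v b) = inner (Z *v a) b" for a b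
    using Z by (simp add: inner_eq_Re_cinner cinner_mult)
  define r where "r = Z *v x - l *\<^sub>R x"
  have "cinner q (Z *v x) = 0" if q: "q \<in> T" for q
  proof -
    obtain m :: real where "Z *v q = m *\<^sub>R q" using T[OF q] by blast
    then show ?thesis using xW q Z by (simp add: cinner_mult cinner_simps W_def)
  qed
  then have rW: "r \<in> W"
    using xW by (auto simp: r_def W_def cinner_simps)
  have xx: "inner x x = 1" using nx by (simp add: norm_eq_1)
  have rx: "inner r x = 0"
    unfolding r_def inner_diff_left inner_scaleR_left xx l_def
    using inner_commute[of "Z *v x" x] by simp
  have "Z *v x = r + l *\<^sub>R x" by (simp add: r_def)
  then have rZx: "inner r (Z *v x) = (norm r)\<^sup>2"
    using rx by (simp add: inner_add_right power2_norm_eq_inner)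
  then have xZr: "inner x (Z *v r) = (norm r)\<^sup>2"
    using sym[of x r] inner_commute[of r "Z *v x"] by simp
  define C where "C = l * (norm r)\<^sup>2 - inner r (Z *v r)"
  have ineq: "2 * t * (norm r)\<^sup>2 \<le> t\<^sup>2 * C" for t
  proof -
    have w: "x + t *\<^sub>R r \<in> W" using xW rW by (auto simp: W_def cinner_simps)
    have "inner (x + t *\<^sub>R r) (Z *v (x + t *\<^sub>R r)) = l + 2 * t * (norm r)\<^sup>2 + t\<^sup>2 * inner r (Z *v r)"
      unfolding matrix_vector_right_distrib mv_scaleR inner_add_left inner_add_right
        inner_scaleR_left inner_scaleR_right rZx xZr l_def[symmetric]
      by (simp add: power2_eq_square[of t] algebra_simps)
    moreover have "(norm (x + t *\<^sub>R r))\<^sup>2 = 1 + t\<^sup>2 * (norm r)\<^sup>2"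
      using nx rx inner_commute[of r x]
      unfolding power2_norm_eq_inner by (simp add: inner_add_left inner_add_right power2_eq_square xx)
    ultimately show ?thesis using bound[OF w] by (simp add: C_def algebra_simps)
  qed
  have "(norm r)\<^sup>2 \<le> 0"
  proof (rule ccontr)
    assume "\<not> (norm r)\<^sup>2 \<le> 0"
    then have p: "(norm r)\<^sup>2 > 0" by simp
    \<comment> \<open>Small enough that, after division by \<open>t\<close>, the second order term
      \<open>t * C\<close> is at most half of the first order gain
      \<open>2 * (norm r)\<^sup>2\<close>.\<close>
    define t where "t = (norm r)\<^sup>2 / (\<bar>C\<bar> + 1)"
    have t: "t > 0" using p by (simp add: t_def)
    have "2 * t * (norm r)\<^sup>2 \<le> t * (t * C)" using ineq[of t] by (simp add: power2_eq_square)
    then have "2 * (norm r)\<^sup>2 \<le> t * C" using t by (simp add: mult.assoc mult.left_commute[of 2])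
    also have "\<dots> \<le> t * (\<bar>C\<bar> + 1)" using t by (intro mult_left_mono) auto
    also have "\<dots> = (norm r)\<^sup>2" by (simp add: t_def)
    finally show False using p by simp
  qed
  then have "Z *v x = l *\<^sub>R x" by (simp add: r_def)
  then show ?thesis using that nx xW unfolding W_def by blast
qed

text \<open>Orthonormal eigenvectors are adjoined one at a time, each found in the complement of the
  earlier ones.\<close>

lemma hermitian_diagonalisation:
  fixes Z :: "complex^'n^'n"
  assumes Z: "Z\<^sup>\<dagger> = Z"
  obtains V s where "V \<in> unitary_group" "Z = V ** diag s ** V\<^sup>\<dagger>"
proof -
  have "\<exists>(v :: 'n \<Rightarrow> complex^'n) s. (\<forall>i\<in>I. \<forall>k\<in>I. cinner (v i) (v k) = (if i = k then 1 else 0))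
      \<and> (\<forall>i\<in>I. Z *v v i = s i *\<^sub>R v i)" if "finite I" for I
    using that
  proof (induction I)
    case (insert k I)
    then obtain v :: "'n \<Rightarrow> complex^'n" and s :: "'n \<Rightarrow> real" where
      v: "\<And>i l. i \<in> I \<Longrightarrow> l \<in> I \<Longrightarrow> cinner (v i) (v l) = (if i = l then 1 else 0)"
      "\<And>i. i \<in> I \<Longrightarrow> Z *v v i = s i *\<^sub>R v i" by blast
    have "card (v ` I) \<le> card I" by (intro card_image_le) simp
    also have "\<dots> < card (insert k I)" using insert by simp
    also have "\<dots> \<le> CARD('n)" by (simp add: card_mono)
    finally have c: "card (v ` I) < CARD('n)" .
    obtain x and l :: real where x: "norm x = 1" "\<And>q. q \<in> v ` I \<Longrightarrow> cinner q x = 0"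
      "Z *v x = l *\<^sub>R x"
      using hermitian_eigenvector_exists[OF Z _ c] insert.hyps(1) v(2) by blast
    have "cinner x x = 1" using x(1) by (simp add: cinner_self)
    moreover have "cinner (v i) x = 0" "cinner x (v i) = 0" if "i \<in> I" for i
      using x(2)[of "v i"] cinner_commute[of "v i" x] that by auto
    ultimately show ?case
      using v x(3) insert.hyps
      by (intro exI[of _ "v(k := x)"] exI[of _ "s(k := l)"]) auto
  qed simp
  from this[of UNIV] obtain v :: "'n \<Rightarrow> complex^'n" and s :: "'n \<Rightarrow> real" where
    v: "\<And>i k. cinner (v i) (v k) = (if i = k then 1 else 0)" "\<And>i. Z *v v i = s i *\<^sub>R v i"
    by auto
  define V :: "complex^'n^'n" where "V = (\<chi> i k. v k $ i)"
  have col: "column k V = v k" for k by (simp add: V_def column_def vec_eq_iff)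
  have V: "V \<in> unitary_group"
    unfolding stiefel_unitary[symmetric]
    using v by (auto simp: stiefel_def vec_eq_iff ct_mult_nth col mat_def)
  have "(Z ** V) $ i $ k = (V ** diag s) $ i $ k" for i k
  proof -
    have "(Z ** V) $ i $ k = (Z *v v k) $ i"
      by (simp add: matrix_matrix_mult_def matrix_vector_mult_def V_def)
    then show ?thesis by (simp add: v(2) mult_diag_nth V_def scaleR_conv_of_real[where 'a = complex])
  qed
  then have "Z ** V = V ** diag s" by (simp add: vec_eq_iff)
  then have "Z ** V ** V\<^sup>\<dagger> = V ** diag s ** V\<^sup>\<dagger>" by simp
  then show ?thesis using that V by (simp add: matrix_mul_assoc[symmetric] unitaryD)
qed

text \<open>Spectral bounds are later obtained by estimating the Rayleigh quotient of a column of
  \<open>V\<close>.\<close>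

lemma diagonalisation_entry:
  fixes Z V :: "complex^'n^'n"
  assumes "V \<in> unitary_group" "Z = V ** diag s ** V\<^sup>\<dagger>"
  shows "s i = inner (column i V) (Z *v column i V)" "norm (column i V) = 1"
proof -
  have "V\<^sup>\<dagger> ** (Z ** V) = diag s"
    using assms by (simp add: matrix_mul_assoc[symmetric] unitaryD)
  moreover have "column i (Z ** V) = Z *v column i V"
    by (simp add: column_def vec_eq_iff matrix_matrix_mult_def matrix_vector_mult_def)
  ultimately have "cinner (column i V) (Z *v column i V) = diag s $ i $ i"
    by (metis ct_mult_nth)
  then show "s i = inner (column i V) (Z *v column i V)"
    by (simp add: inner_eq_Re_cinner diag_def)
  have "cinner (column i V) (column i V) = 1"
    using unitaryD(1)[OF assms(1)] ct_mult_nth[of V V i i] by (simp add: mat_def)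
  then show "norm (column i V) = 1"
    by (simp add: cinner_self power2_eq_1_iff flip: of_real_power) (smt (verit) norm_ge_zero)
qed

section \<open>Projections and the quotient metric\<close>

lemma col_space_subset_project: "col_space A \<subseteq> col_space B \<Longrightarrow> B \<in> stiefel \<Longrightarrow> B ** (B\<^sup>\<dagger> ** A) = A"
proof -
  assume AB: "col_space A \<subseteq> col_space B" and B: "B \<in> stiefel"
  have "(B ** (B\<^sup>\<dagger> ** A)) *v x = A *v x" for x
  proof -
    obtain y where "A *v x = B *v y" using AB by (auto simp: col_space_def)
    then show ?thesis
      using B by (simp add: matrix_vector_mul_assoc[symmetric])
        (simp add: matrix_vector_mul_assoc matrix_mul_assoc[symmetric] stiefelD)
  qed
  then show ?thesis by (simp add: matrix_eq)
qed

lemma col_space_mult_subset: "col_space (A ** C) \<subseteq> col_space A"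
  by (auto simp: col_space_def matrix_vector_mul_assoc[symmetric])

lemma col_space_mult_invertible:
  assumes "C ** D = mat 1"
  shows "col_space (A ** C) = col_space A"
proof
  have "A = (A ** C) ** D" using assms by (simp add: matrix_mul_assoc[symmetric])
  then show "col_space A \<subseteq> col_space (A ** C)" using col_space_mult_subset by metis
qed (rule col_space_mult_subset)

text \<open>The subspace determines this matrix whatever frame represents it, so its derivative
  along a curve does not depend on a lift. For column spaces of Stiefel matrices
  \<open>proj_col_space\<close> justifies the \<open>THE\<close>.\<close>

definition proj :: "(complex^'n) set \<Rightarrow> complex^'n^'n"
  where "proj L = (THE P. P\<^sup>\<dagger> = P \<and> P ** P = P \<and> col_space P = L)"

lemma proj_col_space:
  assumes A: "A \<in> stiefel"
  shows "proj (col_space A) = A ** A\<^sup>\<dagger>"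
  unfolding proj_def
proof (rule the_equality)
  let ?P = "A ** A\<^sup>\<dagger>"
  have "A = ?P ** A" using A by (simp add: mat_simps stiefelD)
  then have "col_space ?P = col_space A"
    using col_space_mult_subset[of ?P A] col_space_mult_subset[of A "A\<^sup>\<dagger>"] by auto
  then show P: "?P\<^sup>\<dagger> = ?P \<and> ?P ** ?P = ?P \<and> col_space ?P = col_space A"
    using A by (simp add: mat_simps stiefelD)
  have *: "Q ** R = R" if "Q ** Q = Q" "col_space R \<subseteq> col_space Q" for Q R :: "complex^'b^'b"
  proof -
    have "(Q ** R) *v x = R *v x" for x
    proof -
      have "R *v x \<in> col_space Q" using that(2) by (auto simp: col_space_def)
      then obtain y where "R *v x = Q *v y" by (auto simp: col_space_def)
      then show ?thesis using that(1) by (simp add: matrix_vector_mul_assoc[symmetric])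
          (simp add: matrix_vector_mul_assoc)
    qed
    then show ?thesis by (simp add: matrix_eq)
  qed
  \<comment> \<open>Each of two self-adjoint projections with the same range fixes the other; taking
    the adjoint of one identity makes them equal.\<close>
  fix Q assume Q: "Q\<^sup>\<dagger> = Q \<and> Q ** Q = Q \<and> col_space Q = col_space A"
  then have "Q ** ?P = ?P" "?P ** Q = Q" using P by (auto intro!: *)
  then show "Q = ?P" using P Q by (metis ct_mult)
qed

lemma stiefel_tangent_skew:
  assumes "X \<in> stiefel_tangent A"
  shows "X\<^sup>\<dagger> ** A = - (A\<^sup>\<dagger> ** X)"
  using assms by (simp add: stiefel_tangent_def eq_neg_iff_add_eq_0 add.commute)

text \<open>\<open>X ** A\<^sup>\<dagger> + A ** X\<^sup>\<dagger>\<close> is the derivative of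
  \<open>A ** A\<^sup>\<dagger>\<close> in direction \<open>X\<close>. Vertical components cancel in
  it, and the horizontal part appears in two mutually orthogonal blocks that contribute equally,
  hence the factor 1/2.\<close>

lemma quotient_metric_proj:
  assumes A: "A \<in> stiefel" and X: "X \<in> stiefel_tangent A" and Y: "Y \<in> stiefel_tangent A"
  shows "quotient_metric A X Y
    = inner (X ** A\<^sup>\<dagger> + A ** X\<^sup>\<dagger>) (Y ** A\<^sup>\<dagger> + A ** Y\<^sup>\<dagger>) / 2"
proof -
  let ?h = "horizontal_part A"
  have h: "A\<^sup>\<dagger> ** ?h Z = 0" "(?h Z)\<^sup>\<dagger> ** A = 0"
    "Z ** A\<^sup>\<dagger> + A ** Z\<^sup>\<dagger> = ?h Z ** A\<^sup>\<dagger> + A ** (?h Z)\<^sup>\<dagger>"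
    if "Z \<in> stiefel_tangent A" for Z
    using A stiefel_tangent_skew[OF that]
    by (simp_all add: horizontal_part_eq[OF A that] mat_simps stiefelD)
  have 1: "inner (?h X ** A\<^sup>\<dagger>) (?h Y ** A\<^sup>\<dagger>) = inner (?h X) (?h Y)"
    by (simp add: inner_matrix_right mat_simps stiefelD[OF A])
  have 2: "inner (A ** (?h X)\<^sup>\<dagger>) (A ** (?h Y)\<^sup>\<dagger>) = inner (?h X) (?h Y)"
    unfolding inner_matrix_left stiefelD[OF A] by (rule inner_ct_ct)
  have 3: "inner (?h X ** A\<^sup>\<dagger>) (A ** (?h Y)\<^sup>\<dagger>) = 0"
    unfolding inner_matrix_right by (simp add: mat_simps h(2)[OF Y])
  have 4: "inner (A ** (?h X)\<^sup>\<dagger>) (?h Y ** A\<^sup>\<dagger>) = 0"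
    unfolding inner_matrix_left by (simp add: matrix_mul_assoc h(1)[OF Y] matrix_zero_left)
  show ?thesis
    unfolding quotient_metric_def h(3)[OF X] h(3)[OF Y]
    by (simp add: inner_add_left inner_add_right 1 2 3 4)
qed

text \<open>A derivative within \<open>S\<close> is determined only along directions in which
  \<open>S\<close> accumulates at the point. This form covers the end points of an interval as well
  as the linear domain of a chart.\<close>

lemma has_derivative_unique_direction:
  assumes "(f has_derivative f1) (at x within S)" "(f has_derivative f2) (at x within S)"
    and lim: "(0::real) islimpt {r. x + r *\<^sub>R u \<in> S}"
  shows "f1 u = f2 u"
proof -
  let ?T = "{r. x + r *\<^sub>R u \<in> S}"
  have *: "((\<lambda>r. f (x + r *\<^sub>R u)) has_vector_derivative f' u) (at 0 within ?T)"
    if f': "(f has_derivative f') (at x within S)" for f'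
  proof -
    have g: "((\<lambda>r. x + r *\<^sub>R u) has_derivative (\<lambda>r. r *\<^sub>R u)) (at 0 within ?T)"
      by (auto intro!: derivative_eq_intros)
    have "(f has_derivative f') (at (x + 0 *\<^sub>R u) within (\<lambda>r. x + r *\<^sub>R u) ` ?T)"
      using f' by (auto intro: has_derivative_subset)
    from has_derivative_in_compose[OF g this]
    have "((\<lambda>r. f (x + r *\<^sub>R u)) has_derivative (\<lambda>r. f' (r *\<^sub>R u))) (at 0 within ?T)" .
    moreover have "f' (r *\<^sub>R u) = r *\<^sub>R f' u" for r
      using has_derivative_linear[OF f'] by (rule linear_cmul)
    ultimately show ?thesis by (simp add: has_vector_derivative_def)
  qed
  show ?thesis
    using vector_derivative_unique_within[OF _ *[OF assms(1)] *[OF assms(2)]] lim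
    by (simp add: trivial_limit_within)
qed

text \<open>Tangency in the second part comes from differentiating the constant
  \<open>(A y)\<^sup>\<dagger> ** A y = mat 1\<close>.\<close>

lemma lift_proj_derivative:
  fixes A :: "'a::real_normed_vector \<Rightarrow> complex^'j^'n"
  assumes e: "0 < e" "is_lift A f (S \<inter> ball x e)" and x: "x \<in> S"
    and A': "(A has_derivative A') (at x within S)"
  shows "((\<lambda>y. proj (f y)) has_derivative (\<lambda>w. A' w ** (A x)\<^sup>\<dagger> + A x ** (A' w)\<^sup>\<dagger>)) (at x within S)"
    and "(0::real) islimpt {r. x + r *\<^sub>R u \<in> S} \<Longrightarrow> A' u \<in> stiefel_tangent (A x)"
proof -
  have ct': "((\<lambda>y. (A y)\<^sup>\<dagger>) has_derivative (\<lambda>w. (A' w)\<^sup>\<dagger>)) (at x within S)"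
    using bounded_linear.has_derivative[OF bounded_linear_ctranspose A'] .
  have "((\<lambda>y. A y ** (A y)\<^sup>\<dagger>) has_derivative (\<lambda>w. A x ** (A' w)\<^sup>\<dagger> + A' w ** (A x)\<^sup>\<dagger>)) (at x within S)"
    by (rule matrix_mult.FDERIV[OF A' ct'])
  then have "((\<lambda>y. A y ** (A y)\<^sup>\<dagger>) has_derivative (\<lambda>w. A' w ** (A x)\<^sup>\<dagger> + A x ** (A' w)\<^sup>\<dagger>)) (at x within S)"
    by (simp add: add.commute)
  then show "((\<lambda>y. proj (f y)) has_derivative (\<lambda>w. A' w ** (A x)\<^sup>\<dagger> + A x ** (A' w)\<^sup>\<dagger>)) (at x within S)"
  proof (rule has_derivative_transform_within[OF _ e(1) x])
    fix y assume "y \<in> S" "dist y x < e"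
    then have "A y \<in> stiefel" "col_space (A y) = f y"
      using e(2) by (auto simp: is_lift_def dist_commute)
    then show "A y ** (A y)\<^sup>\<dagger> = proj (f y)" using proj_col_space by metis
  qed
  assume lim: "(0::real) islimpt {r. x + r *\<^sub>R u \<in> S}"
  have "((\<lambda>y. (A y)\<^sup>\<dagger> ** A y) has_derivative (\<lambda>w. (A x)\<^sup>\<dagger> ** A' w + (A' w)\<^sup>\<dagger> ** A x)) (at x within S)"
    by (rule matrix_mult.FDERIV[OF ct' A'])
  then have "((\<lambda>y. mat 1) has_derivative (\<lambda>w. (A x)\<^sup>\<dagger> ** A' w + (A' w)\<^sup>\<dagger> ** A x)) (at x within S)"
  proof (rule has_derivative_transform_within[OF _ e(1) x])
    fix y assume "y \<in> S" "dist y x < e"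
    then show "(A y)\<^sup>\<dagger> ** A y = mat 1"
      using e(2) by (auto simp: is_lift_def dist_commute stiefelD)
  qed
  from has_derivative_unique_direction[OF this has_derivative_const lim]
  show "A' u \<in> stiefel_tangent (A x)" by (simp add: stiefel_tangent_def)
qed

text \<open>Independence of the lift: two lifts give the same projection, hence the same derivative
  of it in the directions \<open>u\<close> and \<open>v\<close>, and
  \<open>quotient_metric_proj\<close> expresses the metric through that derivative.\<close>

lemma pullback_metric_lift:
  fixes A :: "'a::real_normed_vector \<Rightarrow> complex^'j^'n"
  assumes e: "0 < e" "is_lift A f (S \<inter> ball x e)" and x: "x \<in> S"
    and A': "(A has_derivative A') (at x within S)"
    and u: "(0::real) islimpt {r. x + r *\<^sub>R u \<in> S}" and v: "(0::real) islimpt {r. x + r *\<^sub>R v \<in> S}"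
  shows "pullback_metric TYPE('j) f S x u v = quotient_metric (A x) (A' u) (A' v)"
  unfolding pullback_metric_def
proof (rule the_equality)
  show "\<exists>(B :: 'a \<Rightarrow> complex^'j^'n) B' d. 0 < d \<and> is_lift B f (S \<inter> ball x d)
      \<and> (B has_derivative B') (at x within S)
      \<and> quotient_metric (A x) (A' u) (A' v) = quotient_metric (B x) (B' u) (B' v)"
    using e A' by blast
  fix r assume "\<exists>(B :: 'a \<Rightarrow> complex^'j^'n) B' d. 0 < d \<and> is_lift B f (S \<inter> ball x d)
      \<and> (B has_derivative B') (at x within S) \<and> r = quotient_metric (B x) (B' u) (B' v)"
  then obtain B :: "'a \<Rightarrow> complex^'j^'n" and B' d where B: "0 < d" "is_lift B f (S \<inter> ball x d)"
    "(B has_derivative B') (at x within S)" "r = quotient_metric (B x) (B' u) (B' v)" by blast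
  have AB: "A x \<in> stiefel" "B x \<in> stiefel"
    using e B x by (auto simp: is_lift_def)
  have "A' w ** (A x)\<^sup>\<dagger> + A x ** (A' w)\<^sup>\<dagger> = B' w ** (B x)\<^sup>\<dagger> + B x ** (B' w)\<^sup>\<dagger>"
    if "(0::real) islimpt {r. x + r *\<^sub>R w \<in> S}" for w
    using has_derivative_unique_direction[OF lift_proj_derivative(1)[OF e x A']
        lift_proj_derivative(1)[OF B(1,2) x B(3)] that] .
  then show "r = quotient_metric (A x) (A' u) (A' v)"
    using u v unfolding B(4)
    by (simp add: quotient_metric_proj AB lift_proj_derivative(2)[OF e x A']
        lift_proj_derivative(2)[OF B(1,2) x B(3)])
qed

lemma islimpt_interval_direction:
  fixes a b t :: real
  assumes "a < b" "t \<in> {a..b}"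
  shows "(0::real) islimpt {r. t + r *\<^sub>R 1 \<in> {a..b}}"
proof -
  have "{r. t + r *\<^sub>R 1 \<in> {a..b}} = {a - t..b - t}" by auto
  moreover have "0 islimpt {a - t..b - t}"
    using assms by (intro connected_imp_perfect) auto
  ultimately show ?thesis by simp
qed

lemma speed_lift:
  fixes A :: "real \<Rightarrow> complex^'j^'n"
  assumes ab: "a < b" "t \<in> {a..b}" and e: "0 < e" "is_lift A \<gamma> ({a..b} \<inter> ball t e)"
    and A': "(A has_vector_derivative A') (at t within {a..b})"
  shows "speed TYPE('j) \<gamma> {a..b} t = norm (A' - A t ** ((A t)\<^sup>\<dagger> ** A'))"
    and "((\<lambda>t. proj (\<gamma> t)) has_vector_derivative A' ** (A t)\<^sup>\<dagger> + A t ** A'\<^sup>\<dagger>) (at t within {a..b})"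
    and "(speed TYPE('j) \<gamma> {a..b} t)\<^sup>2 = (norm (A' ** (A t)\<^sup>\<dagger> + A t ** A'\<^sup>\<dagger>))\<^sup>2 / 2"
proof -
  have d: "(A has_derivative (\<lambda>x. x *\<^sub>R A')) (at t within {a..b})"
    using A' by (simp add: has_vector_derivative_def)
  note l = islimpt_interval_direction[OF ab]
  have St: "A t \<in> stiefel" using e ab by (auto simp: is_lift_def)
  have tan: "A' \<in> stiefel_tangent (A t)"
    using lift_proj_derivative(2)[OF e ab(2) d l] by simp
  have pb: "pullback_metric TYPE('j) \<gamma> {a..b} t 1 1 = quotient_metric (A t) A' A'"
    using pullback_metric_lift[OF e ab(2) d l l] by simp
  then show "speed TYPE('j) \<gamma> {a..b} t = norm (A' - A t ** ((A t)\<^sup>\<dagger> ** A'))"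
    by (simp add: speed_def quotient_metric_def horizontal_part_eq[OF St tan] norm_eq_sqrt_inner)
  show "((\<lambda>t. proj (\<gamma> t)) has_vector_derivative A' ** (A t)\<^sup>\<dagger> + A t ** A'\<^sup>\<dagger>) (at t within {a..b})"
    using lift_proj_derivative(1)[OF e ab(2) d]
    by (simp add: has_vector_derivative_def mat_simps scaleR_add_right)
  have "pullback_metric TYPE('j) \<gamma> {a..b} t 1 1 \<ge> 0" unfolding pb quotient_metric_def by simp
  then show "(speed TYPE('j) \<gamma> {a..b} t)\<^sup>2 = (norm (A' ** (A t)\<^sup>\<dagger> + A t ** A'\<^sup>\<dagger>))\<^sup>2 / 2"
    by (simp add: speed_def pb quotient_metric_proj[OF St tan tan] power2_norm_eq_inner)
qed

lemma stiefel_grassmannian: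
  fixes A :: "complex^'j^'n"
  assumes A: "A \<in> stiefel"
  shows "col_space A \<in> grassmannian TYPE('j)"
proof -
  have inj: "inj ((*v) A)"
    by (rule inj_on_inverseI[of _ "(*v) (A\<^sup>\<dagger>)"]) (use A in \<open>simp add: matrix_vector_mul_assoc stiefelD\<close>)
  have lin: "Vector_Spaces.linear (*s) (*s) ((*v) A)" by (rule matrix_vector_mul_linear_gen)
  have "vec.dim (col_space A) = CARD('j)"
    using vec.dim_image_eq[OF lin, of UNIV] inj by (simp add: col_space_def vec_dim_card del: vec.dim_UNIV)
  moreover have "vec.subspace (col_space A)"
    unfolding col_space_def using vec.linear_subspace_image[OF lin vec.subspace_UNIV] .
  ultimately show ?thesis by (simp add: grassmannian_def)
qed

section \<open>Difference quotients and the derivative of a matrix inverse\<close>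

lemma has_vector_derivative_iff_tendsto:
  "(f has_vector_derivative d) (at t within S) \<longleftrightarrow>
    ((\<lambda>s. (1 / (s - t)) *\<^sub>R (f s - f t)) \<longlongrightarrow> d) (at t within S)"
proof -
  have "(f has_vector_derivative d) (at t within S) \<longleftrightarrow>
      ((\<lambda>s. norm ((1 / norm (s - t)) *\<^sub>R (f s - (f t + (s - t) *\<^sub>R d)))) \<longlongrightarrow> 0) (at t within S)"
    unfolding has_vector_derivative_def has_derivative_within tendsto_norm_zero_iff
    by (simp add: bounded_linear_scaleR_left)
  also have "\<dots> \<longleftrightarrow> ((\<lambda>s. norm ((1 / (s - t)) *\<^sub>R (f s - f t) - d)) \<longlongrightarrow> 0) (at t within S)"
  proof (rule filterlim_cong[OF refl refl])
    have "norm ((1 / norm (s - t)) *\<^sub>R (f s - (f t + (s - t) *\<^sub>R d))) = norm ((1 / (s - t)) *\<^sub>R (f s - f t) - d)"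
      if "s \<noteq> t" for s
    proof -
      have "(1 / (s - t)) *\<^sub>R (f s - f t) - d = (1 / (s - t)) *\<^sub>R (f s - (f t + (s - t) *\<^sub>R d))"
        using that by (simp add: scaleR_diff_right scaleR_add_right)
      then show ?thesis by simp
    qed
    then show "\<forall>\<^sub>F s in at t within S. norm ((1 / norm (s - t)) *\<^sub>R (f s - (f t + (s - t) *\<^sub>R d)))
        = norm ((1 / (s - t)) *\<^sub>R (f s - f t) - d)"
      by (auto simp: eventually_at_filter)
  qed
  also have "\<dots> \<longleftrightarrow> ((\<lambda>s. (1 / (s - t)) *\<^sub>R (f s - f t)) \<longlongrightarrow> d) (at t within S)"
    unfolding tendsto_norm_zero_iff by (rule LIM_zero_iff)
  finally show ?thesis .
qed

text \<open>Everything rests on the identity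
  \<open>N s - N t = - (N s ** (a s - a t) ** N t)\<close>. It yields first local boundedness of
  \<open>N\<close>, then continuity, and after division by \<open>s - t\<close> the limit.\<close>

lemma matrix_inverse_derivative:
  fixes a N :: "real \<Rightarrow> complex^'j^'j"
  assumes t: "t \<in> S" and a': "(a has_vector_derivative a') (at t within S)"
    and inv: "\<And>s. s \<in> S \<Longrightarrow> N s ** a s = mat 1"
  shows "(N has_vector_derivative - (N t ** a' ** N t)) (at t within S)"
proof -
  have aN: "a s ** N s = mat 1" if "s \<in> S" for s using inv[OF that] square_inverse_comm by blast
  have diff: "N s - N t = - (N s ** (a s - a t) ** N t)" if "s \<in> S" for s
  proof -
    have "N s ** (a s - a t) ** N t = (N s ** a s) ** N t - N s ** (a t ** N t)"
      by (simp add: mat_simps)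
    then show ?thesis by (simp add: inv aN that t)
  qed
  obtain K where K: "K > 0" "\<And>(X :: complex^'j^'j) (Y :: complex^'j^'j). norm (X ** Y) \<le> norm X * norm Y * K"
    using matrix_mult.pos_bounded by blast
  have lima: "(a \<longlongrightarrow> a t) (at t within S)"
    using has_vector_derivative_continuous[OF a'] by (simp add: continuous_within)
  then have "((\<lambda>s. norm (a s - a t) * (norm (N t) * K * K)) \<longlongrightarrow> norm (a t - a t) * (norm (N t) * K * K)) (at t within S)"
    by (intro tendsto_intros)
  then have "((\<lambda>s. norm (a s - a t) * (norm (N t) * K * K)) \<longlongrightarrow> 0) (at t within S)" by simp
  then have "\<forall>\<^sub>F s in at t within S. norm (a s - a t) * (norm (N t) * K * K) < 1/2"
    by (rule order_tendstoD) simp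
  moreover have "\<forall>\<^sub>F s in at t within S. s \<in> S" by (simp add: eventually_at_filter)
  \<comment> \<open>Near \<open>t\<close> the identity bounds \<open>norm (N s - N t)\<close> by
    half of \<open>norm (N s)\<close>, which the triangle inequality absorbs.\<close>
  ultimately have bd: "\<forall>\<^sub>F s in at t within S. norm (N s) \<le> 2 * norm (N t)"
  proof eventually_elim
    case (elim s)
    have "norm (N s - N t) \<le> norm (N s ** (a s - a t)) * norm (N t) * K"
      using K(2)[of "N s ** (a s - a t)" "N t"] elim by (simp add: diff)
    also have "\<dots> \<le> norm (N s) * norm (a s - a t) * K * norm (N t) * K"
      using K by (intro mult_right_mono) auto
    also have "\<dots> = norm (N s) * (norm (a s - a t) * (norm (N t) * K * K))" by simp
    also have "\<dots> \<le> norm (N s) * (1/2)" using elim by (intro mult_left_mono) auto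
    finally have "norm (N s - N t) \<le> norm (N s) / 2" by simp
    moreover have "norm (N s) \<le> norm (N t) + norm (N s - N t)"
      by (metis add.commute diff_add_cancel norm_triangle_ineq)
    ultimately show ?case by simp
  qed
  have B: "Bfun N (at t within S)"
    by (rule BfunI[OF bd])
  have Z: "Zfun (\<lambda>s. a s - a t) (at t within S)"
    using lima by (simp add: tendsto_Zfun_iff)
  have "Zfun (\<lambda>s. N s ** (a s - a t) ** N t) (at t within S)"
    by (intro matrix_mult.Zfun_left matrix_mult.Bfun_prod_Zfun B Z)
  then have "Zfun (\<lambda>s. - (N s ** (a s - a t) ** N t)) (at t within S)" by (rule Zfun_minus)
  then have "Zfun (\<lambda>s. N s - N t) (at t within S)"
    by (rule Zfun_ssubst[rotated]) (auto simp: eventually_at_filter diff)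
  then have limN: "(N \<longlongrightarrow> N t) (at t within S)" by (simp add: tendsto_Zfun_iff)
  have "((\<lambda>s. - (N s ** ((1 / (s - t)) *\<^sub>R (a s - a t)) ** N t)) \<longlongrightarrow> - (N t ** a' ** N t)) (at t within S)"
    using a' limN unfolding has_vector_derivative_iff_tendsto by (intro tendsto_intros matrix_mult.tendsto)
  then show ?thesis unfolding has_vector_derivative_iff_tendsto
    by (rule Lim_transform_eventually) (auto simp: eventually_at_filter diff matrix_scaleR_left matrix_scaleR_right)
qed

section \<open>Traces of polynomials of a compressed projection\<close>

lemma arcsin_square_derivative:
  fixes c y :: real
  assumes c: "0 < c" "c < 1" and y: "0 < y" "y \<le> 1"
  shows "((\<lambda>y. (arcsin (c * sqrt y))\<^sup>2) has_real_derivative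
      arcsin (c * sqrt y) * c / (sqrt y * sqrt (1 - c\<^sup>2 * y))) (at y)"
proof -
  have "c * sqrt y \<le> c * 1" using c y by (intro mult_left_mono) auto
  then have lt: "c * sqrt y < 1" using c by linarith
  have "0 < c * sqrt y" using c y by simp
  then have "-1 < c * sqrt y" by linarith
  note lt = lt this
  have sq: "(c * sqrt y)\<^sup>2 = c\<^sup>2 * y" using y by (simp add: power_mult_distrib)
  have "((\<lambda>y. (arcsin (c * sqrt y))\<^sup>2) has_real_derivative
      2 * arcsin (c * sqrt y) * (inverse (sqrt (1 - (c * sqrt y)\<^sup>2)) * (c * (inverse (sqrt y) / 2)))) (at y)"
    using lt y by (auto intro!: derivative_eq_intros)
  then show ?thesis unfolding sq by (simp add: field_simps)
qed

text \<open>The left side is the right side times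
  \<open>c\<^sup>2 * (1 - y) / (1 - c\<^sup>2 * y)\<close>, and this factor is at most 1 because
  \<open>c < 1\<close>.\<close>

lemma arcsin_square_bound:
  fixes c y :: real
  assumes c: "0 < c" "c < 1" and y: "0 < y" "y \<le> 1"
  shows "(arcsin (c * sqrt y) * c / (sqrt y * sqrt (1 - c\<^sup>2 * y)))\<^sup>2 * y * (1 - y) \<le> (arcsin (c * sqrt y))\<^sup>2"
proof -
  have "c\<^sup>2 < 1" using c by (simp add: power_less_one_iff)
  then have "c\<^sup>2 * y < 1" using y by (metis mult_left_le less_le_trans mult_less_cancel_left_pos mult.right_neutral order_le_less_trans zero_le_power2)
  then have pos: "1 - c\<^sup>2 * y > 0" by simp
  have "(arcsin (c * sqrt y) * c / (sqrt y * sqrt (1 - c\<^sup>2 * y)))\<^sup>2 * y * (1 - y)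
      = (arcsin (c * sqrt y))\<^sup>2 * (c\<^sup>2 * (1 - y) / (1 - c\<^sup>2 * y))"
    using y pos by (simp add: power_mult_distrib power_divide)
  also have "\<dots> \<le> (arcsin (c * sqrt y))\<^sup>2 * 1"
  proof (rule mult_left_mono)
    have "c\<^sup>2 * (1 - y) \<le> 1 - c\<^sup>2 * y" using \<open>c\<^sup>2 < 1\<close> by (simp add: algebra_simps)
    then show "c\<^sup>2 * (1 - y) / (1 - c\<^sup>2 * y) \<le> 1" using pos by simp
  qed simp
  finally show ?thesis by simp
qed

text \<open>Removable singularity at 0. It lets the derivative of
  \<open>(arcsin (c * sqrt y))\<^sup>2\<close>, which contains a division by \<open>sqrt y\<close>,
  extend continuously to \<open>y = 0\<close>.\<close>

lemma arcsin_quotient_continuous: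
  "continuous_on {-1<..<1} (\<lambda>z::real. if z = 0 then 1 else arcsin z / z)"
proof (rule continuous_at_imp_continuous_on, intro ballI)
  fix z :: real assume z: "z \<in> {-1<..<1}"
  let ?k = "\<lambda>z::real. if z = 0 then 1 else arcsin z / z"
  show "isCont ?k z"
  proof (cases "z = 0")
    case True
    have "(arcsin has_real_derivative 1) (at 0)"
      using DERIV_arcsin[of 0] by simp
    then have "((\<lambda>h. arcsin h / h) \<longlongrightarrow> 1) (at 0)"
      by (simp add: DERIV_def)
    then have "(?k \<longlongrightarrow> 1) (at 0)"
      by (rule Lim_transform_eventually) (auto simp: eventually_at_filter)
    then show ?thesis using True by (simp add: isCont_def)
  next
    case False
    have "\<forall>\<^sub>F w in nhds z. ?k w = arcsin w / w"
      using False by (auto simp: eventually_nhds intro!: exI[of _ "-{0}"])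
    moreover have "isCont (\<lambda>w. arcsin w / w) z"
      using False z by (intro continuous_intros isCont_arcsin) auto
    ultimately show ?thesis by (simp add: isCont_cong)
  qed
qed

text \<open>Weierstrass approximation is applied to the derivative of the target, not to the target:
  integrating the polynomial \<open>q\<close> to \<open>p\<close> then keeps both the function and
  its derivative close. The antiderivative is the one vanishing at 0, so that zero eigenvalues
  contribute nothing to a trace.\<close>

lemma polynomial_approximation:
  fixes c e :: real
  assumes c: "0 < c" "c < 1" and e: "e > 0"
  obtains a :: "nat \<Rightarrow> real" and n where
    "\<And>y. y \<in> {0..1} \<Longrightarrow> (\<Sum>i\<le>n. a i * y ^ i)\<^sup>2 * y * (1 - y) \<le> (\<Sum>i\<le>n. a i / real (Suc i) * y ^ Suc i) + e"
    "\<And>y. y \<in> {0..1} \<Longrightarrow> (arcsin (c * sqrt y))\<^sup>2 - e \<le> (\<Sum>i\<le>n. a i / real (Suc i) * y ^ Suc i)"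
proof -
  define f where "f y = (arcsin (c * sqrt y))\<^sup>2" for y
  define k where "k z = (if z = 0 then 1 else arcsin z / z)" for z :: real
  \<comment> \<open>Continuous extension of the derivative of \<open>f\<close> to
    \<open>y = 0\<close>.\<close>
  define g where "g y = k (c * sqrt y) * c\<^sup>2 / sqrt (1 - c\<^sup>2 * y)" for y
  have lt: "c * sqrt y < 1" "0 \<le> c * sqrt y" if "y \<in> {0..1}" for y
  proof -
    have "c * sqrt y \<le> c * 1" using c that by (intro mult_left_mono) auto
    then show "c * sqrt y < 1" using c by linarith
    show "0 \<le> c * sqrt y" using c that by auto
  qed
  have c2: "c\<^sup>2 < 1" "c\<^sup>2 > 0" using c by (simp_all add: power_less_one_iff)
  have pos: "1 - c\<^sup>2 * y > 0" if "y \<in> {0..1}" for y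
  proof -
    have "c\<^sup>2 * y \<le> c\<^sup>2 * 1" using c2 that by (intro mult_left_mono) auto
    then show ?thesis using c2 by linarith
  qed
  have gf: "g y = arcsin (c * sqrt y) * c / (sqrt y * sqrt (1 - c\<^sup>2 * y))" if "0 < y" for y
    using that c by (simp add: g_def k_def field_simps power2_eq_square)
  have "continuous_on {-1<..<1} k" unfolding k_def by (rule arcsin_quotient_continuous)
  then have "continuous_on {0..1} (\<lambda>y. k (c * sqrt y))"
    by (rule continuous_on_compose2) (use lt in \<open>force intro!: continuous_intros\<close>)+
  then have cg: "continuous_on {0..1} g"
    unfolding g_def using pos by (intro continuous_intros) force+
  then have "bounded (g ` {0..1})" by (intro compact_imp_bounded compact_continuous_image) auto
  then obtain M where M: "\<And>y. y \<in> {0..1} \<Longrightarrow> \<bar>g y\<bar> \<le> M" unfolding bounded_iff by (metis image_eqI real_norm_def)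
  have M0: "M \<ge> 0" using M[of 0] by simp
  \<comment> \<open>Replacing \<open>g\<close> by \<open>q\<close> costs
    \<open>d * (2 * M + 1)\<close> in the squared derivative, where \<open>d \<le> 1\<close> bounds
    the quadratic part; replacing \<open>f\<close> by \<open>p\<close> costs another
    \<open>d\<close>. The choice keeps the total at most \<open>e\<close>.\<close>
  define d where "d = min 1 (e / (2 + 2 * M))"
  have d: "0 < d" "d \<le> 1" using e M0 by (auto simp: d_def)
  have "d \<le> e / (2 + 2 * M)" by (simp add: d_def)
  then have de: "d * (2 + 2 * M) \<le> e" using M0 by (subst (asm) pos_le_divide_eq) auto
  obtain q where q: "real_polynomial_function q" "\<And>y. y \<in> {0..1} \<Longrightarrow> \<bar>g y - q y\<bar> < d"
    using Stone_Weierstrass_real_polynomial_function[OF _ cg d(1)] by auto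
  obtain a n where qs: "q = (\<lambda>x. \<Sum>i\<le>n. a i * x ^ i)"
    using q(1) unfolding real_polynomial_function_iff_sum by blast
  define p where "p y = (\<Sum>i\<le>n. a i / real (Suc i) * y ^ Suc i)" for y
  have p': "(p has_real_derivative q y) (at y)" for y
  proof -
    have "(p has_real_derivative (\<Sum>i\<le>n. a i / real (Suc i) * (real (Suc i) * y ^ i))) (at y)"
      unfolding p_def[abs_def]
      by (intro DERIV_sum DERIV_cmult) (use DERIV_pow[of "Suc _" y] in simp)
    moreover have "a i / real (Suc i) * (real (Suc i) * y ^ i) = a i * y ^ i" for i
      by simp
    ultimately show ?thesis by (simp only: qs)
  qed
  have pf: "\<bar>p y - f y\<bar> \<le> d" if y: "y \<in> {0..1}" for y
  proof (cases "y = 0")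
    case True
    then show ?thesis using d by (simp add: p_def f_def)
  next
    case False
    have D: "((\<lambda>z. p z - f z) has_real_derivative q z - g z) (at z)" if "0 < z" "z \<le> 1" for z
      unfolding f_def gf[OF that(1)]
      by (intro DERIV_diff p' arcsin_square_derivative c that)
    have "continuous_on {0..1} f"
      unfolding f_def using lt by (intro continuous_intros) (force intro: order_trans[of _ 0])+
    then have "continuous_on {0..y} f" by (rule continuous_on_subset) (use y in auto)
    moreover have "continuous_on {0..y} p"
      using DERIV_isCont[OF p'] by (auto intro: continuous_at_imp_continuous_on)
    ultimately have cont: "continuous_on {0..y} (\<lambda>z. p z - f z)"
      by (intro continuous_on_diff)
    have diff: "(\<lambda>z. p z - f z) differentiable (at z)" if "0 < z" "z < y" for z
      using D[of z] that y by (auto simp: real_differentiable_def)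
    have "0 < y" using False y by simp
    then have "\<exists>l z. 0 < z \<and> z < y \<and> ((\<lambda>z. p z - f z) has_real_derivative l) (at z) \<and>
      (p y - f y) - (p 0 - f 0) = (y - 0) * l"
      by (rule MVT[OF _ cont]) (rule diff)
    then obtain l z where lz: "0 < z" "z < y" "((\<lambda>z. p z - f z) has_real_derivative l) (at z)"
      "(p y - f y) - (p 0 - f 0) = (y - 0) * l"
      by blast
    have "l = q z - g z" by (rule DERIV_unique[OF lz(3) D]) (use lz(1,2) y in auto)
    then have "\<bar>l\<bar> \<le> d" using q(2)[of z] lz(1,2) y by simp
    then have "\<bar>y * l\<bar> \<le> 1 * d" unfolding abs_mult using y by (intro mult_mono) auto
    then show ?thesis using lz(4) by (simp add: p_def f_def)
  qed
  show ?thesis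
  proof (rule that)
    fix y :: real assume y: "y \<in> {0..1}"
    have gy: "(g y)\<^sup>2 * y * (1 - y) \<le> f y"
    proof (cases "y = 0")
      case False
      then show ?thesis using arcsin_square_bound[OF c, of y] y by (simp add: gf f_def)
    qed (simp add: f_def)
    have qd: "\<bar>q y - g y\<bar> \<le> d" using q(2)[OF y] by (simp add: abs_minus_commute)
    have "(q y)\<^sup>2 - (g y)\<^sup>2 = (q y - g y) * (2 * g y + (q y - g y))"
      by (simp add: power2_eq_square algebra_simps)
    also have "\<dots> \<le> \<bar>q y - g y\<bar> * \<bar>2 * g y + (q y - g y)\<bar>"
      by (metis abs_ge_self abs_mult)
    also have "\<dots> \<le> d * (2 * M + 1)"
      using qd M[OF y] d by (intro mult_mono) auto
    finally have 1: "(q y)\<^sup>2 \<le> (g y)\<^sup>2 + d * (2 * M + 1)" by simp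
    have y1: "y * (1 - y) \<le> 1" "0 \<le> y * (1 - y)"
      using y mult_mono[of y 1 "1 - y" 1] by auto
    have "(q y)\<^sup>2 * (y * (1 - y)) \<le> ((g y)\<^sup>2 + d * (2 * M + 1)) * (y * (1 - y))"
      using 1 y1(2) by (rule mult_right_mono)
    also have "\<dots> \<le> f y + d * (2 * M + 1)"
      using gy y1 M0 d mult_left_mono[OF y1(1), of "d * (2 * M + 1)"] by (simp add: algebra_simps)
    also have "\<dots> \<le> p y + e"
      using pf[OF y] de by (simp add: algebra_simps)
    finally show "(\<Sum>i\<le>n. a i * y ^ i)\<^sup>2 * y * (1 - y) \<le> (\<Sum>i\<le>n. a i / real (Suc i) * y ^ Suc i) + e"
      by (simp add: qs p_def mult.assoc)
    have "d * 1 \<le> d * (2 + 2 * M)" using d M0 by (intro mult_left_mono) auto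
    with de have "d \<le> e" by simp
    then show "(arcsin (c * sqrt y))\<^sup>2 - e \<le> (\<Sum>i\<le>n. a i / real (Suc i) * y ^ Suc i)"
      using pf[OF y] unfolding p_def f_def by simp
  qed
qed

section \<open>Powers and traces along matrix curves\<close>

primrec mpow :: "complex^'n^'n \<Rightarrow> nat \<Rightarrow> complex^'n^'n"
  where "mpow Z 0 = mat 1" | "mpow Z (Suc k) = Z ** mpow Z k"

definition rtrace :: "complex^'n^'n \<Rightarrow> real"
  where "rtrace X = Re (trace X)"

lemma rtrace_cyclic: "rtrace (A ** B) = rtrace (B ** A)"
  unfolding rtrace_def by (subst trace_mul_sym) simp

lemma inner_eq_rtrace: "inner A B = rtrace (A\<^sup>\<dagger> ** B)"
  by (simp add: rtrace_def inner_matrix_eq)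

lemma bounded_linear_rtrace: "bounded_linear rtrace"
proof -
  have "rtrace = inner (mat 1)" by (auto simp: inner_eq_rtrace)
  then show ?thesis using bounded_linear_inner_right by metis
qed

lemmas lin_rtrace = bounded_linear.linear[OF bounded_linear_rtrace]

lemma rtrace_simps: "rtrace (A + B) = rtrace A + rtrace B" "rtrace (A - B) = rtrace A - rtrace B"
  "rtrace (r *\<^sub>R A) = r * rtrace A" "rtrace (sum f I) = (\<Sum>i\<in>I. rtrace (f i))" "rtrace 0 = 0"
  using linear_add[OF lin_rtrace] linear_diff[OF lin_rtrace] linear_scale[OF lin_rtrace] linear_sum[OF lin_rtrace] linear_0[OF lin_rtrace]
  by simp_all

lemma rtrace_diagonalised:
  assumes "V \<in> unitary_group"
  shows "rtrace (V ** diag s ** V\<^sup>\<dagger>) = (\<Sum>i\<in>UNIV. s i)"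
proof -
  have "rtrace (V ** diag s ** V\<^sup>\<dagger>) = rtrace (V\<^sup>\<dagger> ** (V ** diag s))" by (rule rtrace_cyclic)
  then show ?thesis using assms by (simp add: unitaryD rtrace_def trace_diag)
qed

lemma mult_diagonalised:
  assumes "V \<in> unitary_group"
  shows "(V ** diag s ** V\<^sup>\<dagger>) ** (V ** diag r ** V\<^sup>\<dagger>) = V ** diag (\<lambda>i. s i * r i) ** V\<^sup>\<dagger>"
  using assms by (simp add: mat_simps unitaryD)
    (simp add: matrix_mul_assoc diag_mult)

lemma mpow_diagonalised:
  assumes "V \<in> unitary_group"
  shows "mpow (V ** diag s ** V\<^sup>\<dagger>) k = V ** diag (\<lambda>i. s i ^ k) ** V\<^sup>\<dagger>"
  by (induction k) (simp_all add: diag_1 unitaryD assms mult_diagonalised)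

lemma mpow_commute: "C ** Z = Z ** C \<Longrightarrow> C ** mpow Z k = mpow Z k ** C"
  by (induction k) (simp_all add: matrix_mul_assoc, simp add: matrix_mul_assoc[symmetric])

text \<open>\<open>Z t\<close> and \<open>Z'\<close> need not commute, so the scalar power rule
  survives only under the trace, by cyclicity. The factor \<open>C\<close> carries the induction:
  the step applies the hypothesis to \<open>C ** Z t\<close>, which still commutes with
  \<open>Z t\<close>.\<close>

lemma mpow_derivative:
  assumes Z': "(Z has_vector_derivative Z') (at t within S)"
  shows "\<exists>D. ((\<lambda>s. mpow (Z s) k) has_vector_derivative D) (at t within S) \<and>
    (\<forall>C. C ** Z t = Z t ** C \<longrightarrow> rtrace (C ** D) = real k * rtrace (C ** mpow (Z t) (k - 1) ** Z'))"
proof (induction k)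
  case 0
  show ?case by (auto simp: matrix_zero_right rtrace_simps intro!: exI[of _ 0])
next
  case (Suc k)
  then obtain D where D: "((\<lambda>s. mpow (Z s) k) has_vector_derivative D) (at t within S)"
    "\<And>C. C ** Z t = Z t ** C \<Longrightarrow> rtrace (C ** D) = real k * rtrace (C ** mpow (Z t) (k - 1) ** Z')"
    by blast
  let ?D = "Z t ** D + Z' ** mpow (Z t) k"
  have "((\<lambda>s. mpow (Z s) (Suc k)) has_vector_derivative ?D) (at t within S)"
    using matrix_mult.has_vector_derivative[OF Z' D(1)] by simp
  moreover have "rtrace (C ** ?D) = real (Suc k) * rtrace (C ** mpow (Z t) k ** Z')"
    if C: "C ** Z t = Z t ** C" for C
  proof -
    have "(C ** Z t) ** Z t = Z t ** (C ** Z t)" by (metis C matrix_mul_assoc)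
    from D(2)[OF this]
    have 1: "rtrace (C ** (Z t ** D)) = real k * rtrace (C ** Z t ** mpow (Z t) (k - 1) ** Z')"
      by (simp add: matrix_mul_assoc)
    \<comment> \<open>For \<open>k = 0\<close> the truncated exponent \<open>k - 1\<close> is
      harmless, since the factor \<open>real k\<close> vanishes.\<close>
    have 2: "real k * rtrace (C ** Z t ** mpow (Z t) (k - 1) ** Z') = real k * rtrace (C ** mpow (Z t) k ** Z')"
      by (cases k) (simp_all add: matrix_mul_assoc)
    have "rtrace (C ** (Z' ** mpow (Z t) k)) = rtrace (mpow (Z t) k ** (C ** Z'))"
      using rtrace_cyclic[of "C ** Z'" "mpow (Z t) k"] by (simp add: matrix_mul_assoc)
    also have "\<dots> = rtrace (C ** mpow (Z t) k ** Z')"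
      using mpow_commute[OF C, of k] by (simp add: matrix_mul_assoc)
    finally show ?thesis
      using 1 2 by (simp add: matrix_add_ldistrib rtrace_simps algebra_simps)
  qed
  ultimately show ?case by auto
qed

text \<open>\<open>Z\<close> is the Gram matrix of \<open>P ** Q\<close>, so an eigenvalue is the
  squared norm of the image of a unit eigenvector under two self-adjoint projections, neither of
  which increases norms.\<close>

lemma compressed_projection_spectrum:
  fixes P Q Z :: "complex^'n^'n"
  assumes P: "P\<^sup>\<dagger> = P" "P ** P = P" and Q: "Q\<^sup>\<dagger> = Q" "Q ** Q = Q" and Z: "Z = Q ** P ** Q"
    and V: "V \<in> unitary_group" "Z = V ** diag s ** V\<^sup>\<dagger>"
  shows "s i \<in> {0..1}"
proof -
  let ?x = "column i V"
  have sym: "inner a (R *v b) = inner (R *v a) b" if "R\<^sup>\<dagger> = R" for R :: "complex^'n^'n" and a b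
    using that by (simp add: inner_eq_Re_cinner cinner_mult)
  have le: "norm (R *v x) \<le> norm x" if R: "R\<^sup>\<dagger> = R" "R ** R = R" for R :: "complex^'n^'n" and x
  proof -
    have "inner (R *v x) (R *v x) = inner (R *v (R *v x)) x" by (rule sym[OF R(1)])
    then have "(norm (R *v x))\<^sup>2 = inner x (R *v x)"
      unfolding power2_norm_eq_inner matrix_vector_mul_assoc R(2) by (simp add: inner_commute)
    also have "\<dots> \<le> norm x * norm (R *v x)" by (rule norm_cauchy_schwarz)
    finally have "norm (R *v x) * norm (R *v x) \<le> norm x * norm (R *v x)"
      by (simp only: power2_eq_square)
    then show ?thesis by (cases "R *v x = 0") (simp_all add: mult_le_cancel_right)
  qed
  have "s i = inner ?x (Q *v (P *v (P *v (Q *v ?x))))"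
  proof -
    have "Q ** (P ** (P ** Q)) = Z" using P(2) by (metis Z matrix_mul_assoc)
    then show ?thesis using diagonalisation_entry(1)[OF V, of i] by (simp add: matrix_vector_mul_assoc mat_simps)
  qed
  also have "\<dots> = (norm (P *v (Q *v ?x)))\<^sup>2"
    unfolding power2_norm_eq_inner sym[OF Q(1)] sym[OF P(1)] ..
  finally have s: "s i = (norm (P *v (Q *v ?x)))\<^sup>2" .
  have "norm (P *v (Q *v ?x)) \<le> 1"
    using le[OF P, of "Q *v ?x"] le[OF Q, of ?x] diagonalisation_entry(2)[OF V, of i] by simp
  then show ?thesis unfolding s by (simp add: power_le_one)
qed

text \<open>The differentiated idempotence \<open>P' = P ** P' + P' ** P\<close> makes
  \<open>P'\<close> off-diagonal with respect to the range of \<open>P\<close>, so only the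
  off-diagonal block \<open>W\<close> of \<open>R\<close> pairs with it. Applying Cauchy-Schwarz to
  this block, rather than to all of \<open>R\<close>, is what produces the factor
  \<open>s i * (1 - s i)\<close>.\<close>

lemma compressed_projection_derivative_bound:
  fixes P P' Q Z :: "complex^'n^'n"
  assumes P: "P\<^sup>\<dagger> = P" "P ** P = P" and P': "P'\<^sup>\<dagger> = P'" "P' = P ** P' + P' ** P"
    and Q: "Q\<^sup>\<dagger> = Q" "Q ** Q = Q" and Z: "Z = Q ** P ** Q"
    and V: "V \<in> unitary_group" "Z = V ** diag s ** V\<^sup>\<dagger>"
  shows "(rtrace (V ** diag r ** V\<^sup>\<dagger> ** (Q ** P' ** Q)))\<^sup>2
    \<le> 2 * (\<Sum>i\<in>UNIV. (r i)\<^sup>2 * s i * (1 - s i)) * (norm P')\<^sup>2"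
proof -
  define T where "T = V ** diag r ** V\<^sup>\<dagger>"
  define R where "R = Q ** T ** Q"
  have TH: "T\<^sup>\<dagger> = T" by (simp add: T_def mat_simps)
  have RH: "R\<^sup>\<dagger> = R" using TH Q by (simp add: R_def mat_simps)
  have PP: "P ** (P ** X) = P ** X" for X :: "complex^'n^'n" using P by (simp add: matrix_mul_assoc)
  have QQ: "Q ** (Q ** X) = Q ** X" for X :: "complex^'n^'n" using Q by (simp add: matrix_mul_assoc)
  have "rtrace (T ** (Q ** P' ** Q)) = rtrace ((T ** Q ** P') ** Q)" by (simp add: matrix_mul_assoc)
  also have "\<dots> = rtrace (Q ** (T ** Q ** P'))" by (rule rtrace_cyclic)
  also have "\<dots> = inner R P'" by (simp add: inner_eq_rtrace RH) (simp add: R_def matrix_mul_assoc)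
  also have "\<dots> = inner R (P ** P') + inner R (P' ** P)" by (subst P'(2)) (rule inner_add_right)
  also have "inner R (P ** P') = inner R (P' ** P)"
    using inner_ct_ct[of R "P ** P'"] by (simp add: RH ct_mult P P'(1))
  finally have 1: "rtrace (T ** (Q ** P' ** Q)) = 2 * inner R (P' ** P)" by simp
  have "P ** P' ** P = P ** (P ** P' + P' ** P) ** P" using P'(2) by simp
  then have 0: "P ** (P' ** P) = 0" by (simp add: mat_simps PP P)
  \<comment> \<open>\<open>W\<close> is \<open>(mat 1 - P) ** R ** P\<close>; the part removed from
    \<open>R ** P\<close> is orthogonal to \<open>P' ** P\<close> because
    \<open>P ** P' ** P = 0\<close>.\<close>
  define W where "W = R ** P - P ** (R ** P)"
  have "inner W (P' ** P) = inner R (P' ** P)"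
    by (simp add: W_def inner_diff_left inner_matrix_left[of P] P 0 inner_matrix_right[of R P] mat_simps)
  then have 2: "\<bar>inner R (P' ** P)\<bar> \<le> norm W * norm (P' ** P)"
    using Cauchy_Schwarz_ineq2 by metis
  have "(norm P')\<^sup>2 = inner P' (P ** P') + inner P' (P' ** P)"
    using P'(2) by (metis inner_add_right power2_norm_eq_inner)
  also have "inner P' (P' ** P) = (norm (P' ** P))\<^sup>2"
    by (simp add: power2_norm_eq_inner inner_matrix_right[of P' P] mat_simps P)
  also have "inner P' (P ** P') = (norm (P ** P'))\<^sup>2"
    by (simp add: power2_norm_eq_inner inner_matrix_left[of P P'] mat_simps P PP)
  also have "norm (P ** P') = norm (P' ** P)"
    using norm_ct[of "P ** P'"] by (simp add: ct_mult P P'(1))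
  finally have 3: "(norm P')\<^sup>2 = 2 * (norm (P' ** P))\<^sup>2" by simp
  have ZQ: "Q ** Z = Z" "Z ** Q = Z" using Q QQ by (simp_all add: Z mat_simps)
  have comm: "T ** Z = Z ** T" unfolding T_def V(2) mult_diagonalised[OF V(1)] by (simp add: mult.commute)
  have "(norm W)\<^sup>2 = rtrace (P ** R ** R ** P) - rtrace (P ** R ** P ** R ** P)"
    by (simp add: power2_norm_eq_inner inner_eq_rtrace W_def mat_simps RH P PP rtrace_simps)
  also have "rtrace (P ** R ** R ** P) = rtrace (T ** T ** Z)"
  proof -
    have "rtrace (P ** R ** R ** P) = rtrace ((R ** R) ** P)"
      using rtrace_cyclic[of P "R ** R ** P"] P by (simp add: matrix_mul_assoc[symmetric])
    also have "\<dots> = rtrace (Q ** (T ** Q ** T ** Q ** P))"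
      by (simp add: R_def mat_simps QQ)
    also have "\<dots> = rtrace (T ** Q ** T ** Q ** P ** Q)" by (rule rtrace_cyclic)
    also have "T ** Q ** T ** Q ** P ** Q = T ** Q ** (T ** Z)" by (simp add: Z matrix_mul_assoc)
    also have "\<dots> = T ** (Q ** Z) ** T" unfolding comm by (simp add: matrix_mul_assoc)
    also have "\<dots> = T ** T ** Z" unfolding ZQ by (metis comm matrix_mul_assoc)
    finally show ?thesis .
  qed
  also have "rtrace (P ** R ** P ** R ** P) = rtrace (T ** Z ** T ** Z)"
  proof -
    have "rtrace (P ** R ** P ** R ** P) = rtrace ((R ** P ** R) ** P)"
      using rtrace_cyclic[of P "R ** P ** R ** P"] P by (simp add: matrix_mul_assoc[symmetric])
    also have "\<dots> = rtrace (Q ** (T ** Q ** P ** Q ** T ** Q ** P))"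
      by (simp add: R_def mat_simps QQ)
    also have "\<dots> = rtrace (T ** Q ** P ** Q ** T ** Q ** P ** Q)" by (rule rtrace_cyclic)
    finally show ?thesis by (simp add: Z matrix_mul_assoc)
  qed
  also have "T ** Z ** T ** Z = (T ** Z) ** (T ** Z)" by (simp add: matrix_mul_assoc)
  finally have 4: "(norm W)\<^sup>2 = (\<Sum>i\<in>UNIV. (r i)\<^sup>2 * s i * (1 - s i))"
    unfolding T_def V(2) mult_diagonalised[OF V(1)] rtrace_diagonalised[OF V(1)]
    by (simp add: power2_eq_square algebra_simps sum_subtractf)
  have "(rtrace (T ** (Q ** P' ** Q)))\<^sup>2 = 4 * \<bar>inner R (P' ** P)\<bar>\<^sup>2"
    unfolding 1 by (simp add: power_mult_distrib)
  also have "\<dots> \<le> 4 * (norm W * norm (P' ** P))\<^sup>2"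
    using 2 by (intro mult_left_mono power_mono) auto
  finally show ?thesis unfolding T_def[symmetric] 3 4[symmetric] by (simp add: power_mult_distrib)
qed

section \<open>Lower bound for the length of curves\<close>

text \<open>The trace of \<open>p (Q ** P ** Q)\<close> for the polynomial \<open>p\<close> with
  \<open>p 0 = 0\<close> whose derivative has coefficients \<open>a\<close>, the form delivered by
  \<open>polynomial_approximation\<close>.\<close>

definition potential :: "(nat \<Rightarrow> real) \<Rightarrow> nat \<Rightarrow> complex^'n^'n \<Rightarrow> complex^'n^'n \<Rightarrow> real"
  where "potential a n Q P = (\<Sum>i\<le>n. a i / real (Suc i) * rtrace (mpow (Q ** P ** Q) (Suc i)))"

lemma potential_diagonalised:
  assumes "V \<in> unitary_group" "Q ** P ** Q = V ** diag s ** V\<^sup>\<dagger>"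
  shows "potential a n Q P = (\<Sum>k\<in>UNIV. \<Sum>i\<le>n. a i / real (Suc i) * s k ^ Suc i)"
  unfolding potential_def assms(2) mpow_diagonalised[OF assms(1)] rtrace_diagonalised[OF assms(1)]
  by (simp only: sum_distrib_left) (rule sum.swap)

lemma sum_diag: "(\<Sum>i\<in>I. diag (f i)) = diag (\<lambda>k. \<Sum>i\<in>I. f i k)"
  by (induction I rule: infinite_finite_induct) (simp_all add: diag_0 diag_add)

text \<open>The diagonalisation is taken at the single time \<open>t\<close> and only makes the
  derivative polynomial explicit; the differentiation itself is \<open>mpow_derivative\<close> with
  \<open>C = mat 1\<close>.\<close>

lemma potential_derivative:
  assumes P': "(P has_vector_derivative P') (at t within S)"
    and V: "V \<in> unitary_group" "Q ** P t ** Q = V ** diag s ** V\<^sup>\<dagger>"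
  shows "((\<lambda>t. potential a n Q (P t)) has_vector_derivative
    rtrace (V ** diag (\<lambda>k. \<Sum>i\<le>n. a i * s k ^ i) ** V\<^sup>\<dagger> ** (Q ** P' ** Q))) (at t within S)"
proof -
  let ?Z = "\<lambda>t. Q ** P t ** Q"
  have "((\<lambda>t. Q ** P t) has_vector_derivative Q ** P') (at t within S)"
    by (rule bounded_linear.has_vector_derivative[OF matrix_mult.bounded_linear_right P'])
  then have Z': "(?Z has_vector_derivative Q ** P' ** Q) (at t within S)"
    by (rule bounded_linear.has_vector_derivative[OF matrix_mult.bounded_linear_left])
  have "((\<lambda>t. rtrace (mpow (?Z t) (Suc i))) has_vector_derivative
      real (Suc i) * rtrace (mpow (?Z t) i ** (Q ** P' ** Q))) (at t within S)" for i
  proof -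
    obtain D where D: "((\<lambda>s. mpow (?Z s) (Suc i)) has_vector_derivative D) (at t within S)"
      "\<And>C. C ** ?Z t = ?Z t ** C \<Longrightarrow> rtrace (C ** D)
        = real (Suc i) * rtrace (C ** mpow (?Z t) (Suc i - 1) ** (Q ** P' ** Q))"
      using mpow_derivative[OF Z', of "Suc i"] by blast
    have "rtrace D = real (Suc i) * rtrace (mpow (?Z t) i ** (Q ** P' ** Q))"
      using D(2)[of "mat 1"] by simp
    then show ?thesis
      using bounded_linear.has_vector_derivative[OF bounded_linear_rtrace D(1)] by simp
  qed
  then have "((\<lambda>t. potential a n Q (P t)) has_vector_derivative
      (\<Sum>i\<le>n. a i / real (Suc i) * (real (Suc i) * rtrace (mpow (?Z t) i ** (Q ** P' ** Q))))) (at t within S)"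
    unfolding potential_def
    by (intro has_vector_derivative_sum has_vector_derivative_mult_right)
  also have "(\<Sum>i\<le>n. a i / real (Suc i) * (real (Suc i) * rtrace (mpow (?Z t) i ** (Q ** P' ** Q))))
      = (\<Sum>i\<le>n. rtrace (V ** (a i *\<^sub>R diag (\<lambda>k. s k ^ i)) ** V\<^sup>\<dagger> ** (Q ** P' ** Q)))"
    unfolding V(2) mpow_diagonalised[OF V(1)]
    by (intro sum.cong) (simp_all add: matrix_scaleR_left matrix_scaleR_right rtrace_simps)
  also have "\<dots> = rtrace (V ** (\<Sum>i\<le>n. a i *\<^sub>R diag (\<lambda>k. s k ^ i)) ** V\<^sup>\<dagger> ** (Q ** P' ** Q))"
    by (simp add: matrix_mult.sum_left matrix_mult.sum_right rtrace_simps)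
  also have "(\<Sum>i\<le>n. a i *\<^sub>R diag (\<lambda>k. s k ^ i)) = diag (\<lambda>k. \<Sum>i\<le>n. a i * s k ^ i)"
    by (simp add: diag_scaleR sum_diag)
  finally show ?thesis .
qed

lemma at_within_Int_ball:
  fixes t e :: real
  assumes "0 < e"
  shows "at t within (S \<inter> ball t e) = at t within S"
  using assms by (intro at_within_nhd[of t "ball t e"]) auto

text \<open>Provides integrability of the speed on each smooth piece: in a local lift the speed is
  the norm of the horizontal part of \<open>A'\<close>, an expression continuous in \<open>A\<close>
  and \<open>A'\<close>.\<close>

lemma C1_speed_continuous:
  assumes cd: "c < d" and C1: "C1_curve TYPE('j::finite) (\<gamma> :: real \<Rightarrow> (complex^'n) set) {c..d}"
  shows "continuous_on {c..d} (speed TYPE('j) \<gamma> {c..d})"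
  unfolding continuous_on_eq_continuous_within
proof
  fix t assume t: "t \<in> {c..d}"
  then obtain A :: "real \<Rightarrow> complex^'j^'n" and A' e where A: "0 < e"
    "is_lift A \<gamma> ({c..d} \<inter> ball t e)"
    "\<And>s. s \<in> {c..d} \<inter> ball t e \<Longrightarrow> (A has_vector_derivative A' s) (at s within {c..d})"
    "continuous_on ({c..d} \<inter> ball t e) A'"
    using C1 unfolding C1_curve_def by blast
  let ?I = "{c..d} \<inter> ball t e"
  have sp: "speed TYPE('j) \<gamma> {c..d} s = norm (A' s - A s ** ((A s)\<^sup>\<dagger> ** A' s))" if s: "s \<in> ?I" for s
  proof -
    \<comment> \<open>\<open>speed_lift\<close> wants a ball centred at \<open>s\<close>, so the
      ball around \<open>t\<close> is shrunk.\<close>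
    obtain r where r: "r > 0" "ball s r \<subseteq> ball t e"
      using s by (metis IntE open_ball open_contains_ball_eq)
    have "is_lift A \<gamma> ({c..d} \<inter> ball s r)"
      using A(2) r(2) unfolding is_lift_def by blast
    then show ?thesis using speed_lift(1)[OF cd _ r(1) _ A(3)[OF s]] s by blast
  qed
  have "continuous_on ?I A"
    unfolding continuous_on_eq_continuous_within
    using has_vector_derivative_continuous[OF A(3)] by (meson Int_lower1 continuous_within_subset)
  then have "continuous_on ?I (\<lambda>s. norm (A' s - A s ** ((A s)\<^sup>\<dagger> ** A' s)))"
    by (intro continuous_intros matrix_mult.continuous_on A(4)
        bounded_linear.continuous_on[OF bounded_linear_ctranspose])
  then have "continuous_on ?I (speed TYPE('j) \<gamma> {c..d})"
    using continuous_on_cong[OF refl sp] by (rule iffD2[rotated])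
  then have "continuous (at t within ?I) (speed TYPE('j) \<gamma> {c..d})"
    using t A(1) by (auto simp: continuous_on_eq_continuous_within)
  then show "continuous (at t within {c..d}) (speed TYPE('j) \<gamma> {c..d})"
    by (simp add: at_within_Int_ball[OF A(1)] continuous_within)
qed

text \<open>The square root of the potential is a regularised distance function, with gradient of norm at
  most 1.\<close>

lemma C1_piece_potential_bound:
  fixes \<gamma> :: "real \<Rightarrow> (complex^'n) set" and Q :: "complex^'n^'n"
  assumes cd: "c < d" and C1: "C1_curve TYPE('j::finite) \<gamma> {c..d}"
    and Q: "Q\<^sup>\<dagger> = Q" "Q ** Q = Q" and e: "e > 0"
    and poly: "\<And>y. y \<in> {0..1} \<Longrightarrow>
      (\<Sum>i\<le>n. a i * y ^ i)\<^sup>2 * y * (1 - y) \<le> (\<Sum>i\<le>n. a i / real (Suc i) * y ^ Suc i) + e"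
  defines "F \<equiv> \<lambda>t. sqrt (potential a n Q (proj (\<gamma> t)) + (real CARD('n) + 1) * e)"
  shows "F d - F c \<le> integral {c..d} (speed TYPE('j) \<gamma> {c..d})"
proof -
  let ?v = "speed TYPE('j) \<gamma> {c..d}"
  have "\<exists>F'. (F has_vector_derivative F') (at t within {c..d}) \<and> F' \<le> ?v t" if t: "t \<in> {c..d}" for t
  proof -
    obtain A :: "real \<Rightarrow> complex^'j^'n" and A' r where A: "0 < r" "is_lift A \<gamma> ({c..d} \<inter> ball t r)"
      "\<And>s. s \<in> {c..d} \<inter> ball t r \<Longrightarrow> (A has_vector_derivative A' s) (at s within {c..d})"
      using C1 t unfolding C1_curve_def by blast
    have A': "(A has_vector_derivative A' t) (at t within {c..d})" using A(1,3) t by auto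
    have St: "A t \<in> stiefel" "col_space (A t) = \<gamma> t" using A(1,2) t by (auto simp: is_lift_def)
    define P where "P = proj (\<gamma> t)"
    define P' where "P' = A' t ** (A t)\<^sup>\<dagger> + A t ** (A' t)\<^sup>\<dagger>"
    note sl = speed_lift(2,3)[OF cd t A(1,2) A', folded P'_def]
    have PA: "P = A t ** (A t)\<^sup>\<dagger>" using proj_col_space[OF St(1)] St(2) by (simp add: P_def)
    have "A' t \<in> stiefel_tangent (A t)"
      using lift_proj_derivative(2)[OF A(1,2) t _ islimpt_interval_direction[OF cd t], of "\<lambda>x. x *\<^sub>R A' t"]
        A' by (simp add: has_vector_derivative_def)
    from stiefel_tangent_skew[OF this]
    have sk: "(A' t)\<^sup>\<dagger> ** (A t ** X) = - ((A t)\<^sup>\<dagger> ** (A' t ** X))" for X :: "complex^'n^'j"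
      by (simp add: matrix_mul_assoc matrix_minus_left)
    have P: "P\<^sup>\<dagger> = P" "P ** P = P" using St(1) by (simp_all add: PA mat_simps stiefelD)
    have P': "P'\<^sup>\<dagger> = P'" "P' = P ** P' + P' ** P"
      using St(1) by (simp_all add: PA P'_def mat_simps stiefelD sk add.commute)
    have "(Q ** P ** Q)\<^sup>\<dagger> = Q ** P ** Q" by (simp add: mat_simps P Q)
    then obtain V s where V: "V \<in> unitary_group" "Q ** P ** Q = V ** diag s ** V\<^sup>\<dagger>"
      using hermitian_diagonalisation by blast
    have s01: "s k \<in> {0..1}" for k
      by (rule compressed_projection_spectrum[OF P Q refl V])
    let ?q = "\<lambda>k. \<Sum>i\<le>n. a i * s k ^ i" and ?p = "\<lambda>k. \<Sum>i\<le>n. a i / real (Suc i) * s k ^ Suc i"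
    define D where "D = rtrace (V ** diag ?q ** V\<^sup>\<dagger> ** (Q ** P' ** Q))"
    define p where "p = potential a n Q P"
    have pot: "p = (\<Sum>k\<in>UNIV. ?p k)" unfolding p_def by (rule potential_diagonalised[OF V])
    have dpot: "((\<lambda>t. potential a n Q (proj (\<gamma> t))) has_vector_derivative D) (at t within {c..d})"
      unfolding D_def by (rule potential_derivative[OF sl(1) V[unfolded P_def]])
    \<comment> \<open>Each of the \<open>n\<close> eigenvalues may violate the gradient estimate by
      \<open>e\<close>. The one further \<open>e\<close> in \<open>F\<close> keeps the radicand
      strictly positive, so that the root is differentiable.\<close>
    have sum: "(\<Sum>k\<in>UNIV. (?q k)\<^sup>2 * s k * (1 - s k)) \<le> p + real CARD('n) * e"
    proof -
      have "(\<Sum>k\<in>UNIV. (?q k)\<^sup>2 * s k * (1 - s k)) \<le> (\<Sum>k\<in>UNIV. ?p k + e)"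
        by (intro sum_mono poly s01)
      then show ?thesis unfolding pot by (simp add: sum.distrib)
    qed
    have "0 \<le> (\<Sum>k\<in>UNIV. (?q k)\<^sup>2 * s k * (1 - s k))"
      using s01 by (intro sum_nonneg mult_nonneg_nonneg) auto
    then have pos: "p + (real CARD('n) + 1) * e > 0" using sum e by (simp add: algebra_simps)
    have Ft: "F t = sqrt (p + (real CARD('n) + 1) * e)" by (simp add: F_def p_def P_def)
    then have F0: "F t > 0" "(F t)\<^sup>2 = p + (real CARD('n) + 1) * e" using pos by simp_all
    have "D\<^sup>2 \<le> 2 * (\<Sum>k\<in>UNIV. (?q k)\<^sup>2 * s k * (1 - s k)) * (norm P')\<^sup>2"
      unfolding D_def by (rule compressed_projection_derivative_bound[OF P P' Q refl V])
    also have "\<dots> \<le> 2 * (F t)\<^sup>2 * (norm P')\<^sup>2"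
      using sum e unfolding F0(2) by (intro mult_right_mono mult_left_mono) (auto simp: algebra_simps)
    \<comment> \<open>By \<open>sl(2)\<close> the squared speed is half of
      \<open>(norm P')\<^sup>2\<close>, so the constants combine to a perfect square.\<close>
    also have "\<dots> = (2 * F t * ?v t)\<^sup>2" using sl(2) by (simp add: power_mult_distrib)
    finally have "D \<le> 2 * F t * ?v t"
    proof (rule power2_le_imp_le)
      show "0 \<le> 2 * F t * ?v t" using F0 speed_lift(1)[OF cd t A(1,2) A'] by simp
    qed
    then have "D / (2 * F t) \<le> ?v t" using F0 by (simp add: field_simps)
    moreover have "(F has_vector_derivative D / (2 * F t)) (at t within {c..d})"
    proof -
      have "((\<lambda>t. potential a n Q (proj (\<gamma> t)) + (real CARD('n) + 1) * e) has_real_derivative D) (at t within {c..d})"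
        using dpot by (auto simp: has_real_derivative_iff_has_vector_derivative intro!: derivative_eq_intros)
      from DERIV_chain2[OF DERIV_real_sqrt this] pos
      show ?thesis
        by (simp add: F_def p_def P_def has_real_derivative_iff_has_vector_derivative[symmetric] field_simps)
    qed
    ultimately show ?thesis by blast
  qed
  then obtain F' where F': "\<And>t. t \<in> {c..d} \<Longrightarrow> (F has_vector_derivative F' t) (at t within {c..d})"
    "\<And>t. t \<in> {c..d} \<Longrightarrow> F' t \<le> ?v t" by metis
  have "(F' has_integral (F d - F c)) {c..d}"
    using cd F'(1) by (intro fundamental_theorem_of_calculus) auto
  moreover have "(?v has_integral integral {c..d} ?v) {c..d}"
    using integrable_continuous_real[OF C1_speed_continuous[OF cd C1]] by (rule integrable_integral)
  ultimately show ?thesis using F'(2) by (rule has_integral_le)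
qed

text \<open>At points interior to both intervals the two one-variable filters are the full
  neighbourhood filter. The end points are left out since the curve may have a corner there.\<close>

lemma speed_subinterval:
  fixes \<gamma> :: "real \<Rightarrow> (complex^'n) set"
  assumes C1: "C1_curve TYPE('j::finite) \<gamma> {c..d}" and t: "c < t" "t < d" and ac: "a \<le> c" "d \<le> b"
  shows "speed TYPE('j) \<gamma> {a..b} t = speed TYPE('j) \<gamma> {c..d} t"
proof -
  have tcd: "t \<in> {c..d}" using t by simp
  obtain A :: "real \<Rightarrow> complex^'j^'n" and A' r where A: "0 < r" "is_lift A \<gamma> ({c..d} \<inter> ball t r)"
    "\<And>s. s \<in> {c..d} \<inter> ball t r \<Longrightarrow> (A has_vector_derivative A' s) (at s within {c..d})"
    using C1 tcd unfolding C1_curve_def by blast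
  have A': "(A has_vector_derivative A' t) (at t within {c..d})" using A(1,3) tcd by auto
  define e where "e = min r (min (t - c) (d - t))"
  have e: "0 < e" using A(1) t by (simp add: e_def)
  have "ball t e \<subseteq> {c..d} \<inter> ball t r" by (auto simp: e_def dist_real_def)
  then have lift: "is_lift A \<gamma> ({a..b} \<inter> ball t e)" "is_lift A \<gamma> ({c..d} \<inter> ball t e)"
    using A(2) unfolding is_lift_def by blast+
  have "at t within {c..d} = at t" "at t within {a..b} = at t"
    using t ac by (simp_all add: at_within_Icc_at)
  then show ?thesis
    using speed_lift(1)[OF _ tcd e lift(2) A'] speed_lift(1)[OF _ _ e lift(1), of "A' t"] A' t ac by simp
qed

text \<open>Cutting at a point of \<open>S\<close> inside the interval leaves fewer such points
  strictly inside either half, hence induction on their number.\<close>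

lemma interval_additive_induct:
  fixes R :: "real \<Rightarrow> real \<Rightarrow> bool"
  assumes S: "finite S"
    and base: "\<And>c d. a \<le> c \<Longrightarrow> c < d \<Longrightarrow> d \<le> b \<Longrightarrow> {c<..<d} \<inter> S = {} \<Longrightarrow> R c d"
    and join: "\<And>c m d. a \<le> c \<Longrightarrow> c < m \<Longrightarrow> m < d \<Longrightarrow> d \<le> b \<Longrightarrow> R c m \<Longrightarrow> R m d \<Longrightarrow> R c d"
    and "a \<le> c" "c < d" "d \<le> b"
  shows "R c d"
  using assms(4-6)
proof (induction "card ({c<..<d} \<inter> S)" arbitrary: c d rule: less_induct)
  case less
  show ?case
  proof (cases "{c<..<d} \<inter> S = {}")
    case False
    then obtain m where m: "c < m" "m < d" "m \<in> S" by auto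
    have "card ({c<..<m} \<inter> S) < card ({c<..<d} \<inter> S)" "card ({m<..<d} \<inter> S) < card ({c<..<d} \<inter> S)"
      using m S by (auto intro!: psubset_card_mono)
    then have "R c m" "R m d" using less m by auto
    then show ?thesis using join less.prems m by blast
  qed (use base less.prems in blast)
qed

text \<open>Integrability and the estimate pass through the joins together: \<open>integral\<close>
  is 0 by convention on non-integrable functions, so the estimates alone could not be added.\<close>

lemma curve_length_potential_bound:
  fixes \<gamma> :: "real \<Rightarrow> (complex^'n) set" and Q :: "complex^'n^'n"
  assumes ab: "a < b" and C1: "piecewise_C1_curve TYPE('j::finite) \<gamma> a b"
    and Q: "Q\<^sup>\<dagger> = Q" "Q ** Q = Q" and e: "e > 0"
    and poly: "\<And>y. y \<in> {0..1} \<Longrightarrow>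
      (\<Sum>i\<le>n. k i * y ^ i)\<^sup>2 * y * (1 - y) \<le> (\<Sum>i\<le>n. k i / real (Suc i) * y ^ Suc i) + e"
  defines "F \<equiv> \<lambda>t. sqrt (potential k n Q (proj (\<gamma> t)) + (real CARD('n) + 1) * e)"
  shows "F b - F a \<le> curve_length TYPE('j) \<gamma> a b"
proof -
  let ?v = "speed TYPE('j) \<gamma> {a..b}"
  obtain S where S: "finite S"
    "\<And>c d. a \<le> c \<Longrightarrow> c < d \<Longrightarrow> d \<le> b \<Longrightarrow> {c<..<d} \<inter> S = {} \<Longrightarrow> C1_curve TYPE('j) \<gamma> {c..d}"
    using C1 unfolding piecewise_C1_curve_def by blast
  have "?v integrable_on {a..b} \<and> F b - F a \<le> integral {a..b} ?v"
  proof (rule interval_additive_induct[where a = a and b = b and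
        R = "\<lambda>c d. ?v integrable_on {c..d} \<and> F d - F c \<le> integral {c..d} ?v", OF S(1)])
    fix c d assume cd: "a \<le> c" "c < d" "d \<le> b" "{c<..<d} \<inter> S = {}"
    note C = S(2)[OF cd]
    have eq: "?v x = speed TYPE('j) \<gamma> {c..d} x" if "x \<in> {c..d} - {c, d}" for x
      by (rule speed_subinterval[OF C _ _ cd(1,3)]) (use that in auto)
    have int: "(speed TYPE('j) \<gamma> {c..d} has_integral integral {c..d} (speed TYPE('j) \<gamma> {c..d})) {c..d}"
      using integrable_continuous_real[OF C1_speed_continuous[OF cd(2) C]] by (rule integrable_integral)
    \<comment> \<open>The speeds relative to the two intervals may differ at the end points of the
      piece, a negligible set.\<close>
    have "finite {c, d}" by simp
    from has_integral_spike_finite[OF this eq int]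
    have "(?v has_integral integral {c..d} (speed TYPE('j) \<gamma> {c..d})) {c..d}" .
    then show "?v integrable_on {c..d} \<and> F d - F c \<le> integral {c..d} ?v"
      using C1_piece_potential_bound[OF cd(2) C Q e poly]
      by (auto simp: F_def integral_unique)
  next
    fix c m d
    assume cmd: "c < m" "m < d" and
      cm: "?v integrable_on {c..m} \<and> F m - F c \<le> integral {c..m} ?v" and
      md: "?v integrable_on {m..d} \<and> F d - F m \<le> integral {m..d} ?v"
    have "?v integrable_on {c..d}" 
      using cmd cm md by (intro Henstock_Kurzweil_Integration.integrable_combine[where a = c and b = d and c = m]) auto
    moreover from this have "integral {c..m} ?v + integral {m..d} ?v = integral {c..d} ?v"
      using cmd by (intro Henstock_Kurzweil_Integration.integral_combine) auto
    ultimately show "?v integrable_on {c..d} \<and> F d - F c \<le> integral {c..d} ?v"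
      using cm md by linarith
  qed (use ab in auto)
  then show ?thesis by (simp add: curve_length_def)
qed

text \<open>The polynomial, and with it the potential, changes with \<open>e\<close>; the limit is
  therefore taken only in the resulting scalar inequality.\<close>

lemma le_limit_sqrt:
  fixes x y k :: real
  assumes "\<And>e. e > 0 \<Longrightarrow> x \<le> y + sqrt (k * e)" "k \<ge> 0"
  shows "x \<le> y"
proof (rule tendsto_lowerbound)
  show "((\<lambda>e. y + sqrt (k * e)) \<longlongrightarrow> y) (at_right 0)"
  proof -
    have "((\<lambda>e. y + sqrt (k * e)) \<longlongrightarrow> y + sqrt (k * 0)) (at_right 0)"
      by (intro tendsto_intros)
    then show ?thesis by simp
  qed
  show "\<forall>\<^sub>F e in at_right 0. x \<le> y + sqrt (k * e)"
    using assms by (auto simp: eventually_at_filter)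
qed simp

text \<open>The compression \<open>Q ** proj (\<gamma> t) ** Q\<close> vanishes at \<open>a\<close>,
  and at \<open>b\<close> its eigenvalues are the squared sines of the angles, up to zeros. So the
  potential rises from 0 to nearly the sum of
  \<open>(arcsin (c * sin (\<theta> i)))\<^sup>2\<close>, and the gradient bound converts this rise
  into length.\<close>

theorem curve_length_lower_bound:
  fixes \<gamma> :: "real \<Rightarrow> (complex^'n) set" and A0 A1 R :: "complex^'j^'n"
  assumes ab: "a < b" and C1: "piecewise_C1_curve TYPE('j) \<gamma> a b"
    and ends: "\<gamma> a = col_space A0" "\<gamma> b = col_space A1"
    and St: "A0 \<in> stiefel" "A1 \<in> stiefel" "R \<in> stiefel" "V \<in> unitary_group"
    and \<theta>: "\<And>i. \<theta> i \<in> {0..pi/2}"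
    and svd: "(mat 1 - A0 ** A0\<^sup>\<dagger>) ** A1 = R ** diag (\<lambda>i. sin (\<theta> i)) ** V\<^sup>\<dagger>"
  shows "sqrt (\<Sum>i\<in>UNIV. (\<theta> i)\<^sup>2) \<le> curve_length TYPE('j) \<gamma> a b"
proof -
  let ?l = "curve_length TYPE('j) \<gamma> a b"
  define Q where "Q = mat 1 - A0 ** A0\<^sup>\<dagger>"
  have QA: "Q ** A0 = 0" and Q: "Q\<^sup>\<dagger> = Q" "Q ** Q = Q"
    using St(1) by (simp_all add: Q_def mat_simps stiefelD)
  have Za: "Q ** proj (\<gamma> a) ** Q = 0"
    by (simp add: ends proj_col_space St matrix_mul_assoc QA matrix_zero_left)
  have Zb: "Q ** proj (\<gamma> b) ** Q = R ** diag (\<lambda>i. (sin (\<theta> i))\<^sup>2) ** R\<^sup>\<dagger>"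
  proof -
    have "Q ** proj (\<gamma> b) ** Q = (Q ** A1) ** (Q ** A1)\<^sup>\<dagger>"
      by (simp add: ends proj_col_space St mat_simps Q)
    also have "\<dots> = R ** (diag (\<lambda>i. sin (\<theta> i)) ** diag (\<lambda>i. sin (\<theta> i))) ** R\<^sup>\<dagger>"
      using svd by (simp add: Q_def[symmetric] mat_simps unitaryD[OF St(4)])
    finally show ?thesis by (simp add: diag_mult power2_eq_square)
  qed
  \<comment> \<open>Only positive powers have this form: \<open>R\<close> is not square in general,
    so \<open>R ** R\<^sup>\<dagger>\<close> is a projection rather than \<open>mat 1\<close>. The
    potential contains only exponents \<open>Suc i\<close>.\<close>
  have mb: "mpow (Q ** proj (\<gamma> b) ** Q) (Suc i) = R ** diag (\<lambda>k. (sin (\<theta> k))\<^sup>2 ^ Suc i) ** R\<^sup>\<dagger>" for i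
  proof (induction i)
    case (Suc i)
    have "mpow (Q ** proj (\<gamma> b) ** Q) (Suc (Suc i))
        = (R ** diag (\<lambda>i. (sin (\<theta> i))\<^sup>2) ** R\<^sup>\<dagger>) ** (R ** diag (\<lambda>k. (sin (\<theta> k))\<^sup>2 ^ Suc i) ** R\<^sup>\<dagger>)"
      using Suc.IH unfolding Zb by simp
    also have "\<dots> = R ** (diag (\<lambda>i. (sin (\<theta> i))\<^sup>2) ** diag (\<lambda>k. (sin (\<theta> k))\<^sup>2 ^ Suc i)) ** R\<^sup>\<dagger>"
      by (simp add: mat_simps stiefelD[OF St(3)])
    finally show ?case by (simp add: diag_mult)
  qed (simp add: Zb)
  have rt: "rtrace (mpow (Q ** proj (\<gamma> b) ** Q) (Suc i)) = (\<Sum>k\<in>UNIV. (sin (\<theta> k))\<^sup>2 ^ Suc i)" for i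
  proof -
    have "rtrace (mpow (Q ** proj (\<gamma> b) ** Q) (Suc i))
        = rtrace (R\<^sup>\<dagger> ** (R ** diag (\<lambda>k. (sin (\<theta> k))\<^sup>2 ^ Suc i)))"
      unfolding mb by (rule rtrace_cyclic)
    then show ?thesis by (simp add: stiefelD[OF St(3)] rtrace_def trace_diag)
  qed
  have jn: "CARD('j) \<le> CARD('n)"
    using stiefel_grassmannian[OF St(1)] vec.dim_subset[of "col_space A0" UNIV]
    by (simp add: grassmannian_def vec_dim_card del: vec.dim_UNIV)
  have regularised: "sqrt (\<Sum>i\<in>UNIV. (arcsin (c * sin (\<theta> i)))\<^sup>2) \<le> ?l" if c: "0 < c" "c < 1" for c
  proof (rule le_limit_sqrt)
    fix e :: real assume e: "e > 0"
    obtain k :: "nat \<Rightarrow> real" and n where k: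
      "\<And>y. y \<in> {0..1} \<Longrightarrow> (\<Sum>i\<le>n. k i * y ^ i)\<^sup>2 * y * (1 - y) \<le> (\<Sum>i\<le>n. k i / real (Suc i) * y ^ Suc i) + e"
      "\<And>y. y \<in> {0..1} \<Longrightarrow> (arcsin (c * sqrt y))\<^sup>2 - e \<le> (\<Sum>i\<le>n. k i / real (Suc i) * y ^ Suc i)"
      using polynomial_approximation[OF c e] by blast
    have pa: "potential k n Q (proj (\<gamma> a)) = 0"
      by (simp add: potential_def Za matrix_zero_left rtrace_simps)
    have "(\<Sum>i\<in>UNIV. (arcsin (c * sin (\<theta> i)))\<^sup>2) - real CARD('j) * e
        = (\<Sum>i\<in>UNIV. (arcsin (c * sin (\<theta> i)))\<^sup>2 - e)"
      by (simp add: sum_subtractf)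
    also have "\<dots> \<le> (\<Sum>j\<in>UNIV. \<Sum>i\<le>n. k i / real (Suc i) * (sin (\<theta> j))\<^sup>2 ^ Suc i)"
    proof (rule sum_mono)
      fix j
      have "sin (\<theta> j) \<ge> 0" using \<theta>[of j] by (intro sin_ge_zero) auto
      then show "(arcsin (c * sin (\<theta> j)))\<^sup>2 - e \<le> (\<Sum>i\<le>n. k i / real (Suc i) * (sin (\<theta> j))\<^sup>2 ^ Suc i)"
        using k(2)[of "(sin (\<theta> j))\<^sup>2"] by (simp add: abs_square_le_1)
    qed
    also have "\<dots> = potential k n Q (proj (\<gamma> b))"
      unfolding potential_def rt sum_distrib_left by (rule sum.swap)
    finally have pb: "(\<Sum>i\<in>UNIV. (arcsin (c * sin (\<theta> i)))\<^sup>2) \<le> potential k n Q (proj (\<gamma> b)) + real CARD('j) * e"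
      by simp
    \<comment> \<open>At the end point the error arises once for each of the \<open>j\<close>
      angles, while the shift is sized for the \<open>n\<close> eigenvalues along the curve.\<close>
    have "real CARD('j) * e \<le> (real CARD('n) + 1) * e" using jn e by (intro mult_right_mono) auto
    with pb have "(\<Sum>i\<in>UNIV. (arcsin (c * sin (\<theta> i)))\<^sup>2) \<le> potential k n Q (proj (\<gamma> b)) + (real CARD('n) + 1) * e"
      by simp
    then have "sqrt (\<Sum>i\<in>UNIV. (arcsin (c * sin (\<theta> i)))\<^sup>2)
        \<le> sqrt (potential k n Q (proj (\<gamma> b)) + (real CARD('n) + 1) * e)" by simp
    then show "sqrt (\<Sum>i\<in>UNIV. (arcsin (c * sin (\<theta> i)))\<^sup>2) \<le> ?l + sqrt ((real CARD('n) + 1) * e)"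
      using curve_length_potential_bound[OF ab C1 Q e k(1)] unfolding pa add_0 by linarith
  qed simp
  \<comment> \<open>The limit \<open>c\<close> to 1 is harmless because \<open>arcsin\<close> is
    continuous up to 1, although its derivative blows up there.\<close>
  show ?thesis
  proof (rule tendsto_upperbound)
    have "((\<lambda>c. sqrt (\<Sum>i\<in>UNIV. (arcsin (c * sin (\<theta> i)))\<^sup>2)) \<longlongrightarrow> sqrt (\<Sum>i\<in>UNIV. (arcsin (1 * sin (\<theta> i)))\<^sup>2)) (at 1 within {0<..<1})"
    proof (intro tendsto_intros)
      fix i
      have "continuous_on {0..1} (\<lambda>c. arcsin (c * sin (\<theta> i)))"
      proof (intro continuous_intros ballI)
        fix c :: real assume "c \<in> {0..1}"
        then have "\<bar>c * sin (\<theta> i)\<bar> \<le> 1 * 1" unfolding abs_mult by (intro mult_mono) auto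
        then show "-1 \<le> c * sin (\<theta> i) \<and> c * sin (\<theta> i) \<le> 1" by (auto simp: abs_le_iff)
      qed
      then have "((\<lambda>c. arcsin (c * sin (\<theta> i))) \<longlongrightarrow> arcsin (1 * sin (\<theta> i))) (at 1 within {0..1})"
        unfolding continuous_on_def by (rule bspec) simp
      then show "((\<lambda>c. arcsin (c * sin (\<theta> i))) \<longlongrightarrow> arcsin (1 * sin (\<theta> i))) (at 1 within {0<..<1})"
        by (rule tendsto_within_subset) auto
    qed
    moreover have "arcsin (1 * sin (\<theta> i)) = \<theta> i" for i using \<theta>[of i] by (simp add: arcsin_sin)
    ultimately show "((\<lambda>c. sqrt (\<Sum>i\<in>UNIV. (arcsin (c * sin (\<theta> i)))\<^sup>2)) \<longlongrightarrow> sqrt (\<Sum>i\<in>UNIV. (\<theta> i)\<^sup>2)) (at 1 within {0<..<1})"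
      by simp
    show "\<forall>\<^sub>F c in at 1 within {0<..<1}. sqrt (\<Sum>i\<in>UNIV. (arcsin (c * sin (\<theta> i)))\<^sup>2) \<le> ?l"
      using regularised by (auto simp: eventually_at_filter)
    have "(1::real) islimpt {0<..<1}" by (simp add: islimpt_greaterThanLessThan2)
    then show "at (1::real) within {0<..<1} \<noteq> bot" by (simp add: trivial_limit_within)
  qed
qed

section \<open>Principal angles and the geodesic lift\<close>

text \<open>Since \<open>A1\<close> is Stiefel, the Gram matrices of \<open>M\<close> and
  \<open>E\<close> add up to \<open>mat 1\<close>. One \<open>V\<close> therefore diagonalises both,
  with eigenvalues \<open>s i\<close> and \<open>1 - s i\<close>, the squared cosine and sine of one
  angle. Normalising the columns of \<open>M ** V\<close> and \<open>E ** V\<close> gives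
  \<open>U\<close> and \<open>Q\<close>.\<close>

lemma svd_data_exists:
  fixes A0 A1 :: "complex^'j^'n"
  assumes le: "CARD('j) \<le> CARD('n)" and A0: "A0 \<in> stiefel" and A1: "A1 \<in> stiefel"
  shows "\<exists>U V Q \<theta>. svd_data A0 A1 U V Q \<theta>"
proof -
  define M where "M = A0\<^sup>\<dagger> ** A1"
  define E where "E = (mat 1 - A0 ** A0\<^sup>\<dagger>) ** A1"
  have "(M\<^sup>\<dagger> ** M)\<^sup>\<dagger> = M\<^sup>\<dagger> ** M" by (simp add: mat_simps)
  then obtain V s where V: "V \<in> unitary_group" and s: "M\<^sup>\<dagger> ** M = V ** diag s ** V\<^sup>\<dagger>"
    using hermitian_diagonalisation by blast
  have N1: "(M ** V)\<^sup>\<dagger> ** (M ** V) = diag s"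
  proof -
    have "(M ** V)\<^sup>\<dagger> ** (M ** V) = V\<^sup>\<dagger> ** (M\<^sup>\<dagger> ** M) ** V" by (simp add: mat_simps)
    then show ?thesis by (simp add: s mat_simps unitaryD[OF V])
  qed
  have "E\<^sup>\<dagger> ** E = mat 1 - M\<^sup>\<dagger> ** M"
    using A0 A1 by (simp add: E_def M_def mat_simps stiefelD)
  moreover have "(E ** V)\<^sup>\<dagger> ** (E ** V) = V\<^sup>\<dagger> ** (E\<^sup>\<dagger> ** E) ** V" by (simp add: mat_simps)
  ultimately have "(E ** V)\<^sup>\<dagger> ** (E ** V) = V\<^sup>\<dagger> ** (mat 1 - V ** diag s ** V\<^sup>\<dagger>) ** V"
    by (simp add: s)
  also have "\<dots> = diag (\<lambda>i. 1 - s i)"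
    by (simp add: mat_simps unitaryD[OF V] diag_diff[symmetric] diag_1)
  finally have N2: "(E ** V)\<^sup>\<dagger> ** (E ** V) = diag (\<lambda>i. 1 - s i)" .
  have nonneg: "d i \<ge> 0" if "N\<^sup>\<dagger> ** N = diag d" for N :: "complex^'a^'b" and d i
  proof -
    have "cinner (column i N) (column i N) = diag d $ i $ i" using that ct_mult_nth[of N N i i] by simp
    then show ?thesis by (simp add: cinner_self diag_def del: of_real_power) (metis zero_le_power2)
  qed
  have s01: "0 \<le> s i" "s i \<le> 1" for i using nonneg[OF N1, of i] nonneg[OF N2, of i] by auto
  define \<theta> where "\<theta> i = arccos (sqrt (s i))" for i
  have cs: "cos (\<theta> i) = sqrt (s i)" for i
    unfolding \<theta>_def using s01[of i] by (intro cos_arccos) (auto intro: order_trans[of _ 0])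
  have \<theta>: "\<theta> i \<in> {0..pi/2}" for i
  proof -
    have "0 \<le> sqrt (s i)" "sqrt (s i) \<le> 1" using s01[of i] by simp_all
    moreover from this have "0 \<le> arccos (sqrt (s i))" by (intro arccos_lbound) linarith+
    ultimately show ?thesis unfolding \<theta>_def using arccos_le_pi2[of "sqrt (s i)"] by simp
  qed
  have sn0: "sin (\<theta> i) \<ge> 0" for i using \<theta>[of i] by (intro sin_ge_zero) auto
  have sn: "(sin (\<theta> i))\<^sup>2 = 1 - s i" for i using cs[of i] s01[of i] by (simp add: sin_squared_eq)
  have "(M ** V)\<^sup>\<dagger> ** (M ** V) = diag (\<lambda>i. (cos (\<theta> i))\<^sup>2)" using s01 by (simp add: N1 cs)
  then obtain U where U: "U \<in> stiefel" "M ** V = U ** diag (\<lambda>i. cos (\<theta> i))"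
    by (rule orthogonal_columns_normalise[OF order_refl]) (use s01 cs in auto)
  have "(E ** V)\<^sup>\<dagger> ** (E ** V) = diag (\<lambda>i. (sin (\<theta> i))\<^sup>2)" by (simp add: N2 sn)
  then obtain Q where Q: "Q \<in> stiefel" "E ** V = Q ** diag (\<lambda>i. sin (\<theta> i))"
    by (rule orthogonal_columns_normalise[OF le]) (use sn0 in auto)
  have "M = M ** V ** V\<^sup>\<dagger>" "E = E ** V ** V\<^sup>\<dagger>" by (simp_all add: mat_simps unitaryD[OF V])
  then have "M = U ** diag (\<lambda>i. cos (\<theta> i)) ** V\<^sup>\<dagger>" "E = Q ** diag (\<lambda>i. sin (\<theta> i)) ** V\<^sup>\<dagger>"
    using U(2) Q(2) by simp_all
  then show ?thesis
    using U(1) Q(1) V \<theta> by (auto simp: svd_data_def M_def E_def stiefel_unitary)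
qed

lemma diag_has_vector_derivative:
  assumes "\<And>i. ((\<lambda>t. d t i) has_real_derivative d' i) (at t within S)"
  shows "((\<lambda>t. diag (d t)) has_vector_derivative diag d') (at t within S)"
proof -
  have *: "diag f = (\<Sum>i\<in>UNIV. f i *\<^sub>R diag (\<lambda>k. if k = i then 1 else 0))" for f :: "'a \<Rightarrow> real"
    by (simp add: diag_scaleR sum_diag if_distrib cong: if_cong)
  have "((\<lambda>t. \<Sum>i\<in>UNIV. d t i *\<^sub>R diag (\<lambda>k. if k = i then 1 else 0)) has_vector_derivative
      (\<Sum>i\<in>UNIV. d t i *\<^sub>R 0 + d' i *\<^sub>R diag (\<lambda>k. if k = i then 1 else 0))) (at t within S)"
    by (intro has_vector_derivative_sum has_vector_derivative_scaleR assms has_vector_derivative_const)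
  then show ?thesis by (subst *, subst (2) *) simp
qed

definition geodesic_velocity ::
    "complex^'j^'n \<Rightarrow> complex^'j^'j \<Rightarrow> complex^'j^'n \<Rightarrow> ('j \<Rightarrow> real) \<Rightarrow> real \<Rightarrow> complex^'j^'n"
  where "geodesic_velocity A0 U Q \<theta> t =
      (A0 ** U ** diag (\<lambda>i. - \<theta> i * sin (t * \<theta> i)) + Q ** diag (\<lambda>i. \<theta> i * cos (t * \<theta> i))) ** U\<^sup>\<dagger>"

locale svd =
  fixes A0 A1 :: "complex^'j^'n" and U V :: "complex^'j^'j" and Q :: "complex^'j^'n" and \<theta> :: "'j \<Rightarrow> real"
  assumes A0: "A0 \<in> stiefel" and A1: "A1 \<in> stiefel" and svd: "svd_data A0 A1 U V Q \<theta>"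
begin

abbreviation "A \<equiv> geodesic_lift A0 U Q \<theta>"
abbreviation "A' \<equiv> geodesic_velocity A0 U Q \<theta>"

lemma U: "U \<in> unitary_group" and V: "V \<in> unitary_group" and Q: "Q \<in> stiefel"
  and \<theta>: "\<theta> i \<in> {0..pi / 2}"
  and cos_part: "A0\<^sup>\<dagger> ** A1 = U ** diag (\<lambda>i. cos (\<theta> i)) ** V\<^sup>\<dagger>"
  and sin_part: "(mat 1 - A0 ** A0\<^sup>\<dagger>) ** A1 = Q ** diag (\<lambda>i. sin (\<theta> i)) ** V\<^sup>\<dagger>"
  using svd by (auto simp: svd_data_def)

lemma A_eq: "A t = (A0 ** U ** diag (\<lambda>i. cos (t * \<theta> i)) + Q ** diag (\<lambda>i. sin (t * \<theta> i))) ** U\<^sup>\<dagger>"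
  by (simp add: geodesic_lift_def mat_simps)

text \<open>The columns of \<open>Q\<close> with \<open>\<theta> i = 0\<close> are arbitrary, in particular they need not be
  orthogonal to the image of \<open>A0\<close>.\<close>

lemma cross_zero:
  assumes "\<And>i. \<theta> i = 0 \<Longrightarrow> d i = 0"
  shows "A0\<^sup>\<dagger> ** Q ** diag d = 0"
proof -
  \<comment> \<open>The relation is first obtained for \<open>sin (\<theta> i)\<close>, which
    vanishes on \<open>[0, pi/2]\<close> only at angle 0, and is then transferred to every
    \<open>d\<close> with those zeros.\<close>
  have "A0\<^sup>\<dagger> ** Q ** diag (\<lambda>i. sin (\<theta> i)) = A0\<^sup>\<dagger> ** (Q ** diag (\<lambda>i. sin (\<theta> i)) ** V\<^sup>\<dagger>) ** V"
    by (simp add: mat_simps unitaryD[OF V])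
  also have "\<dots> = 0"
    unfolding sin_part[symmetric] using A0 by (simp add: mat_simps stiefelD)
  finally have z: "(A0\<^sup>\<dagger> ** Q) $ i $ k * complex_of_real (sin (\<theta> k)) = 0" for i k
    by (metis mult_diag_nth zero_index)
  have "(A0\<^sup>\<dagger> ** Q) $ i $ k * complex_of_real (d k) = 0" for i k
  proof (cases "\<theta> k = 0")
    case False
    then have "sin (\<theta> k) > 0" using \<theta>[of k] by (intro sin_gt_zero) auto
    then show ?thesis using z[of i k] by simp
  qed (use assms in simp)
  then show ?thesis by (simp add: vec_eq_iff mult_diag_nth)
qed

text \<open>The mixed terms vanish by \<open>cross_zero\<close>, which is why the coefficients of
  \<open>Q\<close> must be 0 wherever the angle is. Both \<open>sin (t * \<theta> i)\<close> and
  \<open>\<theta> i * cos (t * \<theta> i)\<close> qualify.\<close>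

lemma frame_product:
  assumes "\<And>i. \<theta> i = 0 \<Longrightarrow> b i = 0" "\<And>i. \<theta> i = 0 \<Longrightarrow> d i = 0"
  shows "((A0 ** U ** diag a + Q ** diag b) ** U\<^sup>\<dagger>)\<^sup>\<dagger> ** ((A0 ** U ** diag c + Q ** diag d) ** U\<^sup>\<dagger>)
    = U ** diag (\<lambda>i. a i * c i + b i * d i) ** U\<^sup>\<dagger>"
proof -
  have 1: "A0\<^sup>\<dagger> ** (Q ** (diag d ** X)) = 0" for X :: "complex^'j^'j"
    using cross_zero[OF assms(2)] by (simp add: matrix_mul_assoc matrix_zero_left)
  have "diag b ** Q\<^sup>\<dagger> ** A0 = (A0\<^sup>\<dagger> ** Q ** diag b)\<^sup>\<dagger>" by (simp add: mat_simps)
  then have 2: "diag b ** (Q\<^sup>\<dagger> ** (A0 ** X)) = 0" for X :: "complex^'j^'j"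
    using cross_zero[OF assms(1)] by (simp add: matrix_mul_assoc matrix_zero_left)
  show ?thesis
    by (simp add: mat_simps stiefelD[OF A0] stiefelD[OF Q] unitaryD[OF U] 1 2 diag_add[symmetric]
        diag_mult[symmetric])
qed

lemma A_stiefel: "A t \<in> stiefel"
proof -
  have "(A t)\<^sup>\<dagger> ** A t = U ** diag (\<lambda>i. cos (t * \<theta> i) * cos (t * \<theta> i) + sin (t * \<theta> i) * sin (t * \<theta> i)) ** U\<^sup>\<dagger>"
    unfolding A_eq by (rule frame_product) auto
  then show ?thesis
    using unitaryD(2)[OF U] by (simp add: stiefel_def diag_1 flip: power2_eq_square)
qed

lemma A_horizontal: "(A t)\<^sup>\<dagger> ** A' t = 0"
proof -
  have "(A t)\<^sup>\<dagger> ** A' t = U ** diag (\<lambda>i. cos (t * \<theta> i) * (- \<theta> i * sin (t * \<theta> i))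
      + sin (t * \<theta> i) * (\<theta> i * cos (t * \<theta> i))) ** U\<^sup>\<dagger>"
    unfolding A_eq geodesic_velocity_def by (rule frame_product) auto
  then show ?thesis by (simp add: algebra_simps diag_0 matrix_zero_left matrix_zero_right)
qed

lemma norm_velocity: "norm (A' t) = sqrt (\<Sum>i\<in>UNIV. (\<theta> i)\<^sup>2)"
proof -
  have "(A' t)\<^sup>\<dagger> ** A' t = U ** diag (\<lambda>i. (- \<theta> i * sin (t * \<theta> i)) * (- \<theta> i * sin (t * \<theta> i))
      + (\<theta> i * cos (t * \<theta> i)) * (\<theta> i * cos (t * \<theta> i))) ** U\<^sup>\<dagger>"
    unfolding geodesic_velocity_def by (rule frame_product) auto
  also have "(\<lambda>i. (- \<theta> i * sin (t * \<theta> i)) * (- \<theta> i * sin (t * \<theta> i))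
      + (\<theta> i * cos (t * \<theta> i)) * (\<theta> i * cos (t * \<theta> i))) = (\<lambda>i. (\<theta> i)\<^sup>2)"
  proof
    fix i
    have "(- \<theta> i * sin (t * \<theta> i)) * (- \<theta> i * sin (t * \<theta> i)) + (\<theta> i * cos (t * \<theta> i)) * (\<theta> i * cos (t * \<theta> i))
        = (\<theta> i)\<^sup>2 * ((sin (t * \<theta> i))\<^sup>2 + (cos (t * \<theta> i))\<^sup>2)"
      by (simp only: power2_eq_square algebra_simps)
    then show "(- \<theta> i * sin (t * \<theta> i)) * (- \<theta> i * sin (t * \<theta> i)) + (\<theta> i * cos (t * \<theta> i)) * (\<theta> i * cos (t * \<theta> i)) = (\<theta> i)\<^sup>2"
      by simp
  qed
  finally have "(norm (A' t))\<^sup>2 = (\<Sum>i\<in>UNIV. (\<theta> i)\<^sup>2)"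
    unfolding power2_norm_eq_inner inner_eq_rtrace by (simp add: rtrace_diagonalised[OF U])
  then show ?thesis by (metis norm_ge_zero real_sqrt_unique)
qed

lemma A_derivative: "(A has_vector_derivative A' t) (at t within S)"
proof -
  have C: "((\<lambda>t. A0 ** U ** diag (\<lambda>i. cos (t * \<theta> i))) has_vector_derivative
      A0 ** U ** diag (\<lambda>i. - \<theta> i * sin (t * \<theta> i))) (at t within S)"
    by (rule bounded_linear.has_vector_derivative[OF matrix_mult.bounded_linear_right])
      (auto intro!: diag_has_vector_derivative derivative_eq_intros)
  have D: "((\<lambda>t. Q ** diag (\<lambda>i. sin (t * \<theta> i))) has_vector_derivative
      Q ** diag (\<lambda>i. \<theta> i * cos (t * \<theta> i))) (at t within S)"
    by (rule bounded_linear.has_vector_derivative[OF matrix_mult.bounded_linear_right])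
      (auto intro!: diag_has_vector_derivative derivative_eq_intros)
  show ?thesis
    unfolding A_eq[abs_def] geodesic_velocity_def
    by (rule bounded_linear.has_vector_derivative[OF matrix_mult.bounded_linear_left])
      (rule has_vector_derivative_add[OF C D])
qed

text \<open>A matrix version of the great circle equation: the right factor, the squared angle
  matrix in the basis \<open>U\<close>, is constant in \<open>t\<close>, as
  \<open>horizontal_frame_geodesic\<close> requires.\<close>

lemma velocity_derivative:
  "(A' has_vector_derivative - (A t ** (U ** diag (\<lambda>i. (\<theta> i)\<^sup>2) ** U\<^sup>\<dagger>))) (at t within S)"
proof -
  have C: "((\<lambda>t. A0 ** U ** diag (\<lambda>i. - \<theta> i * sin (t * \<theta> i))) has_vector_derivative
      A0 ** U ** diag (\<lambda>i. - (cos (t * \<theta> i) * (\<theta> i)\<^sup>2))) (at t within S)"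
    by (rule bounded_linear.has_vector_derivative[OF matrix_mult.bounded_linear_right])
      (auto intro!: diag_has_vector_derivative derivative_eq_intros simp: power2_eq_square)
  have D: "((\<lambda>t. Q ** diag (\<lambda>i. \<theta> i * cos (t * \<theta> i))) has_vector_derivative
      Q ** diag (\<lambda>i. - (sin (t * \<theta> i) * (\<theta> i)\<^sup>2))) (at t within S)"
    by (rule bounded_linear.has_vector_derivative[OF matrix_mult.bounded_linear_right])
      (auto intro!: diag_has_vector_derivative derivative_eq_intros simp: power2_eq_square)
  have neg: "diag (\<lambda>i. - (f i * g i)) = - (diag f ** diag g)" for f g :: "'j \<Rightarrow> real"
    unfolding diag_mult by (auto simp: vec_eq_iff diag_def)
  have "(A' has_vector_derivative (A0 ** U ** diag (\<lambda>i. - (cos (t * \<theta> i) * (\<theta> i)\<^sup>2))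
      + Q ** diag (\<lambda>i. - (sin (t * \<theta> i) * (\<theta> i)\<^sup>2))) ** U\<^sup>\<dagger>) (at t within S)"
    unfolding geodesic_velocity_def[abs_def]
    by (rule bounded_linear.has_vector_derivative[OF matrix_mult.bounded_linear_left])
      (rule has_vector_derivative_add[OF C D])
  then show ?thesis
    unfolding A_eq neg by (simp add: mat_simps unitaryD[OF U] add.commute)
qed

text \<open>At time 1 the lift is \<open>A1 ** (V ** U\<^sup>\<dagger>)\<close>, in general another
  frame of the same subspace.\<close>

lemma A_ends: "col_space (A 0) = col_space A0" "col_space (A 1) = col_space A1"
proof -
  have "A 0 = A0"
    by (simp add: A_eq diag_1 diag_0 mat_simps unitaryD[OF U])
  then show "col_space (A 0) = col_space A0" by simp
  have "A0 ** (A0\<^sup>\<dagger> ** A1) + (mat 1 - A0 ** A0\<^sup>\<dagger>) ** A1 = A1" by (simp add: mat_simps)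
  moreover define X where "X = A0 ** U ** diag (\<lambda>i. cos (\<theta> i)) + Q ** diag (\<lambda>i. sin (\<theta> i))"
  ultimately have "A1 = X ** V\<^sup>\<dagger>"
    unfolding cos_part sin_part by (simp add: mat_simps)
  then have "A1 ** (V ** U\<^sup>\<dagger>) = X ** U\<^sup>\<dagger>" by (simp add: mat_simps unitaryD[OF V])
  then have "A 1 = A1 ** (V ** U\<^sup>\<dagger>)" by (simp add: A_eq X_def)
  moreover have "(V ** U\<^sup>\<dagger>) ** (U ** V\<^sup>\<dagger>) = mat 1" by (simp add: mat_simps unitaryD[OF U] unitaryD[OF V])
  ultimately show "col_space (A 1) = col_space A1" using col_space_mult_invertible by metis
qed

lemma A_C1: "C1_curve TYPE('j) (\<lambda>t. col_space (A t)) I"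
proof -
  have "continuous_on I A'"
    using has_vector_derivative_continuous[OF velocity_derivative]
    by (auto simp: continuous_on_eq_continuous_within)
  then show ?thesis
    unfolding C1_curve_def is_lift_def using A_stiefel A_derivative
    by (intro ballI exI[of _ A] exI[of _ A'] exI[of _ 1]) (auto intro: continuous_on_subset)
qed

text \<open>The lift is horizontal, so its speed is the full norm of \<open>A'\<close>, which is
  constant.\<close>

lemma A_length: "curve_length TYPE('j) (\<lambda>t. col_space (A t)) 0 1 = sqrt (\<Sum>i\<in>UNIV. (\<theta> i)\<^sup>2)"
proof -
  have "speed TYPE('j) (\<lambda>t. col_space (A t)) {0..1} t = sqrt (\<Sum>i\<in>UNIV. (\<theta> i)\<^sup>2)" if t: "t \<in> {0..1}" for t
    using speed_lift(1)[OF _ t, of 1 A "\<lambda>t. col_space (A t)" "A' t"] A_stiefel A_derivative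
    by (simp add: is_lift_def A_horizontal matrix_zero_right norm_velocity)
  then have "integral {0..1} (speed TYPE('j) (\<lambda>t. col_space (A t)) {0..1})
      = integral {0..1::real} (\<lambda>t. sqrt (\<Sum>i\<in>UNIV. (\<theta> i)\<^sup>2))"
    by (intro integral_cong) simp
  then show ?thesis by (simp add: curve_length_def)
qed

lemma A_length_minimizing: "length_minimizing TYPE('j) (\<lambda>t. col_space (A t)) 0 1"
  unfolding length_minimizing_def
proof (intro conjI allI impI)
  show "piecewise_C1_curve TYPE('j) (\<lambda>t. col_space (A t)) 0 1"
    unfolding piecewise_C1_curve_def using A_C1 by blast
  fix \<delta> assume "piecewise_C1_curve TYPE('j) \<delta> 0 1 \<and> \<delta> 0 = col_space (A 0) \<and> \<delta> 1 = col_space (A 1)"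
  then show "curve_length TYPE('j) (\<lambda>t. col_space (A t)) 0 1 \<le> curve_length TYPE('j) \<delta> 0 1"
    unfolding A_length A_ends
    using curve_length_lower_bound[OF _ _ _ _ A0 A1 Q V \<theta> sin_part] by simp
qed

end

section \<open>The metric in graph charts\<close>

text \<open>For tangent \<open>X\<close> the matrix \<open>B\<^sup>\<dagger> ** X\<close> is
  skew-Hermitian, so \<open>B ** (B\<^sup>\<dagger> ** X)\<close> is vertical; pairing
  \<open>X\<close> with it gives the squared norm of \<open>B\<^sup>\<dagger> ** X\<close>.\<close>

lemma horizontal_space_iff:
  fixes B X :: "complex^'j^'n"
  assumes B: "B \<in> stiefel"
  shows "X \<in> horizontal_space B \<longleftrightarrow> B\<^sup>\<dagger> ** X = 0"
proof
  assume X: "X \<in> horizontal_space B"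
  then have "X\<^sup>\<dagger> ** B = - (B\<^sup>\<dagger> ** X)"
    by (intro stiefel_tangent_skew) (simp add: horizontal_space_def)
  then have "(B\<^sup>\<dagger> ** X)\<^sup>\<dagger> = - (B\<^sup>\<dagger> ** X)" by (simp add: mat_simps)
  then have "B ** (B\<^sup>\<dagger> ** X) \<in> vertical_space B" by (auto simp: vertical_space_def)
  then have "inner X (B ** (B\<^sup>\<dagger> ** X)) = 0" using X by (simp add: horizontal_space_def)
  then have "inner (B ** (B\<^sup>\<dagger> ** X)) X = 0" by (subst inner_commute)
  then show "B\<^sup>\<dagger> ** X = 0"
    using inner_matrix_left[of B "B\<^sup>\<dagger> ** X" X] by simp
next
  assume X: "B\<^sup>\<dagger> ** X = 0"
  have "X\<^sup>\<dagger> ** B = (B\<^sup>\<dagger> ** X)\<^sup>\<dagger>" by (simp add: mat_simps)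
  moreover have "inner X (B ** W) = 0" for W
    using X inner_commute[of X "B ** W"] inner_matrix_left[of B W X] by simp
  ultimately show "X \<in> horizontal_space B"
    using X by (auto simp: horizontal_space_def stiefel_tangent_def vertical_space_def)
qed

lemma horizontal_adjoint:
  fixes B X :: "complex^'j^'n"
  assumes "B\<^sup>\<dagger> ** X = 0"
  shows "X\<^sup>\<dagger> ** B = 0"
  using arg_cong[OF assms, of ctranspose] by (simp add: ct_mult)

section \<open>Second order control of inverse square roots\<close>

lemma sum_squares_le_square_sum:
  fixes f :: "'a \<Rightarrow> real"
  assumes "finite I" "\<And>i. i \<in> I \<Longrightarrow> f i \<ge> 0"
  shows "(\<Sum>i\<in>I. (f i)\<^sup>2) \<le> (\<Sum>i\<in>I. f i)\<^sup>2"
  using assms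
proof (induction I)
  case (insert i I)
  have "(\<Sum>i\<in>I. f i) \<ge> 0" using insert by (intro sum_nonneg) auto
  then have "0 \<le> 2 * f i * (\<Sum>i\<in>I. f i)" using insert by simp
  moreover have "(\<Sum>i\<in>I. (f i)\<^sup>2) \<le> (\<Sum>i\<in>I. f i)\<^sup>2" using insert by simp
  ultimately show ?case using insert.hyps by (simp add: power2_sum)
qed simp

lemma inverse_sqrt_estimate:
  fixes s :: real
  assumes "s \<ge> 1/4"
  shows "\<bar>1 / sqrt s - (1 - (s - 1) / 2)\<bar> \<le> 2 * (s - 1)\<^sup>2"
proof -
  define u where "u = sqrt s"
  have "sqrt (1/4) \<le> u" unfolding u_def using assms by (rule real_sqrt_le_mono)
  then have u: "u \<ge> 1/2" by (simp add: real_sqrt_divide)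
  have s: "s = u\<^sup>2" using assms by (simp add: u_def)
  \<comment> \<open>The remainder of the linear approximation at 1 factors exactly in
    \<open>u = sqrt s\<close>; \<open>u \<ge> 1/2\<close> then controls the quotient.\<close>
  have eq: "1 / u - (1 - (u\<^sup>2 - 1) / 2) = (u - 1)\<^sup>2 * ((u + 2) / (2 * u))"
    using u by (simp add: field_simps power2_eq_square)
  have "(u + 2) / (2 * u) \<le> 2 * (u + 1)\<^sup>2"
  proof -
    have "u + 2 \<le> 2 * (1/2 + 1)\<^sup>2 * (2 * u)" using u by (simp add: power2_eq_square)
    also have "\<dots> \<le> 2 * (u + 1)\<^sup>2 * (2 * u)"
      using u by (intro mult_right_mono mult_left_mono power_mono) auto
    finally show ?thesis using u by (simp add: divide_le_eq)
  qed
  then have "(u - 1)\<^sup>2 * ((u + 2) / (2 * u)) \<le> (u - 1)\<^sup>2 * (2 * (u + 1)\<^sup>2)"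
    by (rule mult_left_mono) simp
  also have "\<dots> = 2 * (u\<^sup>2 - 1)\<^sup>2"
    by (simp add: power2_eq_square algebra_simps)
  finally have "(u - 1)\<^sup>2 * ((u + 2) / (2 * u)) \<le> 2 * (u\<^sup>2 - 1)\<^sup>2" .
  moreover have "0 \<le> (u - 1)\<^sup>2 * ((u + 2) / (2 * u))" using u by simp
  ultimately show ?thesis unfolding u_def[symmetric] unfolding s eq by simp
qed

text \<open>\<open>G\<close>, its inverse root and the linear approximation are diagonal in one
  unitary basis and the norm is unitarily invariant, so the scalar estimate applies to each
  eigenvalue. The bound 1/2 keeps the eigenvalues in its range. Fourth powers are summed through the
  square of a sum.\<close>

lemma inverse_square_root_near_identity:
  fixes G :: "complex^'j^'j"
  assumes G: "G\<^sup>\<dagger> = G" and near: "norm (G - mat 1) \<le> 1/2"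
  shows "\<exists>H. H\<^sup>\<dagger> = H \<and> H ** G ** H = mat 1
    \<and> norm (H - (mat 1 - (1/2) *\<^sub>R (G - mat 1))) \<le> 2 * (norm (G - mat 1))\<^sup>2"
proof -
  obtain V s where V: "V \<in> unitary_group" and s: "G = V ** diag s ** V\<^sup>\<dagger>"
    using hermitian_diagonalisation[OF G] by blast
  have one: "mat 1 = V ** diag (\<lambda>i. 1) ** V\<^sup>\<dagger>" by (simp add: diag_1 unitaryD[OF V])
  have dd: "V ** diag f ** V\<^sup>\<dagger> - V ** diag g ** V\<^sup>\<dagger> = V ** diag (\<lambda>i. f i - g i) ** V\<^sup>\<dagger>"
    "r *\<^sub>R (V ** diag f ** V\<^sup>\<dagger>) = V ** diag (\<lambda>i. r * f i) ** V\<^sup>\<dagger>" for f g r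
    by (simp_all add: mat_simps diag_diff[symmetric] diag_scaleR[symmetric])
  have nd: "(norm (V ** diag f ** V\<^sup>\<dagger>))\<^sup>2 = (\<Sum>i\<in>UNIV. (f i)\<^sup>2)" for f
    using V by (simp add: norm_mult_unitary_ct norm_stiefel_mult stiefel_unitary norm_diag_sq)
  have n: "(norm (G - mat 1))\<^sup>2 = (\<Sum>i\<in>UNIV. (s i - 1)\<^sup>2)"
    unfolding one s dd nd ..
  have s_ge: "s i \<ge> 1/4" for i
  proof -
    have "(s i - 1)\<^sup>2 \<le> (\<Sum>i\<in>UNIV. (s i - 1)\<^sup>2)" by (rule member_le_sum) auto
    also have "\<dots> \<le> (1/2)\<^sup>2" unfolding n[symmetric] using near by (intro power_mono) auto
    finally have "\<bar>s i - 1\<bar> \<le> 1/2" by (simp add: abs_le_square_iff[symmetric])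
    then show ?thesis by linarith
  qed
  define H where "H = V ** diag (\<lambda>i. 1 / sqrt (s i)) ** V\<^sup>\<dagger>"
  have "H\<^sup>\<dagger> = H" by (simp add: H_def mat_simps)
  moreover have "1 / sqrt (s i) * s i * (1 / sqrt (s i)) = 1" for i
    using s_ge[of i] by (simp add: field_simps flip: real_sqrt_mult)
  then have "H ** G ** H = mat 1"
    unfolding H_def s mult_diagonalised[OF V] by (simp add: diag_1 unitaryD[OF V])
  moreover have "(norm (H - (mat 1 - (1/2) *\<^sub>R (G - mat 1))))\<^sup>2
      = (\<Sum>i\<in>UNIV. (1 / sqrt (s i) - (1 - (s i - 1) / 2))\<^sup>2)"
    unfolding H_def one s dd nd by simp
  then have "(norm (H - (mat 1 - (1/2) *\<^sub>R (G - mat 1))))\<^sup>2 \<le> (2 * (norm (G - mat 1))\<^sup>2)\<^sup>2"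
  proof (rule ord_eq_le_trans)
    have "(\<Sum>i\<in>UNIV. (1 / sqrt (s i) - (1 - (s i - 1) / 2))\<^sup>2) \<le> (\<Sum>i\<in>UNIV. (2 * (s i - 1)\<^sup>2)\<^sup>2)"
      using inverse_sqrt_estimate[OF s_ge] by (intro sum_mono) (metis abs_ge_zero power2_abs power_mono)
    also have "\<dots> \<le> (\<Sum>i\<in>UNIV. 2 * (s i - 1)\<^sup>2)\<^sup>2" by (rule sum_squares_le_square_sum) auto
    finally show "(\<Sum>i\<in>UNIV. (1 / sqrt (s i) - (1 - (s i - 1) / 2))\<^sup>2) \<le> (2 * (norm (G - mat 1))\<^sup>2)\<^sup>2"
      unfolding n sum_distrib_left .
  qed
  then have "norm (H - (mat 1 - (1/2) *\<^sub>R (G - mat 1))) \<le> 2 * (norm (G - mat 1))\<^sup>2"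
    by (rule power2_le_imp_le) simp
  ultimately show ?thesis by blast
qed

text \<open>The eigenvalues of \<open>mat 1 + X\<^sup>\<dagger> ** X\<close> are at least 1, so an
  inverse square root exists for every \<open>X\<close>.\<close>

lemma positive_normaliser_exists:
  fixes X :: "complex^'j^'n"
  obtains K :: "complex^'j^'j" where "K\<^sup>\<dagger> ** (mat 1 + X\<^sup>\<dagger> ** X) ** K = mat 1"
proof -
  let ?G = "mat 1 + X\<^sup>\<dagger> ** X"
  have "?G\<^sup>\<dagger> = ?G" by (simp add: mat_simps)
  then obtain V s where V: "V \<in> unitary_group" and s: "?G = V ** diag s ** V\<^sup>\<dagger>"
    using hermitian_diagonalisation by blast
  have s_ge: "s i \<ge> 1" for i
  proof -
    let ?v = "column i V"
    have "inner ?v (X\<^sup>\<dagger> *v (X *v ?v)) = inner (X *v ?v) (X *v ?v)"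
      by (simp add: inner_eq_Re_cinner cinner_mult)
    then have "s i = (norm ?v)\<^sup>2 + (norm (X *v ?v))\<^sup>2"
      using diagonalisation_entry(1)[OF V s, of i]
      by (simp add: matrix_vector_mult_add_rdistrib inner_add_right matrix_vector_mul_assoc
          power2_norm_eq_inner)
    then show ?thesis using diagonalisation_entry(2)[OF V s] by simp
  qed
  have e: "1 / sqrt (s i) * s i * (1 / sqrt (s i)) = 1" for i
    using s_ge[of i] by (simp add: field_simps flip: real_sqrt_mult)
  let ?K = "V ** diag (\<lambda>i. 1 / sqrt (s i)) ** V\<^sup>\<dagger>"
  have "?K ** ?G ** ?K = mat 1"
    unfolding s mult_diagonalised[OF V] e by (simp add: diag_1 unitaryD[OF V])
  moreover have "?K\<^sup>\<dagger> = ?K" by (simp add: mat_simps)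
  ultimately have "?K\<^sup>\<dagger> ** ?G ** ?K = mat 1" by metis
  then show ?thesis by (rule that)
qed

text \<open>\<open>(norm (f y - f x))\<^sup>2\<close> has derivative 0 at \<open>x\<close> by the
  product rule, since both factors vanish there, and it dominates \<open>r\<close>.\<close>

lemma quadratic_remainder_derivative:
  fixes f :: "'a::real_normed_vector \<Rightarrow> 'b::real_inner" and r :: "'a \<Rightarrow> 'c::real_normed_vector"
  assumes f': "(f has_derivative f') (at x within S)" and rx: "r x = 0"
    and bound: "\<forall>\<^sub>F y in at x within S. norm (r y) \<le> C * (norm (f y - f x))\<^sup>2"
  shows "(r has_derivative (\<lambda>_. 0)) (at x within S)"
proof -
  have d: "((\<lambda>y. f y - f x) has_derivative (\<lambda>w. f' w - 0)) (at x within S)"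
    by (rule has_derivative_diff[OF f' has_derivative_const])
  have "((\<lambda>y. inner (f y - f x) (f y - f x)) has_derivative (\<lambda>w. 0)) (at x within S)"
    using has_derivative_inner[OF d d] by simp
  then have "((\<lambda>y. (1 / norm (y - x)) *\<^sub>R (inner (f y - f x) (f y - f x) - 0)) \<longlongrightarrow> 0) (at x within S)"
    by (simp add: has_derivative_within)
  then have lim: "((\<lambda>y. C * ((1 / norm (y - x)) * (norm (f y - f x))\<^sup>2)) \<longlongrightarrow> 0) (at x within S)"
    by (intro tendsto_mult_right_zero) (simp add: power2_norm_eq_inner)
  have "((\<lambda>y. (1 / norm (y - x)) *\<^sub>R r y) \<longlongrightarrow> 0) (at x within S)"
  proof (rule Lim_null_comparison[OF _ lim])
    show "\<forall>\<^sub>F y in at x within S. norm ((1 / norm (y - x)) *\<^sub>R r y)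
        \<le> C * ((1 / norm (y - x)) * (norm (f y - f x))\<^sup>2)"
      using bound
    proof eventually_elim
      case (elim y)
      then have "(1 / norm (y - x)) * norm (r y) \<le> (1 / norm (y - x)) * (C * (norm (f y - f x))\<^sup>2)"
        by (intro mult_left_mono) auto
      then show ?case by simp
    qed
  qed
  then show ?thesis by (simp add: has_derivative_within rx)
qed

text \<open>The lift \<open>(B + Y) (I + Y\<^sup>* Y)\<^sup>-\<^sup>1\<^sup>/\<^sup>2\<close> only needs to be differentiable at the centre point \<open>X\<close>,
  and after normalising the Gram matrix at \<open>X\<close> to the identity this follows from a second order
  estimate of the inverse square root.\<close>

lemma graph_chart_lift:
  fixes B X :: "complex^'j^'n"
  assumes B: "B \<in> stiefel" and X: "B\<^sup>\<dagger> ** X = 0"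
  obtains e :: real and A :: "complex^'j^'n \<Rightarrow> complex^'j^'n"
    and K :: "complex^'j^'j" and L where "0 < e"
    "is_lift A (graph_chart B) (horizontal_space B \<inter> ball X e)"
    "A X = (B + X) ** K" "K\<^sup>\<dagger> ** (mat 1 + X\<^sup>\<dagger> ** X) ** K = mat 1"
    "(A has_derivative (\<lambda>w. w ** K + (B + X) ** L w)) (at X within horizontal_space B)"
proof -
  let ?S = "horizontal_space B"
  obtain K :: "complex^'j^'j" where K: "K\<^sup>\<dagger> ** (mat 1 + X\<^sup>\<dagger> ** X) ** K = mat 1"
    by (rule positive_normaliser_exists)
  define G where "G Y = K\<^sup>\<dagger> ** (mat 1 + Y\<^sup>\<dagger> ** Y) ** K" for Y :: "complex^'j^'n"
  have GH: "(G Y)\<^sup>\<dagger> = G Y" for Y by (simp add: G_def mat_simps)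
  have GX: "G X = mat 1" by (simp add: G_def K)
  \<comment> \<open>The inverse roots are chosen separately at each \<open>Y\<close>; the second
    order bound gives differentiability of this choice at \<open>X\<close>.\<close>
  have "\<forall>Y. \<exists>H. norm (G Y - mat 1) \<le> 1/2 \<longrightarrow> H\<^sup>\<dagger> = H \<and> H ** G Y ** H = mat 1
      \<and> norm (H - (mat 1 - (1/2) *\<^sub>R (G Y - mat 1))) \<le> 2 * (norm (G Y - mat 1))\<^sup>2"
    using inverse_square_root_near_identity[OF GH] by blast
  then obtain h where h: "\<And>Y. norm (G Y - mat 1) \<le> 1/2 \<Longrightarrow> (h Y)\<^sup>\<dagger> = h Y \<and> h Y ** G Y ** h Y = mat 1
      \<and> norm (h Y - (mat 1 - (1/2) *\<^sub>R (G Y - mat 1))) \<le> 2 * (norm (G Y - mat 1))\<^sup>2"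
    by metis
  have hX: "h X = mat 1" using h[of X] by (simp add: GX)
  define r where "r Y = h Y - (mat 1 - (1/2) *\<^sub>R (G Y - mat 1))" for Y
  have Gd: "(G has_derivative (\<lambda>w. K\<^sup>\<dagger> ** (X\<^sup>\<dagger> ** w + w\<^sup>\<dagger> ** X) ** K)) (at X within ?S)"
  proof -
    have "((\<lambda>Y. Y\<^sup>\<dagger> ** Y) has_derivative (\<lambda>w. X\<^sup>\<dagger> ** w + w\<^sup>\<dagger> ** X)) (at X within ?S)"
      by (rule matrix_mult.FDERIV[OF bounded_linear.has_derivative[OF bounded_linear_ctranspose has_derivative_ident]
            has_derivative_ident])
    from has_derivative_add[OF has_derivative_const this]
    have "((\<lambda>Y. mat 1 + Y\<^sup>\<dagger> ** Y) has_derivative (\<lambda>w. X\<^sup>\<dagger> ** w + w\<^sup>\<dagger> ** X)) (at X within ?S)"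
      by simp
    then show ?thesis unfolding G_def[abs_def]
      by (intro bounded_linear.has_derivative[OF matrix_mult.bounded_linear_left]
          bounded_linear.has_derivative[OF matrix_mult.bounded_linear_right])
  qed
  define G' where "G' w = K\<^sup>\<dagger> ** (X\<^sup>\<dagger> ** w + w\<^sup>\<dagger> ** X) ** K" for w
  have "continuous_on UNIV G"
    unfolding G_def[abs_def]
    by (intro matrix_mult.continuous_on continuous_intros bounded_linear.continuous_on[OF bounded_linear_ctranspose])
  then have "continuous_on UNIV (\<lambda>Y. norm (G Y - mat 1))" by (intro continuous_intros)
  then have "open {Y. norm (G Y - mat 1) < 1/2}"
    by (intro open_Collect_less continuous_on_const)
  moreover have "X \<in> {Y. norm (G Y - mat 1) < 1/2}" by (simp add: GX)
  ultimately obtain e where e: "e > 0" "\<And>Y. Y \<in> ball X e \<Longrightarrow> norm (G Y - mat 1) < 1/2"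
    unfolding open_contains_ball by blast
  have near: "\<forall>\<^sub>F Y in at X within ?S. Y \<in> ball X e"
    using e(1) by (auto simp: eventually_at dist_commute intro!: exI[of _ e])
  have "(r has_derivative (\<lambda>_. 0)) (at X within ?S)"
  proof (rule quadratic_remainder_derivative[OF Gd])
    show "r X = 0" by (simp add: r_def hX GX)
    show "\<forall>\<^sub>F Y in at X within ?S. norm (r Y) \<le> 2 * (norm (G Y - G X))\<^sup>2"
      using near
    proof eventually_elim
      case (elim Y)
      then show ?case using h[of Y] e(2)[of Y] by (simp add: r_def GX)
    qed
  qed
  from has_derivative_add[OF this has_derivative_diff[OF has_derivative_const
      has_derivative_scaleR_right[OF has_derivative_diff[OF Gd has_derivative_const]]], of "mat 1" "1/2" "mat 1"]
  have hd: "(h has_derivative (\<lambda>w. - ((1/2) *\<^sub>R G' w))) (at X within ?S)"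
    by (simp add: r_def G'_def)
  define A where "A Y = (B + Y) ** (K ** h Y)" for Y
  have AX: "A X = (B + X) ** K" by (simp add: A_def hX)
  have "((\<lambda>Y. B + Y) has_derivative (\<lambda>w. 0 + w)) (at X within ?S)"
    by (intro has_derivative_add has_derivative_const has_derivative_ident)
  \<comment> \<open>The summand with \<open>B + X\<close> on the left lies along the column space
    and is removed by the horizontal projection in \<open>chart_metric_eq\<close>, so the statement
    exposes it only through \<open>L\<close>.\<close>
  from matrix_mult.FDERIV[OF this bounded_linear.has_derivative[OF matrix_mult.bounded_linear_right hd]]
  have Ad: "(A has_derivative (\<lambda>w. w ** K + (B + X) ** (K ** - ((1/2) *\<^sub>R G' w)))) (at X within ?S)"
    by (simp add: A_def[abs_def] hX add.commute)
  have lift: "is_lift A (graph_chart B) (?S \<inter> ball X e)"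
    unfolding is_lift_def
  proof (intro ballI conjI)
    fix Y assume Y: "Y \<in> ?S \<inter> ball X e"
    then have BY: "B\<^sup>\<dagger> ** Y = 0" using horizontal_space_iff[OF B] by auto
    have hY: "(h Y)\<^sup>\<dagger> = h Y" "h Y ** G Y ** h Y = mat 1"
      using h[of Y] e(2)[of Y] Y by auto
    have "(B + Y)\<^sup>\<dagger> ** (B + Y) = mat 1 + Y\<^sup>\<dagger> ** Y"
      by (simp add: mat_simps BY horizontal_adjoint[OF BY] stiefelD[OF B])
    then have "(A Y)\<^sup>\<dagger> ** A Y = h Y ** G Y ** h Y"
      by (simp add: A_def G_def ct_mult hY(1) flip: matrix_mul_assoc) (simp add: matrix_mul_assoc)
    then show "A Y \<in> stiefel" by (simp add: stiefel_def hY)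
    have "(h Y ** K\<^sup>\<dagger> ** (mat 1 + Y\<^sup>\<dagger> ** Y)) ** (K ** h Y) = mat 1"
      using hY(2) by (simp add: G_def matrix_mul_assoc)
    then have "(K ** h Y) ** (h Y ** K\<^sup>\<dagger> ** (mat 1 + Y\<^sup>\<dagger> ** Y)) = mat 1"
      by (rule iffD1[OF square_inverse_comm])
    then show "col_space (A Y) = graph_chart B Y"
      unfolding A_def graph_chart_def by (rule col_space_mult_invertible)
  qed
  show ?thesis by (rule that[OF e(1) lift AX K Ad])
qed

text \<open>Applied to \<open>X\<^sup>\<dagger>\<close> this inverts
  \<open>mat 1 + X ** X\<^sup>\<dagger>\<close>, so one function provides both factors of the chart
  metric.\<close>

definition gram_inv :: "complex^'j^'n \<Rightarrow> complex^'j^'j"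
  where "gram_inv X = matrix_inv (mat 1 + X\<^sup>\<dagger> ** X)"

lemma gram_inv:
  fixes X :: "complex^'j^'n"
  shows "gram_inv X ** (mat 1 + X\<^sup>\<dagger> ** X) = mat 1" "(mat 1 + X\<^sup>\<dagger> ** X) ** gram_inv X = mat 1"
proof -
  obtain K :: "complex^'j^'j" where "K\<^sup>\<dagger> ** (mat 1 + X\<^sup>\<dagger> ** X) ** K = mat 1" by (rule positive_normaliser_exists)
  then have "(K ** K\<^sup>\<dagger>) ** (mat 1 + X\<^sup>\<dagger> ** X) = mat 1"
    by (metis matrix_mul_assoc square_inverse_comm)
  then have "invertible (mat 1 + X\<^sup>\<dagger> ** X)" unfolding invertible_def using square_inverse_comm by blast
  then show "gram_inv X ** (mat 1 + X\<^sup>\<dagger> ** X) = mat 1" "(mat 1 + X\<^sup>\<dagger> ** X) ** gram_inv X = mat 1"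
    unfolding gram_inv_def matrix_inv_def invertible_def by (metis (mono_tags, lifting) someI_ex)+
qed

lemma gram_inv_unique:
  assumes "M ** (mat 1 + X\<^sup>\<dagger> ** X) = mat 1"
  shows "gram_inv X = M"
  by (metis assms gram_inv(2) matrix_mul_assoc matrix_mul_lid matrix_mul_rid)

lemma gram_inv_hermitian [simp]: "(gram_inv X)\<^sup>\<dagger> = gram_inv X"
proof (rule gram_inv_unique[symmetric])
  show "(gram_inv X)\<^sup>\<dagger> ** (mat 1 + X\<^sup>\<dagger> ** X) = mat 1"
    using arg_cong[OF gram_inv(2)[of X], of ctranspose] by (simp add: mat_simps)
qed

text \<open>Push-through identity: \<open>(mat 1 + X ** X\<^sup>\<dagger>) ** X = X ** (mat 1 +
  X\<^sup>\<dagger> ** X)\<close>, multiplied by the two inverses.\<close>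

lemma gram_inv_intertwine: "gram_inv (X\<^sup>\<dagger>) ** X = X ** gram_inv X"
proof -
  let ?K = "gram_inv (X\<^sup>\<dagger>)" and ?M = "gram_inv X"
  have "?K ** ((mat 1 + X ** X\<^sup>\<dagger>) ** X) ** ?M = ?K ** (X ** (mat 1 + X\<^sup>\<dagger> ** X)) ** ?M"
    by (simp add: mat_simps)
  moreover have "?K ** ((mat 1 + X ** X\<^sup>\<dagger>) ** X) ** ?M = X ** ?M"
    using gram_inv(1)[of "X\<^sup>\<dagger>"] by (simp add: matrix_mul_assoc)
  moreover have "?K ** (X ** (mat 1 + X\<^sup>\<dagger> ** X)) ** ?M = ?K ** X"
    using gram_inv(2)[of X] by (simp add: matrix_mul_assoc[symmetric])
  ultimately show ?thesis by simp
qed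

text \<open>A case of the Woodbury identity; it recognises the second inverse in the complement of a
  projection.\<close>

lemma gram_inv_adjoint: "gram_inv (X\<^sup>\<dagger>) = mat 1 - X ** gram_inv X ** X\<^sup>\<dagger>"
proof -
  have "gram_inv (X\<^sup>\<dagger>) ** (mat 1 + X ** X\<^sup>\<dagger>) = mat 1" using gram_inv(1)[of "X\<^sup>\<dagger>"] by simp
  then have "gram_inv (X\<^sup>\<dagger>) + (gram_inv (X\<^sup>\<dagger>) ** X) ** X\<^sup>\<dagger> = mat 1" by (simp add: mat_simps)
  then show ?thesis unfolding gram_inv_intertwine by (simp add: eq_diff_eq)
qed

text \<open>Up to a term in the column space the lift moves by \<open>w ** K\<close>, so the metric
  pairs \<open>u ** K\<close> with \<open>v ** K\<close> after applying \<open>mat 1 - P\<close>.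
  Since \<open>K ** K\<^sup>\<dagger> = gram_inv X\<close> and \<open>u\<close>, \<open>v\<close>
  are orthogonal to \<open>B\<close>, the projection \<open>P\<close> enters as
  \<open>X ** gram_inv X ** X\<^sup>\<dagger>\<close>, whose complement is
  \<open>gram_inv (X\<^sup>\<dagger>)\<close>.\<close>

lemma chart_metric_eq:
  fixes B X u v :: "complex^'j^'n"
  assumes B: "B \<in> stiefel" and X: "B\<^sup>\<dagger> ** X = 0" and u: "B\<^sup>\<dagger> ** u = 0" and v: "B\<^sup>\<dagger> ** v = 0"
  shows "chart_metric B X u v = inner u (gram_inv (X\<^sup>\<dagger>) ** v ** gram_inv X)"
proof -
  let ?S = "horizontal_space B"
  have XS: "X \<in> ?S" by (simp add: horizontal_space_iff[OF B] X)
  have lim: "(0::real) islimpt {r. X + r *\<^sub>R w \<in> ?S}" if "B\<^sup>\<dagger> ** w = 0" for w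
  proof -
    have "{r. X + r *\<^sub>R w \<in> ?S} = UNIV"
      using that X by (auto simp: horizontal_space_iff[OF B] mat_simps)
    then show ?thesis by (simp add: islimpt_UNIV_iff)
  qed
  obtain e :: real and A :: "complex^'j^'n \<Rightarrow> complex^'j^'n"
    and K :: "complex^'j^'j" and L where e: "0 < e"
    "is_lift A (graph_chart B) (horizontal_space B \<inter> ball X e)" and
    AX: "A X = (B + X) ** K" and K: "K\<^sup>\<dagger> ** (mat 1 + X\<^sup>\<dagger> ** X) ** K = mat 1" and
    A': "(A has_derivative (\<lambda>w. w ** K + (B + X) ** L w)) (at X within horizontal_space B)"
    using graph_chart_lift[OF B X] by blast
  have St: "A X \<in> stiefel" using e XS by (auto simp: is_lift_def)
  have KK: "(K ** K\<^sup>\<dagger>) ** (mat 1 + X\<^sup>\<dagger> ** X) = mat 1" using K by (metis matrix_mul_assoc square_inverse_comm)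
  then have M: "gram_inv X = K ** K\<^sup>\<dagger>" by (rule gram_inv_unique)
  define P where "P = A X ** (A X)\<^sup>\<dagger>"
  have PA: "P ** (B + X) = B + X"
  proof -
    have "K ** (K\<^sup>\<dagger> ** (mat 1 + X\<^sup>\<dagger> ** X)) = mat 1" using KK by (simp add: matrix_mul_assoc)
    then have "B + X = A X ** (K\<^sup>\<dagger> ** (mat 1 + X\<^sup>\<dagger> ** X))" unfolding AX by (metis matrix_mul_assoc matrix_mul_rid)
    then show ?thesis unfolding P_def using stiefelD[OF St] by (metis matrix_mul_assoc)
  qed
  have hp: "horizontal_part (A X) (w ** K + (B + X) ** L w) = w ** K - P ** (w ** K)" if "B\<^sup>\<dagger> ** w = 0" for w
  proof -
    have tan: "w ** K + (B + X) ** L w \<in> stiefel_tangent (A X)"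
      using lift_proj_derivative(2)[OF e XS A' lim[OF that]] .
    have "P ** ((B + X) ** L w) = (B + X) ** L w" by (simp add: matrix_mul_assoc PA)
    then show ?thesis
      unfolding horizontal_part_eq[OF St tan] matrix_mul_assoc P_def[symmetric]
      by (simp add: matrix_add_ldistrib matrix_mul_assoc)
  qed
  have PP: "P\<^sup>\<dagger> = P" "P ** P = P" using St by (simp_all add: P_def mat_simps stiefelD)
  have Pv: "P ** v = (B + X) ** (gram_inv X ** (X\<^sup>\<dagger> ** v))"
    by (simp add: P_def AX M mat_simps v)
  have "chart_metric B X u v = inner (u ** K - P ** (u ** K)) (v ** K - P ** (v ** K))"
    unfolding chart_metric_def pullback_metric_lift[OF e XS A' lim[OF u] lim[OF v]]
    by (simp add: quotient_metric_def hp u v)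
  also have "\<dots> = inner (u ** K) (v ** K - P ** (v ** K))"
  proof -
    have "P ** (v ** K - P ** (v ** K)) = 0" using PP by (simp add: mat_simps) (simp add: matrix_mul_assoc)
    then show ?thesis by (simp add: inner_diff_left inner_matrix_left PP)
  qed
  also have "\<dots> = inner u (v ** gram_inv X - P ** v ** gram_inv X)"
    unfolding inner_matrix_right M by (simp add: mat_simps)
  also have "\<dots> = inner u (v ** gram_inv X) - inner u ((B + X) ** (gram_inv X ** (X\<^sup>\<dagger> ** v ** gram_inv X)))"
    unfolding Pv inner_diff_right by (simp add: matrix_mul_assoc)
  also have "inner u ((B + X) ** (gram_inv X ** (X\<^sup>\<dagger> ** v ** gram_inv X)))
      = inner u (X ** (gram_inv X ** (X\<^sup>\<dagger> ** v ** gram_inv X)))"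
  proof -
    have "inner u (B ** Z) = 0" for Z using inner_matrix_left[of B Z u] u by (simp add: inner_commute)
    then show ?thesis by (simp add: matrix_add_rdistrib inner_add_right)
  qed
  finally show ?thesis
    unfolding gram_inv_adjoint by (simp add: mat_simps inner_diff_right)
qed

section \<open>The geodesic equation\<close>

lemma gram_inv_line_derivative:
  "((\<lambda>r. gram_inv (X + r *\<^sub>R w)) has_vector_derivative
    - (gram_inv X ** (w\<^sup>\<dagger> ** X + X\<^sup>\<dagger> ** w) ** gram_inv X)) (at 0)"
proof -
  have l: "((\<lambda>r. X + r *\<^sub>R w) has_vector_derivative w) (at 0)"
    by (auto intro!: derivative_eq_intros)
  have "((\<lambda>r. (X + r *\<^sub>R w)\<^sup>\<dagger> ** (X + r *\<^sub>R w)) has_vector_derivative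
      (X + 0 *\<^sub>R w)\<^sup>\<dagger> ** w + w\<^sup>\<dagger> ** (X + 0 *\<^sub>R w)) (at 0)"
    by (rule matrix_mult.has_vector_derivative[OF
          bounded_linear.has_vector_derivative[OF bounded_linear_ctranspose l] l])
  from has_vector_derivative_add[OF has_vector_derivative_const this]
  have g: "((\<lambda>r. mat 1 + (X + r *\<^sub>R w)\<^sup>\<dagger> ** (X + r *\<^sub>R w)) has_vector_derivative
      w\<^sup>\<dagger> ** X + X\<^sup>\<dagger> ** w) (at 0)"
    by (simp add: add.commute)
  from matrix_inverse_derivative[OF UNIV_I g gram_inv(1)] show ?thesis by simp
qed

lemma chart_metric_line_derivative:
  fixes B X u v w :: "complex^'j^'n"
  assumes B: "B \<in> stiefel" and X: "B\<^sup>\<dagger> ** X = 0" and u: "B\<^sup>\<dagger> ** u = 0" and v: "B\<^sup>\<dagger> ** v = 0"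
    and w: "B\<^sup>\<dagger> ** w = 0"
  shows "deriv (\<lambda>r. chart_metric B (X + r *\<^sub>R w) u v) 0 =
    - inner u (gram_inv (X\<^sup>\<dagger>) ** (w ** X\<^sup>\<dagger> + X ** w\<^sup>\<dagger>) ** gram_inv (X\<^sup>\<dagger>) ** v ** gram_inv X)
    - inner u (gram_inv (X\<^sup>\<dagger>) ** v ** gram_inv X ** (w\<^sup>\<dagger> ** X + X\<^sup>\<dagger> ** w) ** gram_inv X)"
    (is "_ = ?d")
proof (rule DERIV_imp_deriv)
  have "B\<^sup>\<dagger> ** (X + r *\<^sub>R w) = 0" for r using X w by (simp add: mat_simps)
  then have eq: "chart_metric B (X + r *\<^sub>R w) u v
      = inner u (gram_inv (X\<^sup>\<dagger> + r *\<^sub>R w\<^sup>\<dagger>) ** v ** gram_inv (X + r *\<^sub>R w))" for r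
    using chart_metric_eq[OF B _ u v, of "X + r *\<^sub>R w"] by (simp add: ct_add ct_scaleR)
  note K' = bounded_linear.has_vector_derivative[OF matrix_mult.bounded_linear_left
      gram_inv_line_derivative[of "X\<^sup>\<dagger>" "w\<^sup>\<dagger>"], of v]
  have "((\<lambda>r. inner u (gram_inv (X\<^sup>\<dagger> + r *\<^sub>R w\<^sup>\<dagger>) ** v ** gram_inv (X + r *\<^sub>R w))) has_vector_derivative ?d) (at 0)"
    by (rule has_vector_derivative_eq_rhs[OF bounded_linear.has_vector_derivative[OF bounded_linear_inner_right
          matrix_mult.has_vector_derivative[OF K' gram_inv_line_derivative[of X w]]]])
      (simp add: mat_simps inner_diff_right inner_add_right)
  then show "((\<lambda>r. chart_metric B (X + r *\<^sub>R w) u v) has_real_derivative ?d) (at 0)"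
    unfolding eq has_real_derivative_iff_has_vector_derivative .
qed

text \<open>The geodesic equation in the graph chart is \<open>x'' = 2 x' (I + x\<^sup>* x)\<^sup>-\<^sup>1 x\<^sup>* x'\<close>.\<close>

lemma christoffel_graph_chart:
  fixes B X u w :: "complex^'j^'n"
  assumes B: "B \<in> stiefel" and X: "B\<^sup>\<dagger> ** X = 0" and u: "B\<^sup>\<dagger> ** u = 0" and w: "B\<^sup>\<dagger> ** w = 0"
  shows "christoffel1 (chart_metric B) X u u w
    = - 2 * chart_metric B X (u ** gram_inv X ** X\<^sup>\<dagger> ** u) w"
proof -
  let ?K = "gram_inv (X\<^sup>\<dagger>)" and ?M = "gram_inv X"
  have XK: "X\<^sup>\<dagger> ** ?K = ?M ** X\<^sup>\<dagger>"
    using arg_cong[OF gram_inv_intertwine[of X], of ctranspose] by (simp add: ct_mult)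
  have XK': "X\<^sup>\<dagger> ** (?K ** Z) = ?M ** (X\<^sup>\<dagger> ** Z)" for Z :: "complex^'j^'n"
    using XK by (simp add: matrix_mul_assoc)
  have KX': "?K ** (X ** Z) = X ** (?M ** Z)" for Z :: "complex^'j^'j"
    using gram_inv_intertwine[of X] by (simp add: matrix_mul_assoc)
  \<comment> \<open>The next two rules isolate \<open>w\<close> in the second argument of
    \<open>inner\<close>, so that terms can be compared.\<close>
  have mv: "inner u (C ** w ** D) = inner (C\<^sup>\<dagger> ** u ** D\<^sup>\<dagger>) w" for C :: "complex^'n^'n" and D :: "complex^'j^'j"
    using inner_matrix_left[of "C\<^sup>\<dagger>" "u ** D\<^sup>\<dagger>" w] inner_matrix_right[of u "D\<^sup>\<dagger>" "C ** w"]
    by (simp add: mat_simps)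
  have mv': "inner u (C ** w\<^sup>\<dagger> ** D) = inner (D ** u\<^sup>\<dagger> ** C) w" for C D :: "complex^'j^'n"
  proof -
    have "inner u (C ** w\<^sup>\<dagger> ** D) = inner (C ** (w\<^sup>\<dagger> ** D)) u"
      by (subst inner_commute) (simp add: matrix_mul_assoc)
    also have "\<dots> = inner (w\<^sup>\<dagger> ** D) (C\<^sup>\<dagger> ** u)" by (rule inner_matrix_left)
    also have "\<dots> = inner (w\<^sup>\<dagger>) (C\<^sup>\<dagger> ** u ** D\<^sup>\<dagger>)" by (rule inner_matrix_right)
    also have "\<dots> = inner w (D ** u\<^sup>\<dagger> ** C)"
      using inner_ct_ct[of w "D ** u\<^sup>\<dagger> ** C"] by (simp add: mat_simps)
    finally show ?thesis by (simp add: inner_commute)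
  qed
  \<comment> \<open>Only these three scalars occur. Each derivative along \<open>u\<close>
    contributes \<open>- 2 * a - b - c\<close>, the one along \<open>w\<close> is
    \<open>- 2 * b - 2 * c\<close>, so \<open>b\<close> and \<open>c\<close> cancel in the
    Christoffel symbol and \<open>- 2 * a\<close> remains.\<close>
  define a where "a = inner (?K ** u ** ?M ** X\<^sup>\<dagger> ** u ** ?M) w"
  define b where "b = inner (?K ** X ** u\<^sup>\<dagger> ** ?K ** u ** ?M) w"
  define c where "c = inner (?K ** u ** ?M ** u\<^sup>\<dagger> ** X ** ?M) w"
  have 1: "deriv (\<lambda>r. chart_metric B (X + r *\<^sub>R u) u w) 0 = - 2 * a - b - c"
  proof -
    have "inner u (?K ** (u ** X\<^sup>\<dagger> + X ** u\<^sup>\<dagger>) ** ?K ** w ** ?M) = a + b"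
      using mv[of "?K ** (u ** X\<^sup>\<dagger> + X ** u\<^sup>\<dagger>) ** ?K" ?M]
      by (simp add: a_def b_def mat_simps inner_add_left XK')
    moreover have "inner u (?K ** w ** ?M ** (u\<^sup>\<dagger> ** X + X\<^sup>\<dagger> ** u) ** ?M) = a + c"
      using mv[of ?K "?M ** (u\<^sup>\<dagger> ** X + X\<^sup>\<dagger> ** u) ** ?M"]
      by (simp add: a_def c_def mat_simps inner_add_left)
    ultimately show ?thesis
      unfolding chart_metric_line_derivative[OF B X u w u] by simp
  qed
  have 2: "deriv (\<lambda>r. chart_metric B (X + r *\<^sub>R w) u u) 0 = - 2 * b - 2 * c"
  proof -
    have "inner u (?K ** w ** (X\<^sup>\<dagger> ** ?K ** u ** ?M)) = c"
      using mv[of ?K "X\<^sup>\<dagger> ** ?K ** u ** ?M"] by (simp add: c_def mat_simps gram_inv_intertwine)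
    moreover have "inner u ((?K ** X) ** w\<^sup>\<dagger> ** (?K ** u ** ?M)) = c"
      using mv'[of "?K ** X" "?K ** u ** ?M"] by (simp add: c_def gram_inv_intertwine matrix_mul_assoc)
    moreover have "inner u ((?K ** u ** ?M) ** w\<^sup>\<dagger> ** (X ** ?M)) = b"
      using mv'[of "?K ** u ** ?M" "X ** ?M"] by (simp add: b_def gram_inv_intertwine matrix_mul_assoc)
    moreover have "inner u ((?K ** u ** ?M ** X\<^sup>\<dagger>) ** w ** ?M) = b"
      using mv[of "?K ** u ** ?M ** X\<^sup>\<dagger>" ?M] by (simp add: b_def mat_simps KX')
    ultimately show ?thesis
      unfolding chart_metric_line_derivative[OF B X u u w] by (simp add: mat_simps inner_add_right)
  qed
  have Y: "B\<^sup>\<dagger> ** (u ** ?M ** X\<^sup>\<dagger> ** u) = 0" using u by (simp add: matrix_mul_assoc matrix_zero_left)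
  have "chart_metric B X (u ** ?M ** X\<^sup>\<dagger> ** u) w = inner (u ** ?M ** X\<^sup>\<dagger> ** u) (?K ** (w ** ?M))"
    unfolding chart_metric_eq[OF B X Y w] by (simp add: matrix_mul_assoc)
  also have "\<dots> = a"
  proof -
    have "inner (?K ** (u ** ?M ** X\<^sup>\<dagger> ** u)) (w ** ?M) = inner (u ** ?M ** X\<^sup>\<dagger> ** u) (?K ** (w ** ?M))"
      using inner_matrix_left[of ?K "u ** ?M ** X\<^sup>\<dagger> ** u" "w ** ?M"] by simp
    moreover have "inner (?K ** (u ** ?M ** X\<^sup>\<dagger> ** u) ** ?M) w = inner (?K ** (u ** ?M ** X\<^sup>\<dagger> ** u)) (w ** ?M)"
      using inner_matrix_right[of "?K ** (u ** ?M ** X\<^sup>\<dagger> ** u)" ?M w] by simp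
    ultimately show ?thesis by (simp add: a_def matrix_mul_assoc)
  qed
  finally show ?thesis
    unfolding christoffel1_def 1 2 by simp
qed

lemma matrix_inv_mult:
  fixes A :: "complex^'j^'j"
  assumes "det A \<noteq> 0"
  shows "matrix_inv A ** A = mat 1" "A ** matrix_inv A = mat 1"
proof -
  have "invertible A" using assms invertible_det_nz by blast
  then show "matrix_inv A ** A = mat 1" "A ** matrix_inv A = mat 1"
    unfolding matrix_inv_def invertible_def by (metis (mono_tags, lifting) someI_ex)+
qed

text \<open>A horizontal curve of frames solving \<open>A'' = - A R\<close> with constant \<open>R\<close> has the chart expression
  \<open>x = A N - B\<close> with \<open>N = (B\<^sup>* A)\<^sup>-\<^sup>1\<close>; the terms with \<open>R\<close> cancel in \<open>x''\<close>.\<close>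

lemma horizontal_frame_geodesic:
  fixes A A' :: "real \<Rightarrow> complex^'j^'n" and R :: "complex^'j^'j"
  assumes St: "\<And>t. A t \<in> stiefel" and hor: "\<And>t. (A t)\<^sup>\<dagger> ** A' t = 0"
    and A': "\<And>t S. (A has_vector_derivative A' t) (at t within S)"
    and A'': "\<And>t S. (A' has_vector_derivative - (A t ** R)) (at t within S)"
  shows "geodesic TYPE('j) (\<lambda>t. col_space (A t)) I"
  unfolding geodesic_def
proof (intro ballI conjI allI impI)
  fix t show "col_space (A t) \<in> grassmannian TYPE('j)" by (rule stiefel_grassmannian[OF St])
  fix B :: "complex^'j^'n"
  assume "B \<in> stiefel \<and> col_space (A t) \<in> graph_chart B ` horizontal_space B"
  then obtain X where B: "B \<in> stiefel" and X: "B\<^sup>\<dagger> ** X = 0" "col_space (A t) = col_space (B + X)"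
    using horizontal_space_iff by (auto simp: graph_chart_def)
  \<comment> \<open>A subspace in the chart domain is a graph over \<open>col_space B\<close>, which
    makes the square matrix \<open>B\<^sup>\<dagger> ** A t\<close> invertible.\<close>
  have "A t ** ((A t)\<^sup>\<dagger> ** (B + X)) = B + X"
    using col_space_subset_project[OF _ St] X(2) by blast
  then have "(B\<^sup>\<dagger> ** A t) ** ((A t)\<^sup>\<dagger> ** (B + X)) = B\<^sup>\<dagger> ** (B + X)"
    by (simp only: matrix_mul_assoc[symmetric])
  also have "\<dots> = mat 1" by (simp add: matrix_add_ldistrib stiefelD[OF B] X(1))
  finally have "(B\<^sup>\<dagger> ** A t) ** ((A t)\<^sup>\<dagger> ** (B + X)) = mat 1" .
  then have det_t: "det (B\<^sup>\<dagger> ** A t) \<noteq> 0"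
    using invertible_det_nz square_inverse_comm unfolding invertible_def by blast
  define a where "a s = B\<^sup>\<dagger> ** A s" for s
  define a' where "a' s = B\<^sup>\<dagger> ** A' s" for s
  have da: "(a has_vector_derivative a' s) (at s within S)" for s S
    unfolding a_def[abs_def] a'_def
    by (rule bounded_linear.has_vector_derivative[OF matrix_mult.bounded_linear_right A'])
  have da': "(a' has_vector_derivative - (a s ** R)) (at s within S)" for s S
    using bounded_linear.has_vector_derivative[OF matrix_mult.bounded_linear_right A'', of "B\<^sup>\<dagger>"]
    unfolding a_def a'_def[abs_def] by (simp add: mat_simps)
  have "continuous_on UNIV a"
    using has_vector_derivative_continuous[OF da] by (auto simp: continuous_on_eq_continuous_within)
  then have entry: "continuous_on UNIV (\<lambda>s. a s $ i $ k)" for i k by (intro continuous_intros)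
  have "continuous_on UNIV (\<lambda>s. det (a s))"
    unfolding det_def
    by (intro continuous_on_sum continuous_on_mult continuous_on_const continuous_on_prod entry)
  then have "open {s. det (a s) \<noteq> 0}" by (intro open_Collect_neq continuous_on_const)
  then obtain e where e: "e > 0" "\<And>s. s \<in> ball t e \<Longrightarrow> det (a s) \<noteq> 0"
    using det_t unfolding open_contains_ball a_def by blast
  define N where "N s = matrix_inv (a s)" for s
  have N: "N s ** a s = mat 1" "a s ** N s = mat 1" if "s \<in> ball t e" for s
    using matrix_inv_mult[OF e(2)[OF that]] by (simp_all add: N_def)
  have dN: "(N has_vector_derivative - (N s ** a' s ** N s)) (at s within I)" if s: "s \<in> ball t e" for s
  proof -
    have "(N has_vector_derivative - (N s ** a' s ** N s)) (at s within ball t e)"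
      by (rule matrix_inverse_derivative[OF s da N(1)])
    then have "(N has_vector_derivative - (N s ** a' s ** N s)) (at s)"
      by (simp only: at_within_open[OF s open_ball])
    then show ?thesis by (rule has_vector_derivative_at_within)
  qed
  \<comment> \<open>\<open>A s ** N s\<close> is the frame of the same subspace whose product with
    \<open>B\<^sup>\<dagger>\<close> is \<open>mat 1\<close>, hence of the form
    \<open>B + x s\<close> with horizontal \<open>x s\<close>.\<close>
  define x where "x s = A s ** N s - B" for s
  define x' where "x' s = A' s ** N s - A s ** (N s ** (a' s ** N s))" for s
  define x'' where "x'' = - 2 *\<^sub>R (x' t ** (a' t ** N t))"
  have t: "t \<in> ball t e" using e(1) by simp
  have x_hor: "B\<^sup>\<dagger> ** x s = 0" if "s \<in> ball t e" for s
    using N(2)[OF that] by (simp add: x_def matrix_diff_ldistrib matrix_mul_assoc a_def stiefelD[OF B])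
  have x_chart: "graph_chart B (x s) = col_space (A s)" if "s \<in> ball t e" for s
    using col_space_mult_invertible[OF N(1)[OF that]] by (simp add: x_def graph_chart_def)
  have dx: "(x has_vector_derivative x' s) (at s within I)" if "s \<in> ball t e" for s
    unfolding x_def[abs_def] x'_def
    by (rule has_vector_derivative_eq_rhs[OF has_vector_derivative_diff[OF
          matrix_mult.has_vector_derivative[OF A' dN[OF that]] has_vector_derivative_const]])
      (simp add: mat_simps)
  have x'_hor: "B\<^sup>\<dagger> ** x' t = 0"
    using N(2)[OF t] by (simp add: x'_def matrix_diff_ldistrib matrix_mul_assoc a_def a'_def)
  have x''_hor: "B\<^sup>\<dagger> ** x'' = 0"
    using x'_hor by (simp add: x''_def matrix_scaleR_right matrix_minus_right matrix_mul_assoc matrix_zero_left)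
  \<comment> \<open>Used for the cancellation: \<open>- A R N\<close> comes from the derivative of
    \<open>A'\<close> and \<open>A N a R N\<close> from that of \<open>a'\<close>, and they match
    because \<open>N\<close> inverts \<open>a\<close>.\<close>
  have NaZ: "N t ** (a t ** Z) = Z" for Z :: "complex^'j^'j"
    using N(1)[OF t] by (simp add: matrix_mul_assoc)
  have dx': "(x' has_vector_derivative x'') (at t within I)"
  proof -
    note d1 = matrix_mult.has_vector_derivative[OF A'' dN[OF t]]
    note d2 = matrix_mult.has_vector_derivative[OF da' dN[OF t]]
    note d3 = matrix_mult.has_vector_derivative[OF dN[OF t] d2]
    note d4 = matrix_mult.has_vector_derivative[OF A' d3]
    have two: "A t ** (2 * Z) = 2 * (A t ** Z)" for Z
      unfolding mult_2 by (rule matrix_add_ldistrib)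
    show ?thesis
      unfolding x'_def[abs_def]
      by (rule has_vector_derivative_eq_rhs[OF has_vector_derivative_diff[OF d1 d4]])
        (simp add: x''_def x'_def mat_simps NaZ scaleR_2 scaleR_diff_right two)
  qed
  \<comment> \<open>\<open>B + x t = A t ** N t\<close> with a Stiefel factor, so its Gram matrix is
    \<open>(N t)\<^sup>\<dagger> ** N t\<close>.\<close>
  have gram: "gram_inv (x t) = a t ** (a t)\<^sup>\<dagger>"
  proof (rule gram_inv_unique)
    have "mat 1 + (x t)\<^sup>\<dagger> ** x t = (B + x t)\<^sup>\<dagger> ** (B + x t)"
      using x_hor[OF t] horizontal_adjoint[OF x_hor[OF t]] by (simp add: mat_simps stiefelD[OF B])
    also have "\<dots> = (N t)\<^sup>\<dagger> ** N t" by (simp add: x_def mat_simps stiefelD[OF St])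
    finally have "a t ** (a t)\<^sup>\<dagger> ** (mat 1 + (x t)\<^sup>\<dagger> ** x t) = a t ** ((N t ** a t)\<^sup>\<dagger> ** N t)"
      by (simp add: mat_simps)
    then show "a t ** (a t)\<^sup>\<dagger> ** (mat 1 + (x t)\<^sup>\<dagger> ** x t) = mat 1" by (simp add: N[OF t])
  qed
  have "(x t)\<^sup>\<dagger> ** x' t = (N t)\<^sup>\<dagger> ** ((A t)\<^sup>\<dagger> ** x' t) - B\<^sup>\<dagger> ** x' t" by (simp add: x_def mat_simps)
  \<comment> \<open>Horizontality of the frame curve enters here: the term with \<open>A' t\<close>
    drops out.\<close>
  also have "(A t)\<^sup>\<dagger> ** x' t = - (N t ** (a' t ** N t))"
    using hor[of t] by (simp add: x'_def matrix_diff_ldistrib matrix_mul_assoc matrix_zero_left stiefelD[OF St])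
  finally have xx': "(x t)\<^sup>\<dagger> ** x' t = - ((N t)\<^sup>\<dagger> ** (N t ** (a' t ** N t)))"
    by (simp add: x'_hor matrix_minus_right)
  have "gram_inv (x t) ** ((x t)\<^sup>\<dagger> ** x' t) = - (a t ** ((N t ** a t)\<^sup>\<dagger> ** (N t ** (a' t ** N t))))"
    unfolding gram xx' by (simp add: mat_simps)
  also have "\<dots> = - (a' t ** N t)" by (simp add: N[OF t] matrix_mul_assoc)
  finally have acc: "2 *\<^sub>R (x' t ** gram_inv (x t) ** (x t)\<^sup>\<dagger> ** x' t) = x''"
    unfolding x''_def by (simp add: matrix_mul_assoc[symmetric] matrix_minus_right)
  have geo: "chart_metric B (x t) x'' w + christoffel1 (chart_metric B) (x t) (x' t) (x' t) w = 0"
    if w: "w \<in> horizontal_space B" for w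
  proof -
    have w0: "B\<^sup>\<dagger> ** w = 0" using w horizontal_space_iff[OF B] by blast
    have Y: "B\<^sup>\<dagger> ** (x' t ** gram_inv (x t) ** (x t)\<^sup>\<dagger> ** x' t) = 0"
      using x'_hor by (simp add: matrix_mul_assoc matrix_zero_left)
    show ?thesis
      unfolding christoffel_graph_chart[OF B x_hor[OF t] x'_hor w0]
        chart_metric_eq[OF B x_hor[OF t] x''_hor w0] chart_metric_eq[OF B x_hor[OF t] Y w0]
      unfolding acc[symmetric] by simp
  qed
  show "\<exists>x x' x'' e. 0 < e
      \<and> (\<forall>s\<in>I \<inter> ball t e. x s \<in> horizontal_space B \<and> graph_chart B (x s) = col_space (A s)
            \<and> (x has_vector_derivative x' s) (at s within I))
      \<and> (x' has_vector_derivative x'') (at t within I)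
      \<and> (\<forall>w\<in>horizontal_space B. chart_metric B (x t) x'' w
            + christoffel1 (chart_metric B) (x t) (x' t) (x' t) w = 0)"
    using e(1) x_hor x_chart dx dx' geo horizontal_space_iff[OF B]
    by (intro exI[of _ x] exI[of _ x'] exI[of _ x''] exI[of _ e]) auto
qed

theorem theorem4p2:
  fixes A0 A1 :: "complex^'j::finite^'n::finite"
  assumes "CARD('j) \<le> CARD('n)"
    and "A0 \<in> stiefel" and "A1 \<in> stiefel"
  shows "(\<exists>U V Q \<theta>. svd_data A0 A1 U V Q \<theta>) \<and>
    (\<forall>U V Q \<theta>. svd_data A0 A1 U V Q \<theta> \<longrightarrow>
      (\<forall>t\<in>{0..1}. geodesic_lift A0 U Q \<theta> t \<in> stiefel) \<and>
      length_minimizing_geodesic_from_to TYPE('j) (col_space A0) (col_space A1)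
        (\<lambda>t. col_space (geodesic_lift A0 U Q \<theta> t)))"
proof (intro conjI allI impI)
  show "\<exists>U V Q \<theta>. svd_data A0 A1 U V Q \<theta>" by (rule svd_data_exists[OF assms])
next
  fix U V Q \<theta> assume "svd_data A0 A1 U V Q \<theta>"
  then interpret svd A0 A1 U V Q \<theta> using assms by unfold_locales
  show "\<forall>t\<in>{0..1}. A t \<in> stiefel" using A_stiefel by blast
  have "geodesic TYPE('j) (\<lambda>t. col_space (A t)) {0..1}"
    by (rule horizontal_frame_geodesic[OF A_stiefel A_horizontal A_derivative velocity_derivative])
  then show "length_minimizing_geodesic_from_to TYPE('j) (col_space A0) (col_space A1) (\<lambda>t. col_space (A t))"
    unfolding length_minimizing_geodesic_from_to_def
    using A_ends A_length_minimizing stiefel_grassmannian[OF A_stiefel] by blast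
qed

end
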